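(* Let $Q_d$ be the $d$-dimensional hypercube graph. As $d\to\infty$, \[ \frac{\pi^2}{6d}+o(d^{-1})\le \log c(Q_d) \le \left(\frac34+o(1)\right)\frac{\log d}{d}. \]
   Context: For a finite connected graph $G=(V,E)$ with a chosen root $r\in V$, let $P_G=\{x\in\mathbb{R}^V: x(r)=0,\ |x(u)-x(v)|\le1 \text{ for all } uv\in E\}$; the growth constant $c(G)>0$ is defined by $c(G)^{|V|-1}=\mathrm{Vol}(P_G)$ (volume in the coordinates of non-root vertices, independent of the root). Equivalently $c(G)^{|V|-1}=\lim_{h\to\infty}N_G(h)/h^{|V|-1}$, where $N_G(h)$ counts integer-valued functions $f$ on $V$ with $f(r)=0$ and $|f(u)-f(v)|\le h$ on edges. $Q_d$ has vertex set $\{0,1\}^d$, two vertices adjacent iff they differ in exactly one coordinate. *)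

theory Defs
  imports
    "HOL-Analysis.Analysis"
    "HOL-Library.Landau_Symbols"
    "Graph_Theory.Graph_Theory"
begin

text \<open>
  Finite simple graphs are rendered by the locale \<^locale>\<open>pair_graph\<close>: an undirected edge $uv$ is
  the pair of arcs $(u,v)$, $(v,u)$. Elements of $\mathbb{R}^V$ are functions that are
  \<^const>\<open>undefined\<close> outside $V$.
\<close>

definition lipschitz_polytope :: "'a pair_pre_digraph \<Rightarrow> 'a \<Rightarrow> ('a \<Rightarrow> real) set" where
  "lipschitz_polytope G r =
     {x \<in> pverts G \<rightarrow>\<^sub>E UNIV. x r = 0 \<and> (\<forall>(u, v) \<in> parcs G. \<bar>x u - x v\<bar> \<le> 1)}"

definition lipschitz_volume :: "'a pair_pre_digraph \<Rightarrow> 'a \<Rightarrow> real" where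
  "lipschitz_volume G r =
     measure (\<Pi>\<^sub>M v \<in> pverts G - {r}. lborel)
       ((\<lambda>x. restrict x (pverts G - {r})) ` lipschitz_polytope G r)"

definition growth_constant :: "'a pair_pre_digraph \<Rightarrow> 'a \<Rightarrow> real" where
  "growth_constant G r = root (card (pverts G) - 1) (lipschitz_volume G r)"

lemma growth_constant_power:
  assumes "card (pverts G) > 1"
  shows "growth_constant G r ^ (card (pverts G) - 1) = lipschitz_volume G r"
  using assms by (simp add: growth_constant_def lipschitz_volume_def real_root_pow_pos2)

definition hypercube :: "nat \<Rightarrow> (nat \<Rightarrow> nat) pair_pre_digraph" where
  "hypercube d =
     \<lparr> pverts = {..<d} \<rightarrow>\<^sub>E {0, 1},
       parcs = {(u, v). u \<in> {..<d} \<rightarrow>\<^sub>E {0, 1} \<and> v \<in> {..<d} \<rightarrow>\<^sub>E {0, 1} \<and>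
                        card {i \<in> {..<d}. u i \<noteq> v i} = 1} \<rparr>"

lemma pair_graph_hypercube: "pair_graph (hypercube d)"
proof -
  have comm: "{i \<in> {..<d}. u i \<noteq> v i} = {i \<in> {..<d}. v i \<noteq> u i}" for u v :: "nat \<Rightarrow> nat"
    by (intro Collect_cong) metis
  have arcsD: "u \<in> pverts (hypercube d)" "v \<in> pverts (hypercube d)"
      "(v, u) \<in> parcs (hypercube d)" "u \<noteq> v"
    if "(u, v) \<in> parcs (hypercube d)" for u v
    using that comm[of u v] by (simp_all add: hypercube_def) (elim conjE, force)
  have fin: "finite (pverts (hypercube d))"
    by (simp add: hypercube_def finite_PiE)
  show ?thesis
  proof
    show "finite (pverts (hypercube d))"
      by (rule fin)
    have "parcs (hypercube d) \<subseteq> pverts (hypercube d) \<times> pverts (hypercube d)"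
      using arcsD(1,2) by fast
    with fin show "finite (parcs (hypercube d))"
      by (meson finite_SigmaI finite_subset)
    have "arcs_ends (with_proj (hypercube d)) = parcs (hypercube d)"
      by (simp add: arcs_ends_def arc_to_ends_def)
    then show "symmetric (with_proj (hypercube d))"
      unfolding symmetric_def using arcsD(3) by (metis symI)
    fix e
    assume e: "e \<in> parcs (hypercube d)"
    show "fst e \<in> pverts (hypercube d)" "snd e \<in> pverts (hypercube d)" "fst e \<noteq> snd e"
      using arcsD(1,2,4)[of "fst e" "snd e"] e by simp_all
  qed
qed

lemma card_hypercube: "card (pverts (hypercube d)) = 2 ^ d"
  by (simp add: hypercube_def card_PiE numeral_2_eq_2)

lemma connected_hypercube: "Digraph_Component.connected (with_proj (hypercube d))"
proof -
  interpret pair_graph "hypercube d" by (rule pair_graph_hypercube)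
  have reach: "u \<rightarrow>\<^sup>*\<^bsub>with_proj (hypercube d)\<^esub> v"
    if "card {i \<in> {..<d}. u i \<noteq> v i} = n"
       "u \<in> pverts (hypercube d)" "v \<in> pverts (hypercube d)" for n u v
    using that
  proof (induction n arbitrary: u)
    case 0
    from 0(1) have "u i = v i" if "i \<in> {..<d}" for i
      using that by fastforce
    moreover have "u \<in> {..<d} \<rightarrow>\<^sub>E {0, 1}" "v \<in> {..<d} \<rightarrow>\<^sub>E {0, 1}"
      using 0(2,3) by (simp_all add: hypercube_def)
    ultimately have "u = v"
      by (metis PiE_ext)
    then show ?case
      using reachable_refl[OF 0(2)] by simp
  next
    case (Suc n)
    from Suc.prems(1) have "{i \<in> {..<d}. u i \<noteq> v i} \<noteq> {}"
      by (metis card.empty nat.distinct(1))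
    then obtain i where i: "i < d" "u i \<noteq> v i"
      by blast
    define w where "w = u(i := v i)"
    have w: "w \<in> pverts (hypercube d)"
      using Suc.prems(2,3) i(1) unfolding w_def hypercube_def
      by (simp add: PiE_iff extensional_def)
    have eq: "{j \<in> {..<d}. u j \<noteq> v j} = insert i {j \<in> {..<d}. w j \<noteq> v j}"
      using i by (auto simp: w_def)
    have "i \<notin> {j \<in> {..<d}. w j \<noteq> v j}"
      by (simp add: w_def)
    then have "card (insert i {j \<in> {..<d}. w j \<noteq> v j}) = Suc (card {j \<in> {..<d}. w j \<noteq> v j})"
      by (intro card_insert_disjoint) auto
    then have "card {j \<in> {..<d}. w j \<noteq> v j} = n"
      using Suc.prems(1) unfolding eq by linarith
    from Suc.IH[OF this w Suc.prems(3)] have wv: "w \<rightarrow>\<^sup>*\<^bsub>with_proj (hypercube d)\<^esub> v" .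
    have "{j \<in> {..<d}. u j \<noteq> w j} = {i}"
      using i by (auto simp: w_def)
    then have "(u, w) \<in> parcs (hypercube d)"
      using Suc.prems(2) w by (simp add: hypercube_def)
    from adj_reachable_trans[OF this wv] show ?case .
  qed
  have "(\<lambda>i \<in> {..<d}. 0) \<in> pverts (hypercube d)"
    by (simp add: hypercube_def)
  then have ne: "verts (with_proj (hypercube d)) \<noteq> {}"
    by auto
  show ?thesis
    unfolding Digraph_Component.connected_def
  proof (rule strongly_connectedI)
    show "verts (with_proj (mk_symmetric (with_proj (hypercube d)))) \<noteq> {}"
      using ne by simp
    fix u v
    assume "u \<in> verts (with_proj (mk_symmetric (with_proj (hypercube d))))"
      "v \<in> verts (with_proj (mk_symmetric (with_proj (hypercube d))))"
    then have "u \<rightarrow>\<^sup>*\<^bsub>with_proj (hypercube d)\<^esub> v"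
      using reach[OF refl] by simp
    then show "u \<rightarrow>\<^sup>*\<^bsub>with_proj (mk_symmetric (with_proj (hypercube d)))\<^esub> v"
      by (rule reachable_mk_symmetricI)
  qed
qed

end

theory Submission
  imports Defs "HOL-Probability.Probability" "HOL-Real_Asymp.Real_Asymp"
begin

text \<open>
  Let \<open>A\<close> be the vertices at even distance from the root and \<open>B\<close> the others. Integrating out the values
  on \<open>B\<close> turns the volume into the integral of \<open>\<Prod>b\<in>B. slack (N b) x\<close> over \<open>x \<in> \<real>\<^sup>A\<close>, where the slack is
  two minus the range of \<open>x\<close> on the neighbourhood \<open>N b\<close>.

  Upper bound. Reduce \<open>x\<close> modulo \<open>L = 5\<close>. Since \<open>L > 4\<close> a Lipschitz function is recovered from its
  residues and its value at the root, so the volume is at most an integral over the torus \<open>[0, L)\<^sup>A\<close>. Every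
  \<open>a \<in> A\<close> lies in exactly \<open>d\<close> neighbourhoods, so Finner's inequality bounds this integral by the \<open>|B|/d\<close>-th
  power of the corresponding integral for the complete bipartite graph with \<open>d + d\<close> vertices, which is
  of order \<open>d\<^sup>2 \<integral> R\<^sup>d (2 - R)\<^sup>d dR\<close>, that is, of order \<open>d powr (3/2)\<close>.

  Lower bound. Sample the values on \<open>A\<close> independently from a law that is nearly uniform on \<open>[0, 1]\<close> but whose
  two edges are smoothed at scale \<open>1/d\<close>, and apply Jensen's inequality. For the optimal (Fermi-Dirac)
  profile the gain of entropy is \<open>- \<integral> ln (1 - exp (- t)) dt = pi\<^sup>2/6\<close> per edge, in units of \<open>1/d\<close>,
  while the expected logarithm of the slack vanishes to first order.
\<close>

subsection \<open>Finner's inequality\<close>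

text \<open>The torus is a remedy for translation invariance: a slack does not change when all its
  arguments are shifted, so its powers have infinite integral over all real arguments, and pinning
  the root cures only the neighbourhoods that contain it. On the torus every factor is integrable
  and all vertices are treated alike. The leading constants appear on dividing by 2^d - 1, since
  each class has 2^(d-1) vertices. Above, half of ln (d powr (3/2)) / d is (3/4) ln d / d. Below,
  every vertex of A has two soft edges, so 2^(d-1) * 2 * (pi^2/6) / d becomes pi^2 / (6 d). In the
  lower bound, widening the law gains entropy but also widens the range over a neighbourhood. The
  balance exp (l t) (1 - exp (- t)) = 1 is the largest l for which the first-order loss is still
  compensated. Its position variable is x = ln (exp t - 1), in which the density is exp x / (1 + exp
  x), the Fermi-Dirac function. This l is infinite at t = 0 and has no bounded support, so it is
  only approximated by admissible profiles; a fixed profile for each tolerance gives an error o(1/d)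
  without a rate.\<close>

definition eroot :: "nat \<Rightarrow> ennreal \<Rightarrow> ennreal" where
  "eroot n x = (if x = \<top> then \<top> else ennreal (root n (enn2real x)))"

lemma eroot_power: "n > 0 \<Longrightarrow> eroot n (x ^ n) = x"
  by (cases x) (auto simp: eroot_def ennreal_power real_root_power_cancel top_power_ennreal)

lemma eroot_mono: "n > 0 \<Longrightarrow> x \<le> y \<Longrightarrow> eroot n x \<le> eroot n y"
  by (cases x; cases y) (auto simp: eroot_def top_unique intro!: ennreal_leI)

lemma eroot_zero [simp]: "eroot n 0 = 0"
  by (simp add: eroot_def)

lemma eroot_eq_0_iff: "n > 0 \<Longrightarrow> eroot n x = 0 \<longleftrightarrow> x = 0"
  by (cases x) (auto simp: eroot_def ennreal_eq_0_iff)

lemma eroot_ennreal: "x \<ge> 0 \<Longrightarrow> eroot n (ennreal x) = ennreal (root n x)"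
  by (simp add: eroot_def)

lemma borel_measurable_eroot [measurable]:
  assumes "n > 0" and [measurable]: "f \<in> borel_measurable M"
  shows "(\<lambda>x. eroot n (f x)) \<in> borel_measurable M"
proof -
  have [measurable]: "root n \<in> borel_measurable borel"
    by (intro borel_measurable_continuous_onI continuous_intros)
  show ?thesis unfolding eroot_def by measurable
qed

text \<open>This is AM-GM for the quotients \<open>g j / c j\<close>. With the integrals of the
  \<open>g j\<close> as \<open>c j\<close>, the mean on the right integrates to 1, which gives
  Hoelder's inequality. \<open>eroot\<close> keeps \<top> at \<top> (\<open>enn2real\<close> would
  send it to 0), so an infinite \<open>g j\<close> makes the right side infinite.\<close>

lemma prod_eroot_le_mean:
  assumes J: "finite J" "card J = n" "n > 0"
    and c: "\<And>j. j \<in> J \<Longrightarrow> c j \<noteq> 0" "\<And>j. j \<in> J \<Longrightarrow> c j \<noteq> \<top>"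
  shows "(\<Prod>j\<in>J. eroot n (g j)) \<le> (\<Prod>j\<in>J. eroot n (c j)) * ((\<Sum>j\<in>J. g j / c j) / of_nat n)"
proof (cases "\<exists>j\<in>J. g j = \<top>")
  case True
  then obtain j where j: "j \<in> J" "g j = \<top>" by auto
  have "g j / c j = \<top>" using j c by (simp add: ennreal_top_divide)
  then have "(\<Sum>j\<in>J. g j / c j) = \<top>"
    using j J(1) by (subst sum.remove[of J j]) auto
  then have "(\<Sum>j\<in>J. g j / c j) / of_nat n = \<top>" by (simp add: ennreal_top_divide)
  moreover have "(\<Prod>j\<in>J. eroot n (c j)) \<noteq> 0"
    using J c by (simp add: eroot_eq_0_iff)
  ultimately show ?thesis by (metis ennreal_mult_top top_greatest)
next
  case False
  define a where "a j = enn2real (g j)" for j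
  define b where "b j = enn2real (c j)" for j
  have g: "g j = ennreal (a j)" if "j \<in> J" for j
    using False that by (auto simp: a_def less_top)
  have cb: "c j = ennreal (b j)" if "j \<in> J" for j
    using c that by (auto simp: b_def less_top)
  have a: "a j \<ge> 0" for j by (simp add: a_def)
  have b: "b j > 0" if "j \<in> J" for j
    using c that by (simp add: b_def enn2real_positive_iff less_top zero_less_iff_neq_zero)
  have ab: "a j / b j \<ge> 0" if "j \<in> J" for j
    using a b[OF that] by (simp add: less_imp_le)
  have "root n (\<Prod>j\<in>J. a j / b j) = (\<Prod>j\<in>J. a j / b j) powr (1 / n)"
    using prod_nonneg[of J "\<lambda>j. a j / b j"] ab \<open>n > 0\<close>
    by (cases "(\<Prod>j\<in>J. a j / b j) = 0") (simp_all add: root_powr_inverse)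
  also have "\<dots> \<le> (\<Sum>j\<in>J. a j / b j / card J)"
    using J ab arith_geom_mean[of J "\<lambda>j. a j / b j"] by fastforce
  finally have "root n (\<Prod>j\<in>J. a j / b j) \<le> (\<Sum>j\<in>J. a j / b j) / n"
    using J by (simp add: sum_divide_distrib)
  then have "(\<Prod>j\<in>J. root n (a j)) \<le> (\<Prod>j\<in>J. root n (b j)) * ((\<Sum>j\<in>J. a j / b j) / n)"
    (is "?l \<le> _")
  proof -
    have pb: "(\<Prod>j\<in>J. root n (b j)) > 0"
      using b J by (intro prod_pos) auto
    have rp: "root n (\<Prod>j\<in>J. f j) = (\<Prod>j\<in>J. root n (f j))" for f
      using J(1) \<open>n > 0\<close> by induction (auto simp: real_root_mult real_root_one)
    have "root n (\<Prod>j\<in>J. a j / b j) = ?l / (\<Prod>j\<in>J. root n (b j))"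
      by (simp add: rp real_root_divide prod_dividef)
    with \<open>root n (\<Prod>j\<in>J. a j / b j) \<le> _\<close>
    have "?l / (\<Prod>j\<in>J. root n (b j)) \<le> (\<Sum>j\<in>J. a j / b j) / n" by linarith
    then show ?thesis
      unfolding pos_divide_le_eq[OF pb] by (simp only: mult.commute)
  qed
  then have "ennreal ?l \<le> ennreal ((\<Prod>j\<in>J. root n (b j)) * ((\<Sum>j\<in>J. a j / b j) / n))"
    by (rule ennreal_leI)
  also have "\<dots> = (\<Prod>j\<in>J. eroot n (c j)) * ((\<Sum>j\<in>J. g j / c j) / of_nat n)"
  proof -
    have "(\<Sum>j\<in>J. g j / c j) = (\<Sum>j\<in>J. ennreal (a j / b j))"
      using g cb a b by (intro sum.cong) (auto simp: divide_ennreal)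
    also have "\<dots> = ennreal (\<Sum>j\<in>J. a j / b j)"
      using a b by (intro sum_ennreal) (auto intro!: divide_nonneg_pos)
    finally have 1: "(\<Sum>j\<in>J. g j / c j) / of_nat n = ennreal ((\<Sum>j\<in>J. a j / b j) / n)"
      using \<open>n > 0\<close> a b by (simp add: ennreal_of_nat_eq_real_of_nat divide_ennreal sum_nonneg divide_nonneg_pos)
    have "(\<Prod>j\<in>J. eroot n (c j)) = (\<Prod>j\<in>J. ennreal (root n (b j)))"
      using cb b by (intro prod.cong) (auto simp: eroot_ennreal less_imp_le)
    also have "\<dots> = ennreal (\<Prod>j\<in>J. root n (b j))"
      by (intro prod_ennreal) (simp add: b_def real_root_pos_pos_le)
    finally show ?thesis unfolding 1
      using a b by (subst ennreal_mult) (auto intro!: prod_nonneg divide_nonneg_nonneg sum_nonneg real_root_pos_pos_le simp: b_def)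
  qed
  also have "ennreal ?l = (\<Prod>j\<in>J. eroot n (g j))"
    using g a by (subst prod_ennreal[symmetric]) (auto intro!: prod.cong real_root_pos_pos_le simp: eroot_ennreal)
  finally show ?thesis .
qed

text \<open>Hoelder's inequality with n equal exponents 1/n. A vanishing integral is treated before
  an infinite one: it makes the product vanish almost everywhere, in accordance with 0 * \<top> = 0.
  In the remaining case AM-GM is integrated.\<close>

lemma nn_integral_prod_eroot_le:
  assumes J: "finite J" "card J = n" "n > 0"
    and [measurable]: "\<And>j. j \<in> J \<Longrightarrow> g j \<in> borel_measurable M"
  shows "(\<integral>\<^sup>+x. (\<Prod>j\<in>J. eroot n (g j x)) \<partial>M) \<le> (\<Prod>j\<in>J. eroot n (\<integral>\<^sup>+x. g j x \<partial>M))"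
proof -
  define c where "c j = (\<integral>\<^sup>+x. g j x \<partial>M)" for j
  note [measurable] = borel_measurable_eroot[OF \<open>n > 0\<close>]
  consider j where "j \<in> J" "c j = 0"
    | j where "j \<in> J" "c j = \<top>" "\<And>j. j \<in> J \<Longrightarrow> c j \<noteq> 0"
    | "\<And>j. j \<in> J \<Longrightarrow> c j \<noteq> 0" "\<And>j. j \<in> J \<Longrightarrow> c j \<noteq> \<top>"
    by metis
  then show ?thesis
  proof cases
    case 1
    then have "AE x in M. g j x = 0"
      by (simp add: c_def nn_integral_0_iff_AE)
    then have "AE x in M. (\<Prod>j\<in>J. eroot n (g j x)) = 0"
      by eventually_elim (use 1 J in \<open>auto intro!: prod_zero bexI[of _ j]\<close>)
    then have "(\<integral>\<^sup>+x. (\<Prod>j\<in>J. eroot n (g j x)) \<partial>M) = (\<integral>\<^sup>+x. 0 \<partial>M)"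
      by (rule nn_integral_cong_AE)
    then show ?thesis by simp
  next
    case 2
    have "(\<Prod>j\<in>J. eroot n (c j)) = eroot n (c j) * (\<Prod>j\<in>J - {j}. eroot n (c j))"
      using 2 J by (simp add: prod.remove)
    moreover have "(\<Prod>j\<in>J - {j}. eroot n (c j)) \<noteq> 0"
      using 2 J by (simp add: eroot_eq_0_iff)
    moreover have "eroot n (c j) = \<top>" using 2 by (simp add: eroot_def)
    ultimately have "(\<Prod>j\<in>J. eroot n (c j)) = \<top>" by (simp add: ennreal_top_mult)
    then show ?thesis by (simp add: c_def)
  next
    case 3
    have "(\<integral>\<^sup>+x. (\<Prod>j\<in>J. eroot n (g j x)) \<partial>M) \<le>
        (\<integral>\<^sup>+x. (\<Prod>j\<in>J. eroot n (c j)) * ((\<Sum>j\<in>J. g j x / c j) / of_nat n) \<partial>M)"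
      using 3 by (intro nn_integral_mono prod_eroot_le_mean J)
    also have "\<dots> = (\<Prod>j\<in>J. eroot n (c j)) * ((\<Sum>j\<in>J. c j / c j) / of_nat n)"
      by (simp add: nn_integral_cmult nn_integral_divide nn_integral_sum c_def)
    also have "(\<Sum>j\<in>J. c j / c j) = (\<Sum>j\<in>J. 1)"
      using 3 by (intro sum.cong) (auto simp: ennreal_divide_self less_top)
    also have "(\<Sum>j\<in>J. 1) / of_nat n = (1::ennreal)"
      using J by (simp add: ennreal_divide_self of_nat_less_top)
    finally show ?thesis by (simp add: c_def)
  qed
qed

text \<open>Induction on the set of coordinates. Exactly n factors depend on a given coordinate a,
  and the others are constant in it; Hoelder with exponents 1/n therefore moves the integral over a
  inside the n roots. What remains is the same kind of integral over the other coordinates, with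
  unchanged degrees.\<close>

theorem finner_inequality:
  fixes S :: "'b \<Rightarrow> 'a set"
  assumes M: "\<And>i. sigma_finite_measure (M i)"
    and fin: "finite A" "finite B" and n: "n > 0"
    and S: "\<And>b. b \<in> B \<Longrightarrow> S b \<subseteq> A"
    and deg: "\<And>a. a \<in> A \<Longrightarrow> card {b\<in>B. a \<in> S b} = n"
    and G: "\<And>b. b \<in> B \<Longrightarrow> G b \<in> borel_measurable (Pi\<^sub>M (S b) M)"
  shows "(\<integral>\<^sup>+x. (\<Prod>b\<in>B. eroot n (G b (restrict x (S b)))) \<partial>Pi\<^sub>M A M)
    \<le> (\<Prod>b\<in>B. eroot n (\<integral>\<^sup>+x. G b x \<partial>Pi\<^sub>M (S b) M))"
  using fin(1) S deg G
proof (induction A arbitrary: S G rule: finite_induct)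
  case empty
  interpret product_sigma_finite M by (rule product_sigma_finite.intro) (rule M)
  have "S b = {}" if "b \<in> B" for b using empty.prems(1)[OF that] by simp
  then show ?case
    by (simp add: PiM_empty nn_integral_count_space_finite cong: prod.cong)
next
  case (insert a A)
  interpret product_sigma_finite M by (rule product_sigma_finite.intro) (rule M)
  note [measurable] = borel_measurable_eroot[OF \<open>n > 0\<close>]
  define B1 where "B1 = {b\<in>B. a \<in> S b}"
  have B1: "finite B1" "card B1 = n" "B1 \<subseteq> B" using insert fin by (auto simp: B1_def)
  define S' where "S' b = S b - {a}" for b
  \<comment> \<open>The factors that see a are integrated over it, so the full integral of each
    factor stays the same (\<open>intG'\<close>).\<close>
  define G' where "G' b x = (if a \<in> S b then \<integral>\<^sup>+t. G b (x(a := t)) \<partial>M a else G b x)" for b x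
  have finS: "finite (S b)" if "b \<in> B" for b
    using insert.prems(1)[OF that] insert.hyps finite_subset by blast
  have ins: "insert a (S' b) = S b" if "b \<in> B1" for b using that by (auto simp: S'_def B1_def)
  have S'eq: "S' b = S b" if "b \<in> B - B1" for b using that by (auto simp: S'_def B1_def)
  have Gm [measurable]: "G b \<in> borel_measurable (Pi\<^sub>M (S b) M)" if "b \<in> B" for b
    using insert.prems(3) that by auto
  have Gm1 [measurable]: "G b \<in> borel_measurable (Pi\<^sub>M (insert a (S' b)) M)" if "b \<in> B1" for b
    using Gm B1 that ins by auto
  have G': "G' b \<in> borel_measurable (Pi\<^sub>M (S' b) M)" if "b \<in> B" for b
  proof (cases "b \<in> B1")
    case True
    note [measurable] = Gm1[OF True]
    have "(\<lambda>x. \<integral>\<^sup>+t. G b (x(a := t)) \<partial>M a) \<in> borel_measurable (Pi\<^sub>M (S' b) M)"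
      by measurable
    then show ?thesis using True by (simp add: G'_def[abs_def] B1_def)
  next
    case False
    then have "a \<notin> S b" using that by (simp add: B1_def)
    then show ?thesis using Gm[OF that] S'eq that False by (simp add: G'_def[abs_def])
  qed
  have intG': "(\<integral>\<^sup>+x. G' b x \<partial>Pi\<^sub>M (S' b) M) = (\<integral>\<^sup>+x. G b x \<partial>Pi\<^sub>M (S b) M)" if "b \<in> B" for b
  proof (cases "b \<in> B1")
    case True
    have "(\<integral>\<^sup>+x. G b x \<partial>Pi\<^sub>M (insert a (S' b)) M) = (\<integral>\<^sup>+x. (\<integral>\<^sup>+t. G b (x(a := t)) \<partial>M a) \<partial>Pi\<^sub>M (S' b) M)"
      using finS[OF that] Gm1[OF True] by (intro product_nn_integral_insert) (auto simp: S'_def)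
    then show ?thesis using True ins by (simp add: G'_def B1_def)
  next
    case False
    then have "a \<notin> S b" using that by (simp add: B1_def)
    then show ?thesis using S'eq that False by (simp add: G'_def)
  qed
  have r: "restrict (x(a := t)) (S b) = (if a \<in> S b then (restrict x (S' b))(a := t) else restrict x (S' b))"
    for x t b by (auto simp: S'_def restrict_def fun_eq_iff)
  have m: "(\<lambda>x. \<Prod>b\<in>B. eroot n (G b (restrict x (S b)))) \<in> borel_measurable (Pi\<^sub>M (insert a A) M)"
  proof (intro borel_measurable_prod_ennreal borel_measurable_eroot n)
    fix b assume "b \<in> B"
    then show "(\<lambda>x. G b (restrict x (S b))) \<in> borel_measurable (Pi\<^sub>M (insert a A) M)"
      using insert.prems(1) by (intro measurable_compose[OF measurable_restrict_subset Gm]) auto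
  qed
  have split: "(\<Prod>b\<in>B. f b) = (\<Prod>b\<in>B - B1. f b) * (\<Prod>b\<in>B1. f b)" for f :: "'b \<Rightarrow> ennreal"
    using B1 fin by (metis prod.subset_diff)
  have "(\<integral>\<^sup>+x. (\<Prod>b\<in>B. eroot n (G b (restrict x (S b)))) \<partial>Pi\<^sub>M (insert a A) M)
      = (\<integral>\<^sup>+x. (\<integral>\<^sup>+t. (\<Prod>b\<in>B. eroot n (G b (restrict (x(a := t)) (S b)))) \<partial>M a) \<partial>Pi\<^sub>M A M)"
    by (rule product_nn_integral_insert[OF insert.hyps m])
  also have "\<dots> \<le> (\<integral>\<^sup>+x. (\<Prod>b\<in>B. eroot n (G' b (restrict x (S' b)))) \<partial>Pi\<^sub>M A M)"
  proof (rule nn_integral_mono)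
    fix x assume x: "x \<in> space (Pi\<^sub>M A M)"
    have xS: "restrict x (S' b) \<in> space (Pi\<^sub>M (S' b) M)" if "b \<in> B" for b
      using x insert.prems(1)[OF that] by (auto simp: space_PiM S'_def PiE_iff)
    have mb: "(\<lambda>t. G b ((restrict x (S' b))(a := t))) \<in> borel_measurable (M a)" if "b \<in> B1" for b
    proof -
      have "(\<lambda>t. (restrict x (S' b))(a := t)) \<in> measurable (M a) (Pi\<^sub>M (insert a (S' b)) M)"
        using xS[of b] that B1 by (intro measurable_fun_upd[where J="S' b"]) auto
      from measurable_compose[OF this Gm1[OF that]] show ?thesis .
    qed
    have "(\<integral>\<^sup>+t. (\<Prod>b\<in>B. eroot n (G b (restrict (x(a := t)) (S b)))) \<partial>M a)
       = (\<integral>\<^sup>+t. (\<Prod>b\<in>B - B1. eroot n (G' b (restrict x (S' b)))) *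
            (\<Prod>b\<in>B1. eroot n (G b ((restrict x (S' b))(a := t)))) \<partial>M a)"
      unfolding split r
      by (intro nn_integral_cong arg_cong2[of _ _ _ _ "(*)"] prod.cong) (auto simp: G'_def B1_def)
    also have "\<dots> = (\<Prod>b\<in>B - B1. eroot n (G' b (restrict x (S' b)))) *
        (\<integral>\<^sup>+t. (\<Prod>b\<in>B1. eroot n (G b ((restrict x (S' b))(a := t)))) \<partial>M a)"
      by (intro nn_integral_cmult borel_measurable_prod_ennreal borel_measurable_eroot mb n)
    also have "\<dots> \<le> (\<Prod>b\<in>B - B1. eroot n (G' b (restrict x (S' b)))) *
        (\<Prod>b\<in>B1. eroot n (\<integral>\<^sup>+t. G b ((restrict x (S' b))(a := t)) \<partial>M a))"
      using mb B1 n by (intro mult_left_mono nn_integral_prod_eroot_le) auto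
    also have "\<dots> = (\<Prod>b\<in>B. eroot n (G' b (restrict x (S' b))))"
      unfolding split by (intro arg_cong2[of _ _ _ _ "(*)"] prod.cong) (auto simp: G'_def B1_def)
    finally show "(\<integral>\<^sup>+t. (\<Prod>b\<in>B. eroot n (G b (restrict (x(a := t)) (S b)))) \<partial>M a)
       \<le> (\<Prod>b\<in>B. eroot n (G' b (restrict x (S' b))))" .
  qed
  also have "\<dots> \<le> (\<Prod>b\<in>B. eroot n (\<integral>\<^sup>+x. G' b x \<partial>Pi\<^sub>M (S' b) M))"
  proof (rule insert.IH)
    show "S' b \<subseteq> A" if "b \<in> B" for b using insert.prems(1)[OF that] by (auto simp: S'_def)
    show "card {b \<in> B. a' \<in> S' b} = n" if "a' \<in> A" for a'
    proof -
      have "a' \<noteq> a" using that insert.hyps by auto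
      then have "{b \<in> B. a' \<in> S' b} = {b \<in> B. a' \<in> S b}" by (auto simp: S'_def)
      then show ?thesis using insert.prems(2) that by simp
    qed
  qed (use G' in auto)
  also have "\<dots> = (\<Prod>b\<in>B. eroot n (\<integral>\<^sup>+x. G b x \<partial>Pi\<^sub>M (S b) M))"
    by (intro prod.cong) (auto simp: intG')
  finally show ?case .
qed

subsection \<open>Integration over a tiled product space\<close>

lemma product_sigma_finite_lborel: "product_sigma_finite (\<lambda>_::'i. lborel :: real measure)"
  by (rule product_sigma_finite.intro) (rule lborel.sigma_finite_measure_axioms)

text \<open>A one-dimensional change of variables with weight \<open>v i\<close> is applied to one
  coordinate after another. Only an inequality is asked for, because a map may cover just a part of
  its target. It serves both for translations and for sampling through the map
  \<open>X n\<close>.\<close>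

lemma nn_integral_PiM_substitution_le:
  assumes M: "\<And>i. sigma_finite_measure (M i)" and N: "\<And>i. sigma_finite_measure (N i)"
    and X [measurable]: "\<And>i. i \<in> I \<Longrightarrow> X i \<in> measurable (N i) (M i)"
    and v [measurable]: "\<And>i. i \<in> I \<Longrightarrow> v i \<in> borel_measurable (N i)"
    and le: "\<And>i h. i \<in> I \<Longrightarrow> h \<in> borel_measurable (M i) \<Longrightarrow>
      (\<integral>\<^sup>+u. v i u * h (X i u) \<partial>N i) \<le> (\<integral>\<^sup>+x. h x \<partial>M i)"
    and I: "finite I" and H: "H \<in> borel_measurable (Pi\<^sub>M I M)"
  shows "(\<integral>\<^sup>+u. (\<Prod>i\<in>I. v i (u i)) * H (\<lambda>i\<in>I. X i (u i)) \<partial>Pi\<^sub>M I N) \<le> (\<integral>\<^sup>+x. H x \<partial>Pi\<^sub>M I M)"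
  using I X v le H
proof (induction I arbitrary: H rule: finite_induct)
  case empty
  then show ?case by (simp add: PiM_empty nn_integral_count_space_finite restrict_def)
next
  case (insert i I)
  interpret M: product_sigma_finite M by (rule product_sigma_finite.intro) (rule M)
  interpret N: product_sigma_finite N by (rule product_sigma_finite.intro) (rule N)
  note [measurable] = insert.prems(4)
  have [measurable]: "X i \<in> measurable (N i) (M i)" "v i \<in> borel_measurable (N i)"
    using insert.prems by auto
  have Xm [measurable]: "(\<lambda>u. \<lambda>j\<in>J. X j (u j)) \<in> measurable (Pi\<^sub>M J N) (Pi\<^sub>M J M)"
    if "J \<subseteq> insert i I" for J
    using that insert.prems(1) by (intro measurable_restrict) (auto intro!: measurable_compose[OF measurable_component_singleton])
  have vm [measurable]: "(\<lambda>u. \<Prod>j\<in>J. v j (u j)) \<in> borel_measurable (Pi\<^sub>M J N)"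
    if "J \<subseteq> insert i I" for J
    using that insert.prems(2) by (intro borel_measurable_prod_ennreal) (auto intro!: measurable_compose[OF measurable_component_singleton])
  have upd: "(\<lambda>j\<in>insert i I. X j ((u(i := t)) j)) = (\<lambda>j\<in>I. X j (u j))(i := X i t)" for u t
    using insert.hyps by (auto simp: fun_eq_iff)
  have pr: "(\<Prod>j\<in>insert i I. v j ((u(i := t)) j)) = (\<Prod>j\<in>I. v j (u j)) * v i t" for u t
  proof -
    have "(\<Prod>j\<in>I. v j ((u(i := t)) j)) = (\<Prod>j\<in>I. v j (u j))"
      using insert.hyps by (intro prod.cong) auto
    then show ?thesis using insert.hyps by (simp add: mult.commute)
  qed
  have "(\<integral>\<^sup>+u. (\<Prod>j\<in>insert i I. v j (u j)) * H (\<lambda>j\<in>insert i I. X j (u j)) \<partial>Pi\<^sub>M (insert i I) N) =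
     (\<integral>\<^sup>+u. (\<integral>\<^sup>+t. (\<Prod>j\<in>insert i I. v j ((u(i := t)) j)) *
        H (\<lambda>j\<in>insert i I. X j ((u(i := t)) j)) \<partial>N i) \<partial>Pi\<^sub>M I N)"
    by (intro N.product_nn_integral_insert insert.hyps borel_measurable_times_ennreal
        vm measurable_compose[OF Xm insert.prems(4)] order_refl)
  also have "\<dots> \<le> (\<integral>\<^sup>+u. (\<Prod>j\<in>I. v j (u j)) * (\<integral>\<^sup>+t. H ((\<lambda>j\<in>I. X j (u j))(i := t)) \<partial>M i) \<partial>Pi\<^sub>M I N)"
  proof (rule nn_integral_mono)
    fix u assume u: "u \<in> space (Pi\<^sub>M I N)"
    have sp: "(\<lambda>j\<in>I. X j (u j)) \<in> space (Pi\<^sub>M I M)"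
      by (rule measurable_space[OF Xm u]) auto
    have [measurable]: "(\<lambda>t. H ((\<lambda>j\<in>I. X j (u j))(i := t))) \<in> borel_measurable (M i)"
    proof -
      have "(\<lambda>t. (\<lambda>j\<in>I. X j (u j))(i := t)) \<in> measurable (M i) (Pi\<^sub>M (insert i I) M)"
        using sp by (intro measurable_fun_upd[where J=I]) auto
      from measurable_compose[OF this insert.prems(4)] show ?thesis .
    qed
    have "(\<integral>\<^sup>+t. (\<Prod>j\<in>insert i I. v j ((u(i := t)) j)) * H (\<lambda>j\<in>insert i I. X j ((u(i := t)) j)) \<partial>N i)
      = (\<integral>\<^sup>+t. (\<Prod>j\<in>I. v j (u j)) * (v i t * H ((\<lambda>j\<in>I. X j (u j))(i := X i t))) \<partial>N i)"
      unfolding upd pr by (simp add: mult.assoc)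
    also have "\<dots> = (\<Prod>j\<in>I. v j (u j)) * (\<integral>\<^sup>+t. v i t * H ((\<lambda>j\<in>I. X j (u j))(i := X i t)) \<partial>N i)"
      by (intro nn_integral_cmult) measurable
    also have "\<dots> \<le> (\<Prod>j\<in>I. v j (u j)) * (\<integral>\<^sup>+t. H ((\<lambda>j\<in>I. X j (u j))(i := t)) \<partial>M i)"
      by (intro mult_left_mono insert.prems(3)) auto
    finally show "(\<integral>\<^sup>+t. (\<Prod>j\<in>insert i I. v j ((u(i := t)) j)) * H (\<lambda>j\<in>insert i I. X j ((u(i := t)) j)) \<partial>N i) \<le>
       (\<Prod>j\<in>I. v j (u j)) * (\<integral>\<^sup>+t. H ((\<lambda>j\<in>I. X j (u j))(i := t)) \<partial>M i)" .
  qed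
  also have "\<dots> \<le> (\<integral>\<^sup>+x. (\<integral>\<^sup>+t. H (x(i := t)) \<partial>M i) \<partial>Pi\<^sub>M I M)"
  proof (rule insert.IH)
    show "(\<lambda>x. \<integral>\<^sup>+t. H (x(i := t)) \<partial>M i) \<in> borel_measurable (Pi\<^sub>M I M)"
      by measurable
  qed (use insert.prems in auto)
  also have "\<dots> = (\<integral>\<^sup>+x. H x \<partial>Pi\<^sub>M (insert i I) M)"
    by (rule M.product_nn_integral_insert[symmetric, OF insert.hyps insert.prems(4)])
  finally show ?case .
qed

lemma nn_integral_lborel_shift:
  fixes h :: "real \<Rightarrow> ennreal"
  assumes [measurable]: "h \<in> borel_measurable lborel"
  shows "(\<integral>\<^sup>+u. h (u + c) \<partial>lborel) = (\<integral>\<^sup>+x. h x \<partial>lborel)"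
  using nn_integral_real_affine[of h 1 c] by (simp add: add.commute)

text \<open>The inequality for the shift by c, together with the one for the shift by -c, gives
  equality.\<close>

lemma nn_integral_PiM_lborel_shift:
  fixes H :: "('i \<Rightarrow> real) \<Rightarrow> ennreal" and c :: "'i \<Rightarrow> real"
  assumes I: "finite I" and H: "H \<in> borel_measurable (Pi\<^sub>M I (\<lambda>_. lborel))"
  shows "(\<integral>\<^sup>+x. H (\<lambda>i\<in>I. x i + c i) \<partial>Pi\<^sub>M I (\<lambda>_. lborel)) = (\<integral>\<^sup>+x. H x \<partial>Pi\<^sub>M I (\<lambda>_. lborel))"
proof -
  have le: "(\<integral>\<^sup>+x. H (\<lambda>i\<in>I. x i + c i) \<partial>Pi\<^sub>M I (\<lambda>_. lborel)) \<le> (\<integral>\<^sup>+x. H x \<partial>Pi\<^sub>M I (\<lambda>_. lborel))"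
    if H: "H \<in> borel_measurable (Pi\<^sub>M I (\<lambda>_. lborel))" for H :: "('i \<Rightarrow> real) \<Rightarrow> ennreal" and c
    using nn_integral_PiM_substitution_le[where M="\<lambda>_. lborel" and N="\<lambda>_. lborel" and v="\<lambda>_ _. 1" and I=I
        and X="\<lambda>i u. u + c i", OF lborel.sigma_finite_measure_axioms lborel.sigma_finite_measure_axioms _ _ _ I H]
    by (simp add: nn_integral_lborel_shift)
  have m: "(\<lambda>x. \<lambda>i\<in>I. x i + c i) \<in> measurable (Pi\<^sub>M I (\<lambda>_. lborel)) (Pi\<^sub>M I (\<lambda>_. lborel :: real measure))"
    by (intro measurable_restrict) (auto intro!: borel_measurable_add measurable_component_singleton)
  have "(\<integral>\<^sup>+x. H x \<partial>Pi\<^sub>M I (\<lambda>_. lborel)) =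
     (\<integral>\<^sup>+x. H (\<lambda>i\<in>I. (\<lambda>i\<in>I. x i + - c i) i + c i) \<partial>Pi\<^sub>M I (\<lambda>_. lborel))"
    by (intro nn_integral_cong arg_cong[of _ _ H]) (auto simp: space_PiM PiE_iff extensional_def fun_eq_iff)
  also have "\<dots> \<le> (\<integral>\<^sup>+x. H (\<lambda>i\<in>I. x i + c i) \<partial>Pi\<^sub>M I (\<lambda>_. lborel))"
    using le[where c="\<lambda>i. - c i", OF measurable_compose[OF m H]] by simp
  finally show ?thesis using le[OF H] by (intro antisym)
qed

text \<open>The space \<open>\<real>\<^sup>I\<close> is tiled by the translates of the cube \<open>[0, L)\<^sup>I\<close> by \<open>L\<close> times integer vectors.\<close>

lemma nn_integral_PiM_lborel_unfold:
  fixes H :: "('i \<Rightarrow> real) \<Rightarrow> ennreal"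
  assumes I: "finite I" and H [measurable]: "H \<in> borel_measurable (Pi\<^sub>M I (\<lambda>_. lborel))" and L: "L > 0"
  shows "(\<integral>\<^sup>+x. H x \<partial>Pi\<^sub>M I (\<lambda>_. lborel)) =
    (\<integral>\<^sup>+x. (\<integral>\<^sup>+k. H (\<lambda>i\<in>I. x i + of_int (k i) * L) \<partial>count_space (I \<rightarrow>\<^sub>E (UNIV :: int set))) *
       (\<Prod>i\<in>I. indicator {0..<L} (x i)) \<partial>Pi\<^sub>M I (\<lambda>_. lborel))"
proof -
  let ?P = "Pi\<^sub>M I (\<lambda>_. lborel :: real measure)" and ?K = "I \<rightarrow>\<^sub>E (UNIV :: int set)"
  have cK: "countable ?K" by (intro countable_PiE I) auto
  have m: "(\<lambda>x. \<lambda>i\<in>I. x i + c i) \<in> measurable ?P ?P" for c :: "'i \<Rightarrow> real"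
    by (intro measurable_restrict) (auto intro!: borel_measurable_add measurable_component_singleton)
  have ind [measurable]: "(\<lambda>x. \<Prod>i\<in>I. indicator {a i..<b i} (x i) :: ennreal) \<in> borel_measurable ?P" for a b :: "'i \<Rightarrow> real"
    by measurable
  \<comment> \<open>\<open>C k\<close> is the indicator of the tile with index \<open>k\<close>.
    Exactly one index, given by the floors of \<open>x i / L\<close>, has \<open>C k x = 1\<close>,
    so summing over \<open>k\<close> reproduces \<open>H x\<close>.\<close>
  define C where "C k x = (\<Prod>i\<in>I. indicator {of_int (k i) * L..<of_int (k i) * L + L} (x i) :: ennreal)" for k :: "'i \<Rightarrow> int" and x
  have [measurable]: "C k \<in> borel_measurable ?P" for k
    unfolding C_def by measurable
  have "(\<integral>\<^sup>+x. H x \<partial>?P) = (\<integral>\<^sup>+x. (\<integral>\<^sup>+k. H x * C k x \<partial>count_space ?K) \<partial>?P)"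
  proof (rule nn_integral_cong)
    fix x :: "'i \<Rightarrow> real"
    define k0 where "k0 = (\<lambda>i\<in>I. \<lfloor>x i / L\<rfloor>)"
    have "C k x = indicator {k0} k" if "k \<in> ?K" for k
    proof -
      have "x i \<in> {of_int (k i) * L..<of_int (k i) * L + L} \<longleftrightarrow> k i = \<lfloor>x i / L\<rfloor>" for i
        using L by (auto simp: field_simps floor_eq_iff eq_commute[of "k i"])
      then have "C k x = (\<Prod>i\<in>I. if k i = \<lfloor>x i / L\<rfloor> then 1 else 0)"
        unfolding C_def by (intro prod.cong) (simp_all add: indicator_def)
      also have "\<dots> = (if \<forall>i\<in>I. k i = \<lfloor>x i / L\<rfloor> then 1 else 0)"
        using I by (auto intro!: prod_zero)
      also have "(\<forall>i\<in>I. k i = \<lfloor>x i / L\<rfloor>) \<longleftrightarrow> k = k0"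
        using that by (auto simp: k0_def PiE_iff extensional_def fun_eq_iff)
      finally show ?thesis by (simp add: indicator_def)
    qed
    then have "(\<integral>\<^sup>+k. H x * C k x \<partial>count_space ?K) = (\<integral>\<^sup>+k. H x * indicator {k0} k \<partial>count_space ?K)"
      by (intro nn_integral_cong) auto
    also have "\<dots> = H x"
      by (subst nn_integral_cmult_indicator) (auto simp: k0_def)
    finally show "H x = (\<integral>\<^sup>+k. H x * C k x \<partial>count_space ?K)" by simp
  qed
  also have "\<dots> = (\<integral>\<^sup>+k. (\<integral>\<^sup>+x. H x * C k x \<partial>?P) \<partial>count_space ?K)"
    by (intro nn_integral_count_space_nn_integral cK) measurable
  also have "\<dots> = (\<integral>\<^sup>+k. (\<integral>\<^sup>+x. H (\<lambda>i\<in>I. x i + of_int (k i) * L) * (\<Prod>i\<in>I. indicator {0..<L} (x i)) \<partial>?P) \<partial>count_space ?K)"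
  proof (rule nn_integral_cong)
    fix k :: "'i \<Rightarrow> int"
    have "(\<integral>\<^sup>+x. H x * C k x \<partial>?P) =
       (\<integral>\<^sup>+x. H (\<lambda>i\<in>I. x i + of_int (k i) * L) * C k (\<lambda>i\<in>I. x i + of_int (k i) * L) \<partial>?P)"
      by (rule nn_integral_PiM_lborel_shift[symmetric, OF I]) measurable
    also have "(\<lambda>x. C k (\<lambda>i\<in>I. x i + of_int (k i) * L)) = (\<lambda>x. \<Prod>i\<in>I. indicator {0..<L} (x i))"
      unfolding C_def by (intro ext prod.cong) (auto simp: indicator_def)
    finally show "(\<integral>\<^sup>+x. H x * C k x \<partial>?P) =
        (\<integral>\<^sup>+x. H (\<lambda>i\<in>I. x i + of_int (k i) * L) * (\<Prod>i\<in>I. indicator {0..<L} (x i)) \<partial>?P)" .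
  qed
  also have "\<dots> = (\<integral>\<^sup>+x. (\<integral>\<^sup>+k. H (\<lambda>i\<in>I. x i + of_int (k i) * L) * (\<Prod>i\<in>I. indicator {0..<L} (x i)) \<partial>count_space ?K) \<partial>?P)"
    by (intro nn_integral_count_space_nn_integral[symmetric] cK borel_measurable_times_ennreal ind
        measurable_compose[OF m H])
  also have "\<dots> = (\<integral>\<^sup>+x. (\<integral>\<^sup>+k. H (\<lambda>i\<in>I. x i + of_int (k i) * L) \<partial>count_space ?K) *
       (\<Prod>i\<in>I. indicator {0..<L} (x i)) \<partial>?P)"
    by (intro nn_integral_cong nn_integral_multc) auto
  finally show ?thesis .
qed

text \<open>The length of the set of admissible values at a vertex whose neighbours \<open>S\<close> carry the values \<open>x\<close>.\<close>

definition slack :: "'i set \<Rightarrow> ('i \<Rightarrow> real) \<Rightarrow> ennreal" where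
  "slack S x = (\<integral>\<^sup>+t. (\<Prod>a\<in>S. indicator {x a - 1..x a + 1} t) \<partial>lborel)"

lemma slack_cong: "(\<And>a. a \<in> S \<Longrightarrow> x a = y a) \<Longrightarrow> slack S x = slack S y"
  unfolding slack_def by (intro nn_integral_cong prod.cong) auto

lemma slack_shift: "slack S (\<lambda>a. x a + c) = slack S x"
proof -
  have "slack S (\<lambda>a. x a + c) = (\<integral>\<^sup>+t. (\<Prod>a\<in>S. indicator {x a + c - 1..x a + c + 1} (t + c)) \<partial>lborel)"
    unfolding slack_def by (subst nn_integral_lborel_shift) auto
  also have "\<dots> = slack S x"
    unfolding slack_def by (intro nn_integral_cong prod.cong) (auto simp: indicator_def)
  finally show ?thesis .
qed

lemma measurable_slack [measurable]:
  assumes S: "S \<subseteq> I"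
  shows "slack S \<in> borel_measurable (Pi\<^sub>M I (\<lambda>_. lborel))"
proof -
  have "(\<lambda>x. \<integral>\<^sup>+t. (\<Prod>a\<in>S. (if x a - 1 \<le> t \<and> t \<le> x a + 1 then 1 else 0)) \<partial>lborel)
      \<in> borel_measurable (Pi\<^sub>M I (\<lambda>_. lborel :: real measure))"
  proof (intro lborel.borel_measurable_nn_integral, unfold split_beta', intro borel_measurable_prod_ennreal)
    fix a assume "a \<in> S"
    then have "a \<in> I" using S by auto
    then have [measurable]: "(\<lambda>x. fst x a) \<in> borel_measurable (Pi\<^sub>M I (\<lambda>_. lborel :: real measure) \<Otimes>\<^sub>M (lborel :: real measure))"
      using measurable_component_singleton[of a I "\<lambda>_. lborel :: real measure"] by measurable
    show "(\<lambda>x. if fst x a - 1 \<le> snd x \<and> snd x \<le> fst x a + 1 then 1 else 0 :: ennreal)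
        \<in> borel_measurable (Pi\<^sub>M I (\<lambda>_. lborel :: real measure) \<Otimes>\<^sub>M (lborel :: real measure))"
      by measurable
  qed
  then show ?thesis by (simp add: slack_def[abs_def] indicator_def of_bool_def)
qed

text \<open>Two neighbours already confine t to the interval from \<open>x j - 1\<close> to
  \<open>x i + 1\<close>. A negative length becomes 0 under \<open>ennreal\<close>, in agreement
  with an empty intersection.\<close>

lemma slack_le:
  assumes "finite S" "i \<in> S" "j \<in> S"
  shows "slack S x \<le> ennreal (2 - (x j - x i))"
proof -
  have "slack S x \<le> (\<integral>\<^sup>+t. indicator {x j - 1..x i + 1} t \<partial>lborel)"
    unfolding slack_def
  proof (rule nn_integral_mono)
    fix t :: real
    show "(\<Prod>a\<in>S. indicator {x a - 1..x a + 1} t) \<le> (indicator {x j - 1..x i + 1} t :: ennreal)"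
    proof (cases "t \<in> {x j - 1..x i + 1}")
      case True
      then show ?thesis by (auto intro!: prod_le_1 simp: indicator_def)
    next
      case False
      then have "t \<notin> {x i - 1..x i + 1} \<or> t \<notin> {x j - 1..x j + 1}" by auto
      then have "(\<Prod>a\<in>S. indicator {x a - 1..x a + 1} t) = (0::ennreal)"
        using assms by (intro prod_zero) (auto simp: indicator_def)
      then show ?thesis by (metis zero_le)
    qed
  qed
  also have "\<dots> = ennreal (2 - (x j - x i))"
    by (cases "x j - 1 \<le> x i + 1") (auto simp: ennreal_neg algebra_simps)
  finally show ?thesis .
qed

lemma slack_ge:
  assumes "\<And>a. a \<in> S \<Longrightarrow> l \<le> x a" "\<And>a. a \<in> S \<Longrightarrow> x a \<le> u"
  shows "ennreal (2 - (u - l)) \<le> slack S x"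
proof -
  have "ennreal (2 - (u - l)) = (\<integral>\<^sup>+t. indicator {u - 1..l + 1} t \<partial>lborel)"
    by (cases "u - 1 \<le> l + 1") (auto simp: ennreal_neg algebra_simps)
  also have "\<dots> \<le> slack S x"
    unfolding slack_def
  proof (rule nn_integral_mono)
    fix t :: real
    show "(indicator {u - 1..l + 1} t :: ennreal) \<le> (\<Prod>a\<in>S. indicator {x a - 1..x a + 1} t)"
    proof (cases "t \<in> {u - 1..l + 1}")
      case True
      then have "(\<Prod>a\<in>S. indicator {x a - 1..x a + 1} t) = (\<Prod>a\<in>S. 1 :: ennreal)"
        using assms by (intro prod.cong) (force simp: indicator_def)+
      then show ?thesis by (simp add: indicator_def)
    qed auto
  qed
  finally show ?thesis .
qed

text \<open>This is how the Lipschitz condition enters once the second class is integrated out: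
  vertices with a common neighbour differ by less than 2. It drives the uniqueness of lifts from the
  torus.\<close>

lemma slack_neq_0D:
  assumes "finite S" "i \<in> S" "j \<in> S" "slack S x \<noteq> 0"
  shows "\<bar>x i - x j\<bar> < 2"
  using slack_le[OF assms(1-3), of x] slack_le[OF assms(1,3,2), of x] assms(4)
  by (smt (verit) ennreal_neg le_zero_eq)

subsection \<open>The complete bipartite graph\<close>

lemma borel_measurable_unfold:
  fixes H :: "('i \<Rightarrow> real) \<Rightarrow> ennreal"
  assumes I: "finite I" and H [measurable]: "H \<in> borel_measurable (Pi\<^sub>M I (\<lambda>_. lborel))"
  shows "(\<lambda>x. (\<integral>\<^sup>+k. H (\<lambda>i\<in>I. x i + of_int (k i) * L) \<partial>count_space (I \<rightarrow>\<^sub>E (UNIV :: int set))) *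
       (\<Prod>i\<in>I. indicator {0..<L} (x i))) \<in> borel_measurable (Pi\<^sub>M I (\<lambda>_. lborel))"
proof -
  let ?P = "Pi\<^sub>M I (\<lambda>_. lborel :: real measure)" and ?K = "I \<rightarrow>\<^sub>E (UNIV :: int set)"
  have cK: "countable ?K" by (intro countable_PiE I) auto
  have m: "(\<lambda>x. \<lambda>i\<in>I. x i + c i) \<in> measurable ?P ?P" for c :: "'i \<Rightarrow> real"
    by (intro measurable_restrict) (auto intro!: borel_measurable_add measurable_component_singleton)
  interpret K: sigma_finite_measure "count_space ?K"
    using cK by (rule sigma_finite_measure_count_space_countable)
  have "(\<lambda>x. \<integral>\<^sup>+k. H (\<lambda>i\<in>I. x i + of_int (k i) * L) \<partial>count_space ?K) \<in> borel_measurable ?P"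
    by (intro K.borel_measurable_nn_integral, unfold split_beta',
        rule measurable_compose_countable'[where g=snd and I="?K" and f="\<lambda>k p. H (\<lambda>i\<in>I. fst p i + of_int (k i) * L)"])
      (use measurable_compose[OF measurable_fst measurable_compose[OF m H]] cK in auto)
  then show ?thesis by measurable
qed

section \<open>Weight of the range of the values on one side of the complete bipartite graph\<close>

lemma nn_integral_exp_abs:
  assumes c: "c > 0"
  shows "(\<integral>\<^sup>+x. ennreal (exp (- (c * \<bar>x - a\<bar>))) \<partial>lborel) \<le> ennreal (2 / c)"
proof -
  define h where "h x = ennreal (exp (- (c * x))) * indicator {0..} x" for x
  have [measurable]: "h \<in> borel_measurable borel" unfolding h_def by measurable
  have h: "(\<integral>\<^sup>+x. h x \<partial>lborel) = ennreal (1 / c)"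
  proof -
    have "(\<integral>\<^sup>+x. ennreal (exp (- (c * x))) * indicator {0..} x \<partial>lborel) = ennreal (0 - (- exp (- (c * 0)) / c))"
    proof (rule nn_integral_FTC_atLeast)
      show "((\<lambda>x. - exp (- (c * x)) / c) has_real_derivative exp (- (c * x))) (at x)" for x
        using c by (auto intro!: derivative_eq_intros)
      have "((\<lambda>x. exp (- (c * x))) \<longlongrightarrow> 0) at_top"
        using c by real_asymp
      from tendsto_divide[OF tendsto_minus[OF this] tendsto_const[of c]] c
      show "((\<lambda>x. - exp (- (c * x)) / c) \<longlongrightarrow> 0) at_top" by simp
    qed auto
    then show ?thesis by (simp add: h_def)
  qed
  have "(\<integral>\<^sup>+x. ennreal (exp (- (c * \<bar>x - a\<bar>))) \<partial>lborel) \<le> (\<integral>\<^sup>+x. h (x - a) + h (a - x) \<partial>lborel)"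
    by (intro nn_integral_mono) (auto simp: h_def indicator_def abs_if)
  also have "\<dots> = (\<integral>\<^sup>+x. h (x - a) \<partial>lborel) + (\<integral>\<^sup>+x. h (a - x) \<partial>lborel)"
    by (intro nn_integral_add) auto
  also have "(\<integral>\<^sup>+x. h (x - a) \<partial>lborel) = (\<integral>\<^sup>+x. h x \<partial>lborel)"
    using nn_integral_real_affine[of h 1 "-a"] by simp
  also have "(\<integral>\<^sup>+x. h (a - x) \<partial>lborel) = (\<integral>\<^sup>+x. h x \<partial>lborel)"
    using nn_integral_real_affine[of h "-1" a] by simp
  finally show ?thesis using c by (simp add: h flip: ennreal_plus)
qed

text \<open>Since (2 - R) R = 1 - s^2 with s = |R - 1|, the power is at most the Gaussian exp (- m
  s^2). Expanding (sqrt m * s - 1)^2 \<ge> 0 replaces it by a two-sided exponential, whose integral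
  is elementary and has the same order 1 / sqrt m. The factor 4 bounds the two surplus powers of 2 -
  R.\<close>

lemma range_weight_le:
  assumes "m > 0" "0 \<le> R" "R \<le> 2"
  shows "(2 - R) ^ (m + 2) * R ^ m \<le> 4 * exp 1 * exp (- (2 * sqrt m * \<bar>R - 1\<bar>))"
proof -
  define s where "s = \<bar>R - 1\<bar>"
  have s2: "s ^ 2 = (R - 1)\<^sup>2" by (simp add: s_def)
  have "((2 - R) * R) ^ m = (1 - s ^ 2) ^ m"
    unfolding s2 by (simp add: power2_eq_square algebra_simps)
  also have "\<dots> \<le> exp (- (s ^ 2)) ^ m"
  proof (rule power_mono)
    show "1 - s\<^sup>2 \<le> exp (- s\<^sup>2)" using exp_ge_add_one_self[of "- s\<^sup>2"] by simp
    have "s \<le> 1" using assms by (auto simp: s_def)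
    then show "0 \<le> 1 - s\<^sup>2" using power_le_one[of s 2] by (simp add: s_def)
  qed
  also have "\<dots> = exp (- (real m * s\<^sup>2))"
    by (simp add: exp_of_nat_mult[symmetric])
  also have "\<dots> \<le> exp (1 + - (2 * sqrt m * s))"
  proof -
    have "0 \<le> (sqrt m * s - 1)\<^sup>2" by simp
    then show ?thesis by (simp add: power2_diff power_mult_distrib)
  qed
  finally have 1: "((2 - R) * R) ^ m \<le> exp 1 * exp (- (2 * sqrt m * s))"
    by (simp only: exp_add)
  have "(2 - R)\<^sup>2 \<le> 2\<^sup>2" using assms by (intro power_mono) auto
  then have "(2 - R)\<^sup>2 * ((2 - R) * R) ^ m \<le> 4 * (exp 1 * exp (- (2 * sqrt m * s)))"
    using 1 assms by (intro mult_mono) auto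
  then show ?thesis by (simp only: power_add power_mult_distrib s_def mult_ac)
qed

lemma nn_integral_range_weight_le:
  assumes "m > 0"
  shows "(\<integral>\<^sup>+R. ennreal (2 - R) ^ (m + 2) * indicator {0..} R * ennreal R ^ m \<partial>lborel)
    \<le> ennreal (4 * exp 1 / sqrt m)"
proof -
  have "(\<integral>\<^sup>+R. ennreal (2 - R) ^ (m + 2) * indicator {0..} R * ennreal R ^ m \<partial>lborel) \<le>
     (\<integral>\<^sup>+R. ennreal (4 * exp 1) * ennreal (exp (- (2 * sqrt m * \<bar>R - 1\<bar>))) \<partial>lborel)"
  proof (rule nn_integral_mono)
    fix R :: real
    consider "R < 0" | "R > 2" | "0 \<le> R" "R \<le> 2" by linarith
    then show "ennreal (2 - R) ^ (m + 2) * indicator {0..} R * ennreal R ^ m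
       \<le> ennreal (4 * exp 1) * ennreal (exp (- (2 * sqrt m * \<bar>R - 1\<bar>)))"
    proof cases
      case 3
      then have "ennreal (2 - R) ^ (m + 2) * indicator {0..} R * ennreal R ^ m = ennreal ((2 - R) ^ (m + 2) * R ^ m)"
        by (simp add: ennreal_power ennreal_mult)
      also have "\<dots> \<le> ennreal (4 * exp 1 * exp (- (2 * sqrt m * \<bar>R - 1\<bar>)))"
        using assms 3 by (intro ennreal_leI range_weight_le)
      finally show ?thesis by (simp add: ennreal_mult)
    qed (auto simp: ennreal_neg)
  qed
  also have "\<dots> = ennreal (4 * exp 1) * (\<integral>\<^sup>+R. ennreal (exp (- (2 * sqrt m * \<bar>R - 1\<bar>))) \<partial>lborel)"
    by (intro nn_integral_cmult) auto
  also have "\<dots> \<le> ennreal (4 * exp 1) * ennreal (2 / (2 * sqrt m))"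
    using assms by (intro mult_left_mono nn_integral_exp_abs) auto
  also have "\<dots> = ennreal (4 * exp 1 / sqrt m)"
    by (simp add: ennreal_mult[symmetric])
  finally show ?thesis .
qed

text \<open>With d = m + 2, the integrand is the contribution of d vertices, each joined to all of
  \<open>D\<close>. Choose the positions i of the minimum and j of the maximum: at most d^2 pairs.
  The m other values lie between them and contribute R^m for range R, and the minimum moves in an
  interval of length L + 4. This leaves the one-dimensional range integral of order 1 / sqrt m, so
  the total order is d powr (3/2).\<close>

lemma nn_integral_slack_power_le:
  fixes D :: "'i set"
  assumes D: "finite D" "card D = m + 2" "e \<in> D" and m: "m > 0" and L: "L \<ge> 0"
  shows "(\<integral>\<^sup>+x. indicator {0..<L} (x e) * slack D x ^ (m + 2) \<partial>Pi\<^sub>M D (\<lambda>_. lborel))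
    \<le> ennreal (real (m + 2) ^ 2 * ((L + 4) * (4 * exp 1 / sqrt m)))"
proof -
  interpret product_sigma_finite "\<lambda>_::'i. lborel :: real measure" by (rule product_sigma_finite_lborel)
  \<comment> \<open>\<open>T i j\<close> restricts to the configurations with minimum at i and
    maximum at j. There \<open>x i\<close> lies within 2 of the anchor value \<open>x e\<close>,
    hence in \<open>{-2..L+2}\<close>.\<close>
  define T :: "'i \<Rightarrow> 'i \<Rightarrow> ('i \<Rightarrow> real) \<Rightarrow> ennreal" where
    "T i j x = indicator {-2..L+2} (x i) *
      (ennreal (2 - (x j - x i)) ^ (m + 2) * indicator {0..} (x j - x i)) *
      (\<Prod>k\<in>D - {i, j}. indicator {0..} (x k - x i) * indicator {0..} (x j - x k))" for i j x
  define Q where "Q = {(i, j). i \<in> D \<and> j \<in> D \<and> i \<noteq> j}"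
  have finQ: "finite Q" using D by (auto simp: Q_def intro: finite_subset[of _ "D \<times> D"])
  have Tm: "T i j \<in> borel_measurable (Pi\<^sub>M J (\<lambda>_. lborel))" if "i \<in> D" "j \<in> D" "J = D" for i j J
  proof -
    have c: "(\<lambda>x. x k) \<in> borel_measurable (Pi\<^sub>M J (\<lambda>_. lborel :: real measure))" if "k \<in> D" for k
      using measurable_component_singleton[of k J "\<lambda>_. lborel :: real measure"] that \<open>J = D\<close> by simp
    have ci: "(\<lambda>x. indicator {0..} (x k - x l) :: ennreal) \<in> borel_measurable (Pi\<^sub>M J (\<lambda>_. lborel :: real measure))"
      if "k \<in> D" "l \<in> D" for k l
      using measurable_compose[OF borel_measurable_diff[OF c[OF that(1)] c[OF that(2)]], of "indicator {0..} :: real \<Rightarrow> ennreal" borel]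
      by simp
    show ?thesis
      unfolding T_def
    proof (intro borel_measurable_times_ennreal borel_measurable_prod_ennreal)
      show "(\<lambda>x. indicator {0..} (x k - x i) :: ennreal) \<in> borel_measurable (Pi\<^sub>M J (\<lambda>_. lborel :: real measure))"
        "(\<lambda>x. indicator {0..} (x j - x k) :: ennreal) \<in> borel_measurable (Pi\<^sub>M J (\<lambda>_. lborel :: real measure))"
        if "k \<in> D - {i, j}" for k
        using that \<open>i \<in> D\<close> \<open>j \<in> D\<close> by (intro ci; simp)+
      show "(\<lambda>x. indicator {0..} (x j - x i) :: ennreal) \<in> borel_measurable (Pi\<^sub>M J (\<lambda>_. lborel :: real measure))"
        by (intro ci that)
      show "(\<lambda>x. ennreal (2 - (x j - x i)) ^ (m + 2)) \<in> borel_measurable (Pi\<^sub>M J (\<lambda>_. lborel))"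
        by (intro borel_measurable_power_ennreal measurable_compose[OF _ measurable_ennreal, where f="\<lambda>x. 2 - (x j - x i)"]
            borel_measurable_diff borel_measurable_const c that)
      show "(\<lambda>x. indicator {- 2..L + 2} (x i) :: ennreal) \<in> borel_measurable (Pi\<^sub>M J (\<lambda>_. lborel :: real measure))"
        using measurable_compose[OF c[OF that(1)], of "indicator {- 2..L + 2} :: real \<Rightarrow> ennreal" borel] by simp
    qed
  qed
  have point: "indicator {0..<L} (x e) * slack D x ^ (m + 2) \<le> (\<Sum>(i, j)\<in>Q. T i j x)" for x
  proof (cases "x e \<in> {0..<L} \<and> slack D x \<noteq> 0")
    case True
    have Dne: "D \<noteq> {}" using D by auto
    obtain i where i: "i \<in> D" "\<And>k. k \<in> D \<Longrightarrow> x i \<le> x k"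
      using D(1) Dne by (metis arg_min_if_finite(1) arg_min_least)
    \<comment> \<open>The maximum is taken over \<open>D - {i}\<close>, so that i and j are distinct
      even when all values coincide.\<close>
    have "D - {i} \<noteq> {}"
    proof
      assume "D - {i} = {}"
      then have "D \<subseteq> {i}" by auto
      then have "card D \<le> 1" using card_mono[of "{i}" D] by auto
      then show False using D by simp
    qed
    then obtain j where j: "j \<in> D - {i}" "\<And>k. k \<in> D - {i} \<Longrightarrow> x k \<le> x j"
      using D(1) arg_min_if_finite(1)[of "D - {i}" "\<lambda>k. - x k"] arg_min_least[of "D - {i}" _ "\<lambda>k. - x k"]
      by (metis finite_Diff neg_le_iff_le)
    have near: "\<bar>x i - x e\<bar> < 2" using slack_neq_0D[of D i e x] D i True by auto
    have Q: "(i, j) \<in> Q" using i j by (auto simp: Q_def)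
    have "indicator {0..<L} (x e) * slack D x ^ (m + 2) \<le> ennreal (2 - (x j - x i)) ^ (m + 2)"
      using True power_mono[OF slack_le[of D i j x], of "m + 2"] D i j
      by (auto simp: indicator_def simp del: power_Suc add_2_eq_Suc')
    also have "\<dots> = T i j x"
    proof -
      have "(\<Prod>k\<in>D - {i, j}. indicator {0..} (x k - x i) * indicator {0..} (x j - x k) :: ennreal) = (\<Prod>k\<in>D - {i, j}. 1)"
        using i j by (intro prod.cong) (auto simp: indicator_def)
      then show ?thesis using i j near True by (auto simp: T_def indicator_def)
    qed
    also have "\<dots> \<le> (\<Sum>(i, j)\<in>Q. T i j x)"
      using member_le_sum[of "(i, j)" Q "\<lambda>(i, j). T i j x"] Q finQ by auto
    finally show ?thesis .
  qed auto
  have T: "(\<integral>\<^sup>+x. T i j x \<partial>Pi\<^sub>M D (\<lambda>_. lborel)) \<le> ennreal ((L + 4) * (4 * exp 1 / sqrt m))"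
    if ij: "i \<in> D" "j \<in> D" "i \<noteq> j" for i j
  proof -
    define D' where "D' = D - {i, j}"
    have D': "finite D'" "i \<notin> insert j D'" "j \<notin> D'" "D = insert i (insert j D')" and cD': "card D' = m"
      using D ij by (auto simp: D'_def card_Diff_subset)
    define \<phi> where "\<phi> R = ennreal (2 - R) ^ (m + 2) * indicator {0..} R * ennreal R ^ m" for R :: real
    have [measurable]: "\<phi> \<in> borel_measurable borel" unfolding \<phi>_def by measurable
    have Tm': "T i j \<in> borel_measurable (Pi\<^sub>M (insert i (insert j D')) (\<lambda>_. lborel))"
      by (rule Tm) (use D' ij in auto)
    have Tm2: "(\<lambda>x. T i j (x(i := y))) \<in> borel_measurable (Pi\<^sub>M (insert j D') (\<lambda>_. lborel))" for y
      by (rule measurable_compose[OF _ Tm'], rule measurable_fun_upd[where J="insert j D'"]) auto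
    have in1: "(\<integral>\<^sup>+x. T i j (x(j := z, i := y)) \<partial>Pi\<^sub>M D' (\<lambda>_. lborel)) = indicator {-2..L+2} y * \<phi> (z - y)" for y z
    proof -
      have "T i j (x(j := z, i := y)) = indicator {-2..L+2} y *
         (ennreal (2 - (z - y)) ^ (m + 2) * indicator {0..} (z - y)) * (\<Prod>k\<in>D'. indicator {y..z} (x k))" for x
      proof -
        have "(\<Prod>k\<in>D'. indicator {0..} ((x(j := z, i := y)) k - y) * indicator {0..} (z - (x(j := z, i := y)) k) :: ennreal)
            = (\<Prod>k\<in>D'. indicator {y..z} (x k))"
          by (intro prod.cong) (auto simp: D'_def indicator_def)
        then show ?thesis using ij by (simp add: T_def D'_def)
      qed
      then have "(\<integral>\<^sup>+x. T i j (x(j := z, i := y)) \<partial>Pi\<^sub>M D' (\<lambda>_. lborel)) =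
          indicator {-2..L+2} y * (ennreal (2 - (z - y)) ^ (m + 2) * indicator {0..} (z - y)) *
          (\<integral>\<^sup>+x. (\<Prod>k\<in>D'. indicator {y..z} (x k)) \<partial>Pi\<^sub>M D' (\<lambda>_. lborel))"
        by (simp add: nn_integral_cmult)
      also have "(\<integral>\<^sup>+x. (\<Prod>k\<in>D'. indicator {y..z} (x k)) \<partial>Pi\<^sub>M D' (\<lambda>_. lborel)) = emeasure lborel {y..z} ^ m"
        using D' cD' by (subst product_nn_integral_prod) auto
      also have "indicator {-2..L+2} y * (ennreal (2 - (z - y)) ^ (m + 2) * indicator {0..} (z - y)) *
          emeasure lborel {y..z} ^ m = indicator {-2..L+2} y * \<phi> (z - y)"
        by (cases "y \<le> z") (auto simp: \<phi>_def mult_ac)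
      finally show ?thesis .
    qed
    have "(\<integral>\<^sup>+x. T i j x \<partial>Pi\<^sub>M D (\<lambda>_. lborel)) =
       (\<integral>\<^sup>+y. (\<integral>\<^sup>+x. T i j (x(i := y)) \<partial>Pi\<^sub>M (insert j D') (\<lambda>_. lborel)) \<partial>lborel)"
      unfolding D'(4) using D' by (intro product_nn_integral_insert_rev Tm') auto
    also have "\<dots> = (\<integral>\<^sup>+y. (\<integral>\<^sup>+z. (\<integral>\<^sup>+x. T i j (x(j := z, i := y)) \<partial>Pi\<^sub>M D' (\<lambda>_. lborel)) \<partial>lborel) \<partial>lborel)"
      using D' by (subst product_nn_integral_insert_rev[OF _ _ Tm2]) auto
    also have "\<dots> = (\<integral>\<^sup>+y. (\<integral>\<^sup>+z. indicator {-2..L+2} y * \<phi> (z - y) \<partial>lborel) \<partial>lborel)"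
      unfolding in1 ..
    also have "\<dots> = (\<integral>\<^sup>+y. indicator {-2..L+2} y * (\<integral>\<^sup>+z. \<phi> z \<partial>lborel) \<partial>lborel)"
    proof (rule nn_integral_cong)
      fix y :: real
      have "(\<integral>\<^sup>+z. \<phi> (z - y) \<partial>lborel) = (\<integral>\<^sup>+z. \<phi> z \<partial>lborel)"
        using nn_integral_lborel_shift[of \<phi> "-y"] by simp
      then show "(\<integral>\<^sup>+z. indicator {-2..L+2} y * \<phi> (z - y) \<partial>lborel) = indicator {-2..L+2} y * (\<integral>\<^sup>+z. \<phi> z \<partial>lborel)"
        by (simp add: nn_integral_cmult)
    qed
    also have "\<dots> = ennreal (L + 4) * (\<integral>\<^sup>+z. \<phi> z \<partial>lborel)"
      using L by (simp add: nn_integral_multc add.commute)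
    also have "\<dots> \<le> ennreal (L + 4) * ennreal (4 * exp 1 / sqrt m)"
      unfolding \<phi>_def using m by (intro mult_left_mono nn_integral_range_weight_le) auto
    also have "\<dots> = ennreal ((L + 4) * (4 * exp 1 / sqrt m))"
      using L by (intro ennreal_mult[symmetric]) auto
    finally show ?thesis .
  qed
  have "(\<integral>\<^sup>+x. indicator {0..<L} (x e) * slack D x ^ (m + 2) \<partial>Pi\<^sub>M D (\<lambda>_. lborel))
    \<le> (\<integral>\<^sup>+x. (\<Sum>(i, j)\<in>Q. T i j x) \<partial>Pi\<^sub>M D (\<lambda>_. lborel))"
    by (intro nn_integral_mono point)
  also have "\<dots> = (\<Sum>(i, j)\<in>Q. \<integral>\<^sup>+x. T i j x \<partial>Pi\<^sub>M D (\<lambda>_. lborel))"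
    unfolding split_beta' by (intro nn_integral_sum Tm) (auto simp: Q_def)
  also have "\<dots> \<le> (\<Sum>(i, j)\<in>Q. ennreal ((L + 4) * (4 * exp 1 / sqrt m)))"
    unfolding split_beta' by (intro sum_mono T) (auto simp: Q_def)
  also have "\<dots> = of_nat (card Q) * ennreal ((L + 4) * (4 * exp 1 / sqrt m))" by simp
  also have "\<dots> \<le> ennreal (real (m + 2) ^ 2) * ennreal ((L + 4) * (4 * exp 1 / sqrt m))"
  proof (rule mult_right_mono)
    have "card Q \<le> card (D \<times> D)" using D by (intro card_mono) (auto simp: Q_def)
    also have "\<dots> = (m + 2) ^ 2" using D by (simp add: card_cartesian_product power2_eq_square)
    finally have "real (card Q) \<le> real (m + 2) ^ 2" by (metis of_nat_le_iff of_nat_power)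
    then show "of_nat (card Q) \<le> ennreal (real (m + 2) ^ 2)"
      unfolding ennreal_of_nat_eq_real_of_nat by (rule ennreal_leI)
  qed auto
  also have "\<dots> = ennreal (real (m + 2) ^ 2 * ((L + 4) * (4 * exp 1 / sqrt m)))"
    using L by (intro ennreal_mult[symmetric]) auto
  finally show ?thesis .
qed

subsection \<open>Regular bipartite graphs: upper bound\<close>

lemma measurable_indicator_component:
  assumes "J \<in> sets borel" "a \<in> I"
  shows "(\<lambda>x. indicator J (x a) :: ennreal) \<in> borel_measurable (Pi\<^sub>M I (\<lambda>_. lborel :: real measure))"
  using assms measurable_compose[OF measurable_component_singleton[of a I "\<lambda>_. lborel :: real measure"],
      of "indicator J :: real \<Rightarrow> ennreal" borel] by simp

text \<open>The assumption \<open>locally_constant\<close> expresses that the graph is connected.\<close>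

locale bipartite_regular =
  fixes A B :: "'a set" and N :: "'a \<Rightarrow> 'a set" and r :: 'a and n :: nat
  assumes finite_A: "finite A" and finite_B: "finite B" and n_pos: "n > 0"
    and N_sub: "b \<in> B \<Longrightarrow> N b \<subseteq> A"
    and card_N: "b \<in> B \<Longrightarrow> card (N b) = n"
    and degree: "a \<in> A \<Longrightarrow> card {b \<in> B. a \<in> N b} = n"
    and root: "r \<in> A"
    and locally_constant: "(\<And>b a a'. b \<in> B \<Longrightarrow> a \<in> N b \<Longrightarrow> a' \<in> N b \<Longrightarrow> k a = (k a' :: int)) \<Longrightarrow> a \<in> A \<Longrightarrow> k a = k r"
begin

definition vol :: ennreal where
  "vol = (\<integral>\<^sup>+x. (\<Prod>b\<in>B. slack (N b) (x(r := 0))) \<partial>Pi\<^sub>M (A - {r}) (\<lambda>_. lborel))"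

lemma finite_N: "b \<in> B \<Longrightarrow> finite (N b)"
  using N_sub finite_A finite_subset by blast

lemma measurable_prod_slack: "(\<lambda>x. \<Prod>b\<in>B. slack (N b) x) \<in> borel_measurable (Pi\<^sub>M A (\<lambda>_. lborel))"
  by (intro borel_measurable_prod_ennreal measurable_slack N_sub)

text \<open>Slacks are translation invariant, so the integral with the root fixed at y does not
  depend on y. Letting the root range over \<open>J\<close> multiplies by the length of
  \<open>J\<close> and yields an integral over all of \<open>A\<close>, the form used by both
  bounds.\<close>

lemma nn_integral_root_in:
  fixes J :: "real set"
  assumes J: "J \<in> sets borel"
  shows "(\<integral>\<^sup>+x. indicator J (x r) * (\<Prod>b\<in>B. slack (N b) x) \<partial>Pi\<^sub>M A (\<lambda>_. lborel)) = emeasure lborel J * vol"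
proof -
  interpret product_sigma_finite "\<lambda>_::'a. lborel :: real measure" by (rule product_sigma_finite_lborel)
  let ?A = "A - {r}"
  have A: "insert r ?A = A" using root by auto
  have upd: "(\<lambda>x. x(r := y)) \<in> measurable (Pi\<^sub>M ?A (\<lambda>_. lborel)) (Pi\<^sub>M A (\<lambda>_. lborel :: real measure))" for y
    by (rule measurable_fun_upd[where J="?A"]) (use A in auto)
  have pm: "(\<lambda>x. \<Prod>b\<in>B. slack (N b) (x(r := y))) \<in> borel_measurable (Pi\<^sub>M ?A (\<lambda>_. lborel))" for y
    by (rule measurable_compose[OF upd measurable_prod_slack])
  have inner: "(\<integral>\<^sup>+x. (\<Prod>b\<in>B. slack (N b) (x(r := y))) \<partial>Pi\<^sub>M ?A (\<lambda>_. lborel)) = vol" for y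
  proof -
    have "(\<integral>\<^sup>+x. (\<Prod>b\<in>B. slack (N b) (x(r := y))) \<partial>Pi\<^sub>M ?A (\<lambda>_. lborel)) =
      (\<integral>\<^sup>+x. (\<Prod>b\<in>B. slack (N b) ((\<lambda>i\<in>?A. x i + y)(r := y))) \<partial>Pi\<^sub>M ?A (\<lambda>_. lborel))"
      using finite_A by (intro nn_integral_PiM_lborel_shift[symmetric, OF _ pm]) auto
    also have "\<dots> = vol"
      unfolding vol_def
    proof (intro nn_integral_cong prod.cong refl)
      fix x :: "'a \<Rightarrow> real" and b assume b: "b \<in> B"
      have "slack (N b) ((\<lambda>i\<in>?A. x i + y)(r := y)) = slack (N b) (\<lambda>i. (x(r := 0)) i + y)"
        using N_sub[OF b] by (intro slack_cong) auto
      then show "slack (N b) ((\<lambda>i\<in>?A. x i + y)(r := y)) = slack (N b) (x(r := 0))"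
        by (simp only: slack_shift)
    qed
    finally show ?thesis .
  qed
  have "(\<integral>\<^sup>+x. indicator J (x r) * (\<Prod>b\<in>B. slack (N b) x) \<partial>Pi\<^sub>M (insert r ?A) (\<lambda>_. lborel)) =
     (\<integral>\<^sup>+y. (\<integral>\<^sup>+x. indicator J ((x(r := y)) r) * (\<Prod>b\<in>B. slack (N b) (x(r := y))) \<partial>Pi\<^sub>M ?A (\<lambda>_. lborel)) \<partial>lborel)"
    using finite_A measurable_prod_slack J root
    by (intro product_nn_integral_insert_rev borel_measurable_times_ennreal measurable_indicator_component)
      (auto simp: insert_absorb)
  also have "\<dots> = (\<integral>\<^sup>+y. indicator J y * vol \<partial>lborel)"
    by (intro nn_integral_cong) (simp only: fun_upd_same nn_integral_cmult[OF pm] inner)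
  also have "\<dots> = emeasure lborel J * vol"
    using J by (simp add: nn_integral_multc)
  finally show ?thesis by (simp only: A)
qed

text \<open>Folding the integral over \<open>A\<close> onto the torus loses nothing, as at most one
  lift of a torus point has a nonzero integrand. Each slack at this lift is one term of the
  periodized local integrand \<open>G b\<close>, and Finner's inequality separates the
  neighbourhoods. Unfolding each \<open>G b\<close> returns to real arguments with one anchor vertex
  in \<open>{0..<L}\<close>, the quantity bounded by \<open>K\<close>.\<close>

lemma vol_le:
  assumes L: "L > 4"
    and K: "\<And>b a. b \<in> B \<Longrightarrow> a \<in> N b \<Longrightarrow>
      (\<integral>\<^sup>+x. indicator {0..<L} (x a) * slack (N b) x ^ n \<partial>Pi\<^sub>M (N b) (\<lambda>_. lborel)) \<le> K"
  shows "ennreal L * vol \<le> eroot n K ^ card B"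
proof -
  have "\<exists>a. a \<in> N b" if "b \<in> B" for b using card_N[OF that] n_pos by (metis card.empty ex_in_conv less_irrefl)
  \<comment> \<open>The anchor \<open>e b\<close> removes the translation freedom of the
    neighbourhood of \<open>b\<close>, without which the local integral would be infinite.\<close>
  then obtain e where e: "\<And>b. b \<in> B \<Longrightarrow> e b \<in> N b" by metis
  define h where "h b y = indicator {0..<L} (y (e b)) * slack (N b) y ^ n" for b and y :: "'a \<Rightarrow> real"
  have hm: "h b \<in> borel_measurable (Pi\<^sub>M (N b) (\<lambda>_. lborel))" if "b \<in> B" for b
    unfolding h_def using e that
    by (intro borel_measurable_times_ennreal borel_measurable_power_ennreal measurable_slack measurable_indicator_component) auto
  define G where "G b y = (\<integral>\<^sup>+k. h b (\<lambda>i\<in>N b. y i + of_int (k i) * L) \<partial>count_space (N b \<rightarrow>\<^sub>E (UNIV :: int set))) *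
       (\<Prod>i\<in>N b. indicator {0..<L} (y i))" for b and y :: "'a \<Rightarrow> real"
  define H where "H x = indicator {0..<L} (x r) * (\<Prod>b\<in>B. slack (N b) x)" for x
  have Hm: "H \<in> borel_measurable (Pi\<^sub>M A (\<lambda>_. lborel))"
    unfolding H_def using root by (intro borel_measurable_times_ennreal measurable_prod_slack measurable_indicator_component) auto
  have sl: "slack (N b) z \<noteq> 0" if "H z \<noteq> 0" "b \<in> B" for b z
    using that finite_B by (auto simp: H_def)
  let ?K = "A \<rightarrow>\<^sub>E (UNIV :: int set)"
  let ?s = "\<lambda>x k. \<lambda>i\<in>A. x i + of_int (k i :: int) * L"
  have point: "(\<integral>\<^sup>+k. H (?s x k) \<partial>count_space ?K) * (\<Prod>i\<in>A. indicator {0..<L} (x i))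
      \<le> (\<Prod>b\<in>B. eroot n (G b (restrict x (N b))))" for x
  proof (cases "(\<forall>a\<in>A. x a \<in> {0..<L}) \<and> (\<exists>k\<in>?K. H (?s x k) \<noteq> 0)")
    case False
    then consider a where "a \<in> A" "x a \<notin> {0..<L}" | "\<And>k. k \<in> ?K \<Longrightarrow> H (?s x k) = 0" by blast
    then have "(\<integral>\<^sup>+k. H (?s x k) \<partial>count_space ?K) * (\<Prod>i\<in>A. indicator {0..<L} (x i)) = 0"
    proof cases
      case 1
      then have "(\<Prod>i\<in>A. indicator {0..<L} (x i)) = (0 :: ennreal)"
        using finite_A by (intro prod_zero bexI[of _ a]) (auto simp: indicator_def)
      then show ?thesis by (simp only: mult_zero_right)
    next
      case 2
      then have "(\<integral>\<^sup>+k. H (?s x k) \<partial>count_space ?K) = (\<integral>\<^sup>+k. 0 \<partial>count_space ?K)"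
        by (intro nn_integral_cong) auto
      then show ?thesis by simp
    qed
    then show ?thesis by (simp only: zero_le)
  next
    case True
    then obtain k0 where k0: "k0 \<in> ?K" "H (?s x k0) \<noteq> 0" by auto
    have x: "0 \<le> x a" "x a < L" if "a \<in> A" for a using True that by auto
    have ind1: "(\<Prod>i\<in>I. indicator {0..<L} (x i)) = (1 :: ennreal)" if "I \<subseteq> A" for I
      using x that by (intro prod.neutral) (auto simp: indicator_def)
    have kr: "k r = 0" if "H (?s x k) \<noteq> 0" for k
    proof -
      have "0 \<le> x r + of_int (k r) * L" "x r + of_int (k r) * L < L"
        using that root by (auto simp: H_def indicator_def split: if_splits)
      with x[OF root] have "-1 * L < of_int (k r) * L" "of_int (k r) * L < 1 * L" by linarith+
      then have "-1 < real_of_int (k r)" "real_of_int (k r) < 1"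
        using L by (simp_all only: mult_less_cancel_right_pos)
      then show ?thesis by linarith
    qed
    have near: "\<bar>?s x k a - ?s x k a'\<bar> < 2" if "H (?s x k) \<noteq> 0" "b \<in> B" "a \<in> N b" "a' \<in> N b" for k b a a'
      by (rule slack_neq_0D[OF finite_N[OF \<open>b \<in> B\<close>] that(3,4) sl[OF that(1,2)]])
    \<comment> \<open>For two vertices with a common neighbour, both lifts have increments below 2
      in absolute value. The two increments differ by a multiple of \<open>L\<close> that is below 4
      < L, hence by 0. So \<open>k - k0\<close> is constant on \<open>A\<close>, and it vanishes at
      the root.\<close>
    have uniq: "k = k0" if k: "k \<in> ?K" "H (?s x k) \<noteq> 0" for k
    proof -
      have "k a - k0 a = k r - k0 r" if "a \<in> A" for a
      proof (rule locally_constant[OF _ that])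
        fix b a a' assume ba: "b \<in> B" "a \<in> N b" "a' \<in> N b"
        then have aA: "a \<in> A" "a' \<in> A" using N_sub by auto
        have "\<bar>(x a + of_int (k a) * L) - (x a' + of_int (k a') * L)\<bar> < 2"
          "\<bar>(x a + of_int (k0 a) * L) - (x a' + of_int (k0 a') * L)\<bar> < 2"
          using near[OF k(2) ba] near[OF k0(2) ba] aA by auto
        then have "\<bar>(of_int (k a) * L - of_int (k a') * L) - (of_int (k0 a) * L - of_int (k0 a') * L)\<bar> < 4"
          by linarith
        also have "(of_int (k a) * L - of_int (k a') * L) - (of_int (k0 a) * L - of_int (k0 a') * L)
           = of_int ((k a - k0 a) - (k a' - k0 a')) * L" by (simp add: algebra_simps)
        finally have "real_of_int \<bar>(k a - k0 a) - (k a' - k0 a')\<bar> * L < 4"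
          using L by (simp add: abs_mult)
        then have "real_of_int \<bar>(k a - k0 a) - (k a' - k0 a')\<bar> * L < 1 * L"
          using L by linarith
        then have "real_of_int \<bar>(k a - k0 a) - (k a' - k0 a')\<bar> < 1"
          using L by (simp only: mult_less_cancel_right_pos)
        then show "k a - k0 a = k a' - k0 a'" by linarith
      qed
      then have "k a = k0 a" if "a \<in> A" for a using kr[OF k(2)] kr[OF k0(2)] that by auto
      then show ?thesis using k(1) k0(1) by (metis PiE_ext)
    qed
    have "(\<integral>\<^sup>+k. H (?s x k) \<partial>count_space ?K) = (\<integral>\<^sup>+k. H (?s x k0) * indicator {k0} k \<partial>count_space ?K)"
    proof (rule nn_integral_cong)
      fix k assume "k \<in> space (count_space ?K)"
      then have "k = k0 \<or> H (?s x k) = 0" using uniq by (metis space_count_space)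
      then show "H (?s x k) = H (?s x k0) * indicator {k0} k"
        by (cases "k = k0") auto
    qed
    also have "\<dots> = H (?s x k0)"
      using k0 by (subst nn_integral_cmult_indicator) auto
    also have "\<dots> \<le> (\<Prod>b\<in>B. slack (N b) (?s x k0))"
      unfolding H_def by (simp add: indicator_def)
    also have "\<dots> \<le> (\<Prod>b\<in>B. eroot n (G b (restrict x (N b))))"
    proof (intro prod_mono_ennreal)
      fix b assume b: "b \<in> B"
      \<comment> \<open>The global lift, renormalized to vanish at the anchor. The slack does not
        notice the common shift, and now the anchor value lies in \<open>{0..<L}\<close>, so this
        term occurs in the sum that defines \<open>G b\<close>.\<close>
      define k1 where "k1 = (\<lambda>a\<in>N b. k0 a - k0 (e b))"
      have eA: "e b \<in> A" using e N_sub b by auto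
      have "slack (N b) (?s x k0) = slack (N b) (\<lambda>a. (x a + of_int (k1 a) * L) + of_int (k0 (e b)) * L)"
        using N_sub[OF b] by (intro slack_cong) (auto simp: k1_def algebra_simps)
      also have "\<dots> = slack (N b) (\<lambda>a. x a + of_int (k1 a) * L)" by (rule slack_shift)
      also have "\<dots> = slack (N b) (\<lambda>i\<in>N b. restrict x (N b) i + of_int (k1 i) * L)"
        by (intro slack_cong) auto
      also have "\<dots> = eroot n (h b (\<lambda>i\<in>N b. restrict x (N b) i + of_int (k1 i) * L))"
        using e[OF b] x[OF eA] n_pos by (simp add: h_def k1_def eroot_power)
      also have "\<dots> \<le> eroot n (\<integral>\<^sup>+k. h b (\<lambda>i\<in>N b. restrict x (N b) i + of_int (k i) * L) \<partial>count_space (N b \<rightarrow>\<^sub>E (UNIV :: int set)))"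
        by (intro eroot_mono n_pos nn_integral_ge_point) (auto simp: k1_def)
      also have "\<dots> = eroot n (G b (restrict x (N b)))"
      proof -
        have "(\<Prod>i\<in>N b. indicator {0..<L} (restrict x (N b) i)) = (1 :: ennreal)"
          using ind1[OF N_sub[OF b]] by (simp cong: prod.cong)
        then show ?thesis unfolding G_def by simp
      qed
      finally show "slack (N b) (?s x k0) \<le> eroot n (G b (restrict x (N b)))" .
    qed
    finally show ?thesis using ind1[of A] by simp
  qed
  have "ennreal L * vol = (\<integral>\<^sup>+x. H x \<partial>Pi\<^sub>M A (\<lambda>_. lborel))"
    using nn_integral_root_in[of "{0..<L}"] L by (simp add: H_def)
  also have "\<dots> = (\<integral>\<^sup>+x. (\<integral>\<^sup>+k. H (?s x k) \<partial>count_space ?K) * (\<Prod>i\<in>A. indicator {0..<L} (x i)) \<partial>Pi\<^sub>M A (\<lambda>_. lborel))"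
    using L by (intro nn_integral_PiM_lborel_unfold finite_A Hm) auto
  also have "\<dots> \<le> (\<integral>\<^sup>+x. (\<Prod>b\<in>B. eroot n (G b (restrict x (N b)))) \<partial>Pi\<^sub>M A (\<lambda>_. lborel))"
    by (intro nn_integral_mono point)
  also have "\<dots> \<le> (\<Prod>b\<in>B. eroot n (\<integral>\<^sup>+x. G b x \<partial>Pi\<^sub>M (N b) (\<lambda>_. lborel)))"
    unfolding G_def
    by (intro finner_inequality finite_A finite_B n_pos N_sub degree borel_measurable_unfold hm finite_N
        lborel.sigma_finite_measure_axioms)
  also have "\<dots> \<le> (\<Prod>b\<in>B. eroot n K)"
  proof (intro prod_mono_ennreal eroot_mono n_pos)
    fix b assume b: "b \<in> B"
    have "(\<integral>\<^sup>+x. G b x \<partial>Pi\<^sub>M (N b) (\<lambda>_. lborel)) = (\<integral>\<^sup>+x. h b x \<partial>Pi\<^sub>M (N b) (\<lambda>_. lborel))"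
      unfolding G_def using L b by (intro nn_integral_PiM_lborel_unfold[symmetric] finite_N hm) auto
    also have "\<dots> \<le> K" unfolding h_def using K[OF b e[OF b]] .
    finally show "(\<integral>\<^sup>+x. G b x \<partial>Pi\<^sub>M (N b) (\<lambda>_. lborel)) \<le> K" .
  qed
  also have "\<dots> = eroot n K ^ card B" by simp
  finally show ?thesis .
qed

end

subsection \<open>A near-uniform distribution with soft edges\<close>

text \<open>An antiderivative on the whole line instead of an integral from 0: its derivative is
  then two-sided at 0 and at negative arguments as well.\<close>

definition primitive :: "(real \<Rightarrow> real) \<Rightarrow> real \<Rightarrow> real" where
  "primitive f = (SOME F. F 0 = 0 \<and> (\<forall>x. (F has_real_derivative f x) (at x)))"

lemma
  assumes "continuous_on UNIV f"
  shows primitive_0: "primitive f 0 = 0"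
    and has_derivative_primitive: "(primitive f has_real_derivative f x) (at x)"
proof -
  have "isCont f x" for x
    using assms by (simp add: continuous_on_eq_continuous_at)
  then obtain F where F: "\<And>x. (F has_real_derivative f x) (at x)"
    using einterval_antiderivative[of "-\<infinity>" "\<infinity>" f]
    by (auto simp: has_real_derivative_iff_has_vector_derivative)
  have "((\<lambda>x. F x - F 0) has_real_derivative f x) (at x)" for x
    using F by (auto intro!: derivative_eq_intros)
  then have "\<exists>F. F 0 = 0 \<and> (\<forall>x. (F has_real_derivative f x) (at x))"
    by (intro exI[of _ "\<lambda>x. F x - F 0"]) auto
  from someI_ex[OF this] show "primitive f 0 = 0" "(primitive f has_real_derivative f x) (at x)"
    unfolding primitive_def by auto
qed

section \<open>The uniform law on the unit interval and Jensen's inequality for exp\<close>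

definition unit_uniform :: "real measure" where
  "unit_uniform = density lborel (\<lambda>x. ennreal (indicator {0..1} x))"

lemma sets_unit_uniform [measurable_cong, simp]: "sets unit_uniform = sets borel"
  by (simp add: unit_uniform_def)

lemma space_unit_uniform [simp]: "space unit_uniform = UNIV"
  by (simp add: unit_uniform_def)

lemma nn_integral_unit_uniform:
  "f \<in> borel_measurable borel \<Longrightarrow> (\<integral>\<^sup>+x. f x \<partial>unit_uniform) = (\<integral>\<^sup>+x. f x * indicator {0..1} x \<partial>lborel)"
  unfolding unit_uniform_def by (subst nn_integral_density) (auto simp: mult.commute ennreal_indicator)

lemma prob_space_unit_uniform: "prob_space unit_uniform"
proof
  have "emeasure unit_uniform UNIV = (\<integral>\<^sup>+x. 1 \<partial>unit_uniform)" by simp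
  also have "\<dots> = 1" by (subst nn_integral_unit_uniform) auto
  finally show "emeasure unit_uniform (space unit_uniform) = 1" by simp
qed

lemma sigma_finite_unit_uniform: "sigma_finite_measure unit_uniform"
  using prob_space_unit_uniform by (rule prob_space_imp_sigma_finite)

lemma AE_unit_uniform: "AE x in unit_uniform. x \<in> {0..1}"
  unfolding unit_uniform_def by (subst AE_density) (auto simp: indicator_def)

text \<open>An infinite right side is harmless, and otherwise exp Y is integrable, so that
  integrability of Y alone suffices for the convex inequality.\<close>

lemma (in prob_space) exp_expectation_le_nn_integral:
  assumes Y: "integrable M Y"
  shows "ennreal (exp (expectation Y)) \<le> (\<integral>\<^sup>+x. ennreal (exp (Y x)) \<partial>M)"
proof (cases "(\<integral>\<^sup>+x. ennreal (exp (Y x)) \<partial>M) = \<infinity>")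
  case False
  have [measurable]: "Y \<in> borel_measurable M" using Y by auto
  have int: "integrable M (\<lambda>x. exp (Y x))"
    using False by (intro integrableI_bounded) (auto simp: less_top)
  have "exp (expectation Y) \<le> expectation (\<lambda>x. exp (Y x))"
    using Y int exp_convex by (intro jensens_inequality[where I=UNIV]) auto
  then have "ennreal (exp (expectation Y)) \<le> ennreal (expectation (\<lambda>x. exp (Y x)))" by (rule ennreal_leI)
  also have "\<dots> = (\<integral>\<^sup>+x. ennreal (exp (Y x)) \<partial>M)"
    using int by (intro nn_integral_eq_integral[symmetric]) auto
  finally show ?thesis .
qed auto

text \<open>At a vertex of the first class we sample \<open>x = X u\<close> with \<open>u\<close> uniform on \<open>[0, 1]\<close>. The map \<open>X\<close> is the
  identity except at distance of order \<open>1/n\<close> from the end points, where its derivative at \<open>t / n\<close> is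
  \<open>exp (l t)\<close>. The condition \<open>exp (l t) (1 - exp (- t)) \<le> 1\<close> makes the expected slack at the vertices of the
  second class at least \<open>1\<close> to first order.\<close>

locale edge_profile =
  fixes l :: "real \<Rightarrow> real" and M :: real
  assumes l_continuous: "continuous_on UNIV l"
    and l_nonneg: "l t \<ge> 0"
    and l_support: "t \<ge> M \<Longrightarrow> l t = 0"
    and l_bound: "t \<ge> 0 \<Longrightarrow> exp (l t) * (1 - exp (- t)) \<le> 1"
    and M_pos: "M > 0"
begin

text \<open>In units of 1/n: \<open>w\<close> is the excess of the derivative of \<open>X\<close>
  over 1 at one edge, \<open>W\<close> its total, by which each edge lengthens the support, and
  \<open>\<Theta> t\<close> the position reached at distance t from the edge.
  \<open>\<Lambda> M\<close> is the entropy gained at one edge.\<close>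

definition w :: "real \<Rightarrow> real" where "w t = exp (l t) - 1"
definition \<Psi> :: "real \<Rightarrow> real" where "\<Psi> = primitive w"
definition W :: real where "W = \<Psi> M"
definition \<Theta> :: "real \<Rightarrow> real" where "\<Theta> t = t + \<Psi> t"
definition \<Lambda> :: "real \<Rightarrow> real" where "\<Lambda> = primitive l"

text \<open>The summand \<open>W\<close> normalizes \<open>X n 0\<close> to 0 once n \<ge> M, and
  \<open>X n 1\<close> is then 1 + 2 W / n.\<close>

definition X :: "nat \<Rightarrow> real \<Rightarrow> real" where
  "X n s = s + (\<Psi> (n * s) + W - \<Psi> (n * (1 - s))) / n"

lemma w_continuous: "continuous_on UNIV w"
  unfolding w_def by (intro continuous_intros l_continuous)

lemma w_nonneg: "w t \<ge> 0"
  using l_nonneg[of t] by (simp add: w_def)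

lemma w_support: "t \<ge> M \<Longrightarrow> w t = 0"
  using l_support by (simp add: w_def)

lemma \<Psi>_0 [simp]: "\<Psi> 0 = 0"
  unfolding \<Psi>_def by (rule primitive_0[OF w_continuous])

lemma \<Psi>_deriv: "(\<Psi> has_real_derivative w t) (at t)"
  unfolding \<Psi>_def by (rule has_derivative_primitive[OF w_continuous])

lemma \<Psi>_mono: "s \<le> t \<Longrightarrow> \<Psi> s \<le> \<Psi> t"
  by (rule DERIV_nonneg_imp_nondecreasing) (use \<Psi>_deriv w_nonneg in blast)+

lemma \<Psi>_eq_W: 
  assumes "t \<ge> M" shows "\<Psi> t = W"
proof -
  have "\<Psi> t \<le> \<Psi> M"
    by (rule DERIV_nonpos_imp_nonincreasing[OF assms]) (metis \<Psi>_deriv w_support order_refl)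
  then show ?thesis using \<Psi>_mono[OF assms] by (simp add: W_def)
qed

lemma \<Psi>_le_W: "\<Psi> t \<le> W"
  using \<Psi>_mono[of t M] \<Psi>_eq_W[of t] by (cases "t \<le> M") (auto simp: W_def)

lemma W_nonneg: "W \<ge> 0"
  using \<Psi>_le_W[of 0] by simp

lemma \<Theta>_deriv: "(\<Theta> has_real_derivative exp (l t)) (at t)"
  unfolding \<Theta>_def using \<Psi>_deriv[of t] by (auto intro!: derivative_eq_intros simp: w_def)

lemma \<Theta>_0 [simp]: "\<Theta> 0 = 0" by (simp add: \<Theta>_def)

lemma W_le_\<Theta>: "W \<le> \<Theta> M" using M_pos by (simp add: \<Theta>_def W_def)

lemma \<Theta>_M_pos: "\<Theta> M > 0" using M_pos W_nonneg by (simp add: \<Theta>_def W_def)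

lemma l_measurable [measurable]: "l \<in> borel_measurable borel"
  using l_continuous by (rule borel_measurable_continuous_onI)

lemma \<Lambda>_0 [simp]: "\<Lambda> 0 = 0"
  unfolding \<Lambda>_def by (rule primitive_0[OF l_continuous])

lemma \<Lambda>_deriv: "(\<Lambda> has_real_derivative l t) (at t)"
  unfolding \<Lambda>_def by (rule has_derivative_primitive[OF l_continuous])

lemma \<Lambda>_eq: 
  assumes "t \<ge> M" shows "\<Lambda> t = \<Lambda> M"
proof (rule antisym)
  show "\<Lambda> t \<le> \<Lambda> M"
    by (rule DERIV_nonpos_imp_nonincreasing[OF assms]) (metis \<Lambda>_deriv l_support order_refl)
  show "\<Lambda> M \<le> \<Lambda> t"
    by (rule DERIV_nonneg_imp_nondecreasing[OF assms]) (metis \<Lambda>_deriv l_support order_refl)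
qed

lemma nn_integral_exp_l:
  assumes "0 \<le> b"
  shows "(\<integral>\<^sup>+t. ennreal (exp (l t)) * indicator {0..b} t \<partial>lborel) = ennreal (\<Theta> b)"
  using nn_integral_FTC_Icc[of "\<lambda>t. exp (l t)" 0 b \<Theta>] assms \<Theta>_deriv by simp

lemma nn_integral_w:
  "(\<integral>\<^sup>+t. ennreal (w t) * indicator {0..M} t \<partial>lborel) = ennreal W"
proof -
  have [measurable]: "w \<in> borel_measurable borel" unfolding w_def by measurable
  show ?thesis
    using nn_integral_FTC_Icc[of w 0 M \<Psi>] M_pos \<Psi>_deriv w_nonneg by (simp add: W_def)
qed

section \<open>The sampling map for a degree so large that the two edge zones do not overlap\<close>

context
  fixes n :: nat
  assumes n: "real n \<ge> 2 * M"
begin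

lemma n_pos': "real n > 0" using n M_pos by linarith

lemma X_deriv:
  fixes s :: real
  shows "(X n has_real_derivative 1 + w (n * s) + w (n * (1 - s))) (at s)"
proof -
  have "((\<lambda>s. \<Psi> (n * s)) has_real_derivative w (n * s) * n) (at s)"
    by (rule DERIV_chain2[OF \<Psi>_deriv]) (auto intro!: derivative_eq_intros)
  moreover have "((\<lambda>s. \<Psi> (n * (1 - s))) has_real_derivative w (n * (1 - s)) * (- n)) (at s)"
    by (rule DERIV_chain2[OF \<Psi>_deriv]) (auto intro!: derivative_eq_intros)
  ultimately show ?thesis
    unfolding X_def using n_pos' by (auto intro!: derivative_eq_intros simp: field_simps)
qed

lemma X_measurable [measurable]: "X n \<in> borel_measurable borel"
  by (rule borel_measurable_continuous_onI)
    (use X_deriv DERIV_isCont in \<open>blast intro: continuous_at_imp_continuous_on\<close>)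

lemma X_1: "X n 1 = 1 + 2 * W / n"
proof -
  have "\<Psi> n = W" using n M_pos by (intro \<Psi>_eq_W) linarith
  then show ?thesis by (simp add: X_def)
qed

lemma X_reflect:
  fixes s :: real
  shows "X n (1 - s) = X n 1 - X n s"
proof -
  have "X n s + X n (1 - s) = 1 + (W + W) / n"
    unfolding X_def by (simp add: add_divide_distrib diff_divide_distrib)
  then show ?thesis unfolding X_1 by simp
qed

text \<open>The far edge contributes \<open>W - \<Psi> (n * (1 - s))\<close>, which is nonnegative.
  Capping the argument at \<open>M\<close> keeps the bound of order 1/n, as the expansion of the
  logarithm of the slack requires.\<close>

lemma X_ge:
  fixes s :: real
  assumes "0 \<le> s"
  shows "\<Theta> (min M (n * s)) / n \<le> X n s"
proof -
  have "\<Theta> (min M (n * s)) \<le> n * s + \<Psi> (n * s)"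
    unfolding \<Theta>_def by (intro add_mono \<Psi>_mono) auto
  also have "\<dots> \<le> n * s + (\<Psi> (n * s) + W - \<Psi> (n * (1 - s)))"
    using \<Psi>_le_W[of "n * (1 - s)"] by simp
  also have "\<dots> = n * X n s" using n_pos' by (simp add: X_def field_simps)
  finally show ?thesis using n_pos' by (simp add: field_simps)
qed

lemma X_nonneg:
  fixes s :: real
  shows "0 \<le> s \<Longrightarrow> 0 \<le> X n s"
proof -
  assume s: "0 \<le> s"
  have "0 \<le> \<Theta> (min M (n * s))"
    using \<Psi>_mono[of 0 "min M (n * s)"] s M_pos by (auto simp: \<Theta>_def)
  then have "0 \<le> \<Theta> (min M (n * s)) / n" by simp
  then show ?thesis using X_ge[OF s] by linarith
qed

lemma nn_integral_X_le:
  assumes h [measurable]: "h \<in> borel_measurable borel"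
  shows "(\<integral>\<^sup>+u. ennreal (1 + w (n * u) + w (n * (1 - u))) * h (X n u) \<partial>unit_uniform) \<le> (\<integral>\<^sup>+x. h x \<partial>lborel)"
proof -
  have [measurable]: "w \<in> borel_measurable borel" unfolding w_def by measurable
  have "(\<integral>\<^sup>+u. ennreal (1 + w (n * u) + w (n * (1 - u))) * h (X n u) \<partial>unit_uniform) =
    (\<integral>\<^sup>+u. h (X n u) * ennreal (1 + w (n * u) + w (n * (1 - u))) * indicator {0..1} u \<partial>lborel)"
    by (subst nn_integral_unit_uniform) (auto simp: mult_ac)
  also have "\<dots> = (\<integral>\<^sup>+x. h x * indicator {X n 0..X n 1} x \<partial>lborel)"
  proof (rule nn_integral_substitution_aux[symmetric])
    show "continuous_on {0..1} (\<lambda>u::real. 1 + w (n * u) + w (n * (1 - u)))"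
      by (intro continuous_intros continuous_on_compose2[OF w_continuous]) auto
    show "0 \<le> 1 + w (n * u) + w (n * (1 - u))" for u :: real
      using w_nonneg[of "n * u"] w_nonneg[of "n * (1 - u)"] by simp
  qed (auto intro: X_deriv)
  also have "\<dots> \<le> (\<integral>\<^sup>+x. h x \<partial>lborel)"
    by (intro nn_integral_mono) (auto simp: indicator_def)
  finally show ?thesis .
qed

text \<open>At most one of the two arguments lies below \<open>M\<close>, so one of the two
  exponents is 0. The right side is the derivative of \<open>X n\<close>, so its logarithm splits
  into the contributions of the two edges.\<close>

lemma exp_l_le:
  fixes u :: real
  shows "exp (l (n * u) + l (n * (1 - u))) \<le> 1 + w (n * u) + w (n * (1 - u))"
proof -
  have "n * u + n * (1 - u) = real n" by (simp add: algebra_simps)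
  then have "n * u \<ge> M \<or> n * (1 - u) \<ge> M" using n by linarith
  then show ?thesis using l_support by (auto simp: w_def)
qed

text \<open>The two choices of \<open>\<phi>\<close> are the distances to the left and to the right
  end. Rescaling by n turns the integral into that of l over its support, divided by n.\<close>

lemma expectation_l:
  fixes \<phi> :: "real \<Rightarrow> real"
  assumes \<phi>: "\<phi> = (\<lambda>u. u) \<or> \<phi> = (\<lambda>u. 1 - u)"
  shows "has_bochner_integral unit_uniform (\<lambda>u. l (n * \<phi> u)) (\<Lambda> M / n)"
proof -
  have c: "isCont l x" for x using l_continuous by (simp add: continuous_on_eq_continuous_at)
  have \<phi>m [measurable]: "\<phi> \<in> borel_measurable borel" using \<phi> by auto
  define F where "F u = (if \<phi> = (\<lambda>u. u) then \<Lambda> (n * u) / n else - \<Lambda> (n * (1 - u)) / n)" for u :: real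
  have "has_bochner_integral lborel (\<lambda>u. l (n * \<phi> u) * indicator {0..1} u) (F 1 - F 0)"
  proof (rule has_bochner_integral_FTC_Icc_real)
    fix u :: real
    have 1: "((\<lambda>s. \<Lambda> (n * s)) has_real_derivative l (n * u) * n) (at u)"
      by (rule DERIV_chain2[OF \<Lambda>_deriv]) (auto intro!: derivative_eq_intros)
    have 2: "((\<lambda>s. \<Lambda> (n * (1 - s))) has_real_derivative l (n * (1 - u)) * (- n)) (at u)"
      by (rule DERIV_chain2[OF \<Lambda>_deriv]) (auto intro!: derivative_eq_intros)
    show "(F has_real_derivative l (n * \<phi> u)) (at u)"
    proof (cases "\<phi> = (\<lambda>u. u)")
      case True
      then show ?thesis using DERIV_cdivide[OF 1, of n] n_pos' by (simp add: F_def[abs_def])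
    next
      case False
      then show ?thesis
        using \<phi> DERIV_cdivide[OF DERIV_minus[OF 2], of n] n_pos' by (simp add: F_def[abs_def])
    qed
    show "isCont (\<lambda>u. l (n * \<phi> u)) u"
      using \<phi> by (auto intro!: isCont_o2[OF _ c] continuous_intros)
  qed auto
  moreover have "F 1 - F 0 = \<Lambda> M / n"
    using \<Lambda>_eq[of "real n"] n M_pos by (simp add: F_def)
  ultimately show ?thesis
    unfolding unit_uniform_def by (intro has_bochner_integral_density) (auto simp: mult.commute)
qed

text \<open>From n \<ge> 2 M follows t / n \<le> 1/2, where ln (1 - x) \<ge> - x - 2 x^2. The
  quadratic term costs at most 2 t^2 / n after multiplication by n.\<close>

lemma exp_minus_le:
  assumes t: "0 \<le> t" "t \<le> M"
  shows "exp (- t) \<le> (1 - t / n) ^ n + 2 * M\<^sup>2 / n"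
proof -
  have tn: "0 \<le> t / n" "t / n \<le> 1 / 2" using t n n_pos' by (auto simp: field_simps)
  have "exp (- t) - 2 * M\<^sup>2 / n \<le> exp (- t) - 2 * t\<^sup>2 / n"
    using t n_pos' by (intro diff_left_mono divide_right_mono mult_left_mono power_mono) auto
  also have "\<dots> \<le> exp (- t) * (1 + - (2 * t\<^sup>2 / n))"
  proof -
    have "exp (- t) * (2 * t\<^sup>2 / n) \<le> 1 * (2 * t\<^sup>2 / n)"
      using t n_pos' by (intro mult_right_mono) auto
    then show ?thesis by (simp add: algebra_simps)
  qed
  also have "\<dots> \<le> exp (- t) * exp (- (2 * t\<^sup>2 / n))"
    by (intro mult_left_mono exp_ge_add_one_self) auto
  also have "\<dots> = exp (n * (- (t / n) - 2 * (t / n)\<^sup>2))"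
    using n_pos' by (simp add: exp_add[symmetric] power2_eq_square field_simps)
  also have "\<dots> \<le> exp (n * ln (1 - t / n))"
    using n_pos' tn ln_one_minus_pos_lower_bound[of "t / n"] by (simp only: exp_le_cancel_iff mult_left_mono)
  also have "\<dots> = (1 - t / n) ^ n"
  proof -
    have "0 < 1 - t / n" using tn by linarith
    then show ?thesis by (simp only: exp_of_nat_mult exp_ln)
  qed
  finally show ?thesis by simp
qed

text \<open>The factor (1 - t / n)^n is the probability that n uniform points all stay at distance
  at least t / n from an end, so the integral is the expected position of the extreme point in units
  of 1/n. The profile condition says \<open>w t \<le> exp (l t) * exp (- t)\<close>. Hence up to
  O(1/n) this expectation is at least \<open>W\<close>, the length by which that edge was
  extended.\<close>

lemma nn_integral_occupancy:
  "ennreal W \<le> (\<integral>\<^sup>+t. ennreal (exp (l t) * (1 - t / n) ^ n) * indicator {0..M} t \<partial>lborel) + ennreal (2 * M\<^sup>2 / n * \<Theta> M)"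
proof -
  have "ennreal W = (\<integral>\<^sup>+t. ennreal (w t) * indicator {0..M} t \<partial>lborel)" by (rule nn_integral_w[symmetric])
  also have "\<dots> \<le> (\<integral>\<^sup>+t. ennreal (exp (l t) * (1 - t / n) ^ n) * indicator {0..M} t +
      ennreal (2 * M\<^sup>2 / n) * (ennreal (exp (l t)) * indicator {0..M} t) \<partial>lborel)"
  proof (rule nn_integral_mono)
    fix t :: real
    show "ennreal (w t) * indicator {0..M} t \<le> ennreal (exp (l t) * (1 - t / n) ^ n) * indicator {0..M} t +
      ennreal (2 * M\<^sup>2 / n) * (ennreal (exp (l t)) * indicator {0..M} t)"
    proof (cases "t \<in> {0..M}")
      case True
      then have tn: "t / n \<le> 1" using n n_pos' M_pos by (auto simp: field_simps)
      have "w t \<le> exp (l t) * exp (- t)"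
        using l_bound[of t] True by (simp add: w_def algebra_simps)
      also have "\<dots> \<le> exp (l t) * ((1 - t / n) ^ n + 2 * M\<^sup>2 / n)"
        using True by (intro mult_left_mono exp_minus_le) auto
      also have "\<dots> = exp (l t) * (1 - t / n) ^ n + 2 * M\<^sup>2 / n * exp (l t)"
        by (simp add: algebra_simps)
      finally have "ennreal (w t) \<le> ennreal (exp (l t) * (1 - t / n) ^ n + 2 * M\<^sup>2 / n * exp (l t))"
        by (rule ennreal_leI)
      also have "\<dots> = ennreal (exp (l t) * (1 - t / n) ^ n) + ennreal (2 * M\<^sup>2 / n) * ennreal (exp (l t))"
      proof -
        have "ennreal (2 * M\<^sup>2 / n * exp (l t)) = ennreal (2 * M\<^sup>2 / n) * ennreal (exp (l t))"
          by (intro ennreal_mult) auto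
        moreover have "0 \<le> exp (l t) * (1 - t / n) ^ n" "0 \<le> 2 * M\<^sup>2 / n * exp (l t)"
          using tn by auto
        ultimately show ?thesis by (metis ennreal_plus)
      qed
      finally show ?thesis using True by simp
    qed simp
  qed
  also have "\<dots> = (\<integral>\<^sup>+t. ennreal (exp (l t) * (1 - t / n) ^ n) * indicator {0..M} t \<partial>lborel) +
      ennreal (2 * M\<^sup>2 / n) * ennreal (\<Theta> M)"
    using M_pos by (subst nn_integral_add) (auto simp: nn_integral_cmult nn_integral_exp_l)
  also have "ennreal (2 * M\<^sup>2 / n) * ennreal (\<Theta> M) = ennreal (2 * M\<^sup>2 / n * \<Theta> M)"
    using \<Theta>_M_pos by (intro ennreal_mult[symmetric]) auto
  finally show ?thesis .
qed

end

end

subsection \<open>Regular bipartite graphs: lower bound\<close>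

context edge_profile
begin

text \<open>Layer-cake form of \<open>\<Theta> (min M (n * (MIN a\<in>S. \<phi> (u a))))\<close>, whose expectation is computed by Fubini.\<close>

definition Q :: "nat \<Rightarrow> (real \<Rightarrow> real) \<Rightarrow> 'a set \<Rightarrow> ('a \<Rightarrow> real) \<Rightarrow> ennreal" where
  "Q n \<phi> S u = (\<integral>\<^sup>+t. ennreal (exp (l t)) * indicator {0..M} t * (\<Prod>a\<in>S. indicator {0<..} (n * \<phi> (u a) - t)) \<partial>lborel)"

lemma Q_le_\<Theta>: 
  assumes "finite S" "a \<in> S" "0 \<le> \<phi> (u a)"
  shows "Q n \<phi> S u \<le> ennreal (\<Theta> (min M (n * \<phi> (u a))))"
proof -
  have "Q n \<phi> S u \<le> (\<integral>\<^sup>+t. ennreal (exp (l t)) * indicator {0..min M (n * \<phi> (u a))} t \<partial>lborel)"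
    unfolding Q_def
  proof (rule nn_integral_mono)
    fix t :: real
    have "(\<Prod>a\<in>S. indicator {0<..} (n * \<phi> (u a) - t)) \<le> (indicator {0<..} (n * \<phi> (u a) - t) :: ennreal)"
    proof -
      have "(\<Prod>a\<in>S - {a}. indicator {0<..} (n * \<phi> (u a) - t)) \<le> (\<Prod>a\<in>S - {a}. 1 :: ennreal)"
        by (intro prod_mono_ennreal) (auto simp: indicator_def)
      then show ?thesis
        using assms by (subst prod.remove[of S a]) (auto simp: indicator_def)
    qed
    then have "ennreal (exp (l t)) * indicator {0..M} t * (\<Prod>a\<in>S. indicator {0<..} (n * \<phi> (u a) - t)) \<le>
        ennreal (exp (l t)) * indicator {0..M} t * indicator {0<..} (n * \<phi> (u a) - t)"
      by (rule mult_left_mono) auto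
    also have "\<dots> \<le> ennreal (exp (l t)) * indicator {0..min M (n * \<phi> (u a))} t"
      by (auto simp: indicator_def)
    finally show "ennreal (exp (l t)) * indicator {0..M} t * (\<Prod>a\<in>S. indicator {0<..} (n * \<phi> (u a) - t)) \<le>
        ennreal (exp (l t)) * indicator {0..min M (n * \<phi> (u a))} t" .
  qed
  also have "\<dots> = ennreal (\<Theta> (min M (n * \<phi> (u a))))"
    using assms M_pos by (intro nn_integral_exp_l) auto
  finally show ?thesis .
qed

lemma Q_le: "Q n \<phi> S u \<le> ennreal (\<Theta> M)"
proof -
  have "Q n \<phi> S u \<le> (\<integral>\<^sup>+t. ennreal (exp (l t)) * indicator {0..M} t \<partial>lborel)"
    unfolding Q_def
  proof (rule nn_integral_mono)
    fix t :: real
    have "(\<Prod>a\<in>S. indicator {0<..} (n * \<phi> (u a) - t)) \<le> (\<Prod>a\<in>S. 1 :: ennreal)"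
      by (intro prod_mono_ennreal) (auto simp: indicator_def)
    then have "ennreal (exp (l t)) * indicator {0..M} t * (\<Prod>a\<in>S. indicator {0<..} (n * \<phi> (u a) - t)) \<le>
        ennreal (exp (l t)) * indicator {0..M} t * 1"
      by (intro mult_left_mono) auto
    then show "ennreal (exp (l t)) * indicator {0..M} t * (\<Prod>a\<in>S. indicator {0<..} (n * \<phi> (u a) - t)) \<le>
        ennreal (exp (l t)) * indicator {0..M} t" by simp
  qed
  then show ?thesis using M_pos by (simp add: nn_integral_exp_l)
qed

lemma measurable_Q_integrand:
  fixes A :: "'a set" and N :: "real measure"
  assumes [measurable_cong]: "sets N = sets borel" and [measurable]: "\<phi> \<in> borel_measurable borel" and S: "S \<subseteq> A"
  shows "(\<lambda>(u, t). ennreal (exp (l t)) * indicator {0..M} t * (\<Prod>a\<in>S. indicator {0<..} (n * \<phi> (u a) - t)))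
      \<in> borel_measurable (Pi\<^sub>M A (\<lambda>_. N) \<Otimes>\<^sub>M lborel)"
proof -
  let ?P = "Pi\<^sub>M A (\<lambda>_. N) \<Otimes>\<^sub>M (lborel :: real measure)"
  have "(\<lambda>p. \<Prod>a\<in>S. indicator {0<..} (n * \<phi> (fst p a) - snd p) :: ennreal) \<in> borel_measurable ?P"
  proof (rule borel_measurable_prod_ennreal)
    fix a assume "a \<in> S"
    then have "a \<in> A" using S by auto
    have "(\<lambda>p. fst p a) \<in> measurable ?P N"
      by (rule measurable_compose[OF measurable_fst measurable_component_singleton[OF \<open>a \<in> A\<close>]])
    then have [measurable]: "(\<lambda>p. fst p a) \<in> borel_measurable ?P"
      by (simp add: measurable_cong_sets[OF refl assms(1)])
    have "(\<lambda>p. n * \<phi> (fst p a) - snd p) \<in> borel_measurable ?P"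
      by measurable
    from measurable_compose[OF this, of "indicator {0<..} :: real \<Rightarrow> ennreal" borel]
    show "(\<lambda>p. indicator {0<..} (n * \<phi> (fst p a) - snd p) :: ennreal) \<in> borel_measurable ?P"
      by simp
  qed
  then show ?thesis unfolding split_beta' by measurable
qed

lemma measurable_Q:
  fixes A :: "'a set" and N :: "real measure"
  assumes "sets N = sets borel" "\<phi> \<in> borel_measurable borel" "S \<subseteq> A"
  shows "Q n \<phi> S \<in> borel_measurable (Pi\<^sub>M A (\<lambda>_. N))"
  unfolding Q_def by (rule lborel.borel_measurable_nn_integral) (use measurable_Q_integrand[OF assms] in simp)

text \<open>Fubini turns the expectation into an integral over levels t. The probability that every
  point of \<open>S\<close> is further than t / n from the chosen end is a power by independence;
  coordinates outside \<open>S\<close> contribute total mass 1.\<close>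

lemma nn_integral_Q:
  fixes A :: "'a set" and \<phi> :: "real \<Rightarrow> real"
  assumes n: "real n \<ge> 2 * M" and \<phi>: "\<phi> = (\<lambda>u. u) \<or> \<phi> = (\<lambda>u. 1 - u)"
    and S: "S \<subseteq> A" "card S = n" and A: "finite A"
  shows "(\<integral>\<^sup>+u. Q n \<phi> S u \<partial>Pi\<^sub>M A (\<lambda>_. unit_uniform)) =
    (\<integral>\<^sup>+t. ennreal (exp (l t) * (1 - t / n) ^ n) * indicator {0..M} t \<partial>lborel)"
proof -
  have \<phi>m [measurable]: "\<phi> \<in> borel_measurable borel" using \<phi> by auto
  have n0: "real n > 0" by (rule n_pos'[OF n])
  let ?P = "Pi\<^sub>M A (\<lambda>_. unit_uniform)"
  interpret U: product_sigma_finite "\<lambda>_::'a. unit_uniform"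
    by (rule product_sigma_finite.intro) (rule sigma_finite_unit_uniform)
  interpret P: sigma_finite_measure ?P using A by (rule U.sigma_finite)
  interpret pair_sigma_finite ?P "lborel :: real measure" ..
  have single: "(\<integral>\<^sup>+x. indicator {0<..} (n * \<phi> x - t) \<partial>unit_uniform) = ennreal (1 - t / n)"
    if t: "0 \<le> t" "t \<le> M" for t
  proof -
    have tn: "0 \<le> t / n" "t / n \<le> 1" using t n n0 by (auto simp: field_simps)
    have "(\<integral>\<^sup>+x. indicator {0<..} (n * \<phi> x - t) \<partial>unit_uniform) =
      (\<integral>\<^sup>+x. indicator {0<..} (n * \<phi> x - t) * indicator {0..1} x \<partial>lborel)"
      by (subst nn_integral_unit_uniform) auto
    also have "\<dots> = (\<integral>\<^sup>+x. indicator (if \<phi> = (\<lambda>u. u) then {t / n<..1} else {0..<1 - t / n}) x \<partial>lborel)"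
    proof (rule nn_integral_cong)
      fix x :: real
      have "0 < n * \<phi> x - t \<longleftrightarrow> t / n < \<phi> x" using n0 by (simp add: field_simps)
      then show "indicator {0<..} (n * \<phi> x - t) * indicator {0..1} x =
          (indicator (if \<phi> = (\<lambda>u. u) then {t / n<..1} else {0..<1 - t / n}) x :: ennreal)"
        using \<phi> tn by (auto simp: indicator_def)
    qed
    also have "\<dots> = ennreal (1 - t / n)"
      using tn by auto
    finally show ?thesis .
  qed
  have inner: "(\<integral>\<^sup>+u. ennreal (exp (l t)) * indicator {0..M} t * (\<Prod>a\<in>S. indicator {0<..} (n * \<phi> (u a) - t)) \<partial>?P) =
      ennreal (exp (l t) * (1 - t / n) ^ n) * indicator {0..M} t" for t
  proof (cases "t \<in> {0..M}")
    case True
    then have tn: "0 \<le> 1 - t / n" using n n0 by (auto simp: field_simps)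
    have "(\<Prod>a\<in>S. indicator {0<..} (n * \<phi> (u a) - t)) =
        (\<Prod>a\<in>A. if a \<in> S then indicator {0<..} (n * \<phi> (u a) - t) else (1 :: ennreal))" for u
      using S A by (subst prod.inter_restrict[symmetric]) (auto simp: Int_absorb1)
    then have "(\<integral>\<^sup>+u. (\<Prod>a\<in>S. indicator {0<..} (n * \<phi> (u a) - t)) \<partial>?P) =
       (\<integral>\<^sup>+u. (\<Prod>a\<in>A. (if a \<in> S then indicator {0<..} (n * \<phi> (u a) - t) else 1)) \<partial>?P)" by simp
    also have "\<dots> = (\<Prod>a\<in>A. \<integral>\<^sup>+x. (if a \<in> S then indicator {0<..} (n * \<phi> x - t) else 1) \<partial>unit_uniform)"
      using A by (intro U.product_nn_integral_prod) auto
    also have "\<dots> = (\<Prod>a\<in>A. if a \<in> S then ennreal (1 - t / n) else 1)"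
      using True single prob_space.emeasure_space_1[OF prob_space_unit_uniform]
      by (intro prod.cong) auto
    also have "\<dots> = ennreal (1 - t / n) ^ n"
      using S A by (subst prod.inter_restrict[symmetric]) (auto simp: Int_absorb1)
    also have "\<dots> = ennreal ((1 - t / n) ^ n)" using tn by (rule ennreal_power)
    finally have *: "(\<integral>\<^sup>+u. (\<Prod>a\<in>S. indicator {0<..} (n * \<phi> (u a) - t)) \<partial>?P) = ennreal ((1 - t / n) ^ n)" .
    have m: "(\<lambda>u. \<Prod>a\<in>S. indicator {0<..} (n * \<phi> (u a) - t) :: ennreal) \<in> borel_measurable ?P"
    proof (rule borel_measurable_prod_ennreal)
      fix a assume "a \<in> S"
      then have "a \<in> A" using S by auto
      show "(\<lambda>u. indicator {0<..} (n * \<phi> (u a) - t) :: ennreal) \<in> borel_measurable ?P"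
        by (rule measurable_compose[OF measurable_component_singleton[OF \<open>a \<in> A\<close>]]) measurable
    qed
    show ?thesis
      using True tn by (subst nn_integral_cmult[OF m]) (simp add: * ennreal_mult)
  qed simp
  have "(\<integral>\<^sup>+u. Q n \<phi> S u \<partial>?P) = (\<integral>\<^sup>+t. (\<integral>\<^sup>+u. ennreal (exp (l t)) * indicator {0..M} t *
      (\<Prod>a\<in>S. indicator {0<..} (n * \<phi> (u a) - t)) \<partial>?P) \<partial>lborel)"
    unfolding Q_def
    by (rule Fubini'[symmetric]) (rule measurable_Q_integrand[OF sets_unit_uniform \<phi>m S(1)])
  then show ?thesis unfolding inner .
qed

lemma expectation_Q:
  fixes A :: "'a set" and \<phi> :: "real \<Rightarrow> real"
  assumes n: "real n \<ge> 2 * M" and \<phi>: "\<phi> = (\<lambda>u. u) \<or> \<phi> = (\<lambda>u. 1 - u)"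
    and S: "S \<subseteq> A" "card S = n" and A: "finite A"
  shows "integrable (Pi\<^sub>M A (\<lambda>_. unit_uniform)) (\<lambda>u. enn2real (Q n \<phi> S u))"
    and "W - 2 * M\<^sup>2 / n * \<Theta> M \<le> (\<integral>u. enn2real (Q n \<phi> S u) \<partial>Pi\<^sub>M A (\<lambda>_. unit_uniform))"
proof -
  let ?P = "Pi\<^sub>M A (\<lambda>_. unit_uniform)"
  interpret P: prob_space ?P by (intro prob_space_PiM prob_space_unit_uniform)
  have \<phi>m [measurable]: "\<phi> \<in> borel_measurable borel" using \<phi> by auto
  note [measurable] = measurable_Q[OF sets_unit_uniform \<phi>m S(1)]
  have fin: "Q n \<phi> S u = ennreal (enn2real (Q n \<phi> S u))" for u
    using le_less_trans[OF Q_le[of n \<phi> S u] ennreal_less_top] by simp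
  have b: "enn2real (Q n \<phi> S u) \<le> \<Theta> M" for u
    using Q_le[of n \<phi> S u] \<Theta>_M_pos by (simp add: enn2real_leI)
  show int: "integrable ?P (\<lambda>u. enn2real (Q n \<phi> S u))"
    using b by (intro P.integrable_const_bound[where B="\<Theta> M"]) auto
  have "ennreal W \<le> (\<integral>\<^sup>+u. Q n \<phi> S u \<partial>?P) + ennreal (2 * M\<^sup>2 / n * \<Theta> M)"
    unfolding nn_integral_Q[OF assms] by (rule nn_integral_occupancy[OF n])
  also have "(\<integral>\<^sup>+u. Q n \<phi> S u \<partial>?P) = (\<integral>\<^sup>+u. ennreal (enn2real (Q n \<phi> S u)) \<partial>?P)"
    using fin by (intro nn_integral_cong) auto
  also have "\<dots> = ennreal (\<integral>u. enn2real (Q n \<phi> S u) \<partial>?P)"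
    using int by (intro nn_integral_eq_integral) auto
  also have "\<dots> + ennreal (2 * M\<^sup>2 / n * \<Theta> M) = ennreal ((\<integral>u. enn2real (Q n \<phi> S u) \<partial>?P) + 2 * M\<^sup>2 / n * \<Theta> M)"
    using \<Theta>_M_pos by (intro ennreal_plus[symmetric]) auto
  finally show "W - 2 * M\<^sup>2 / n * \<Theta> M \<le> (\<integral>u. enn2real (Q n \<phi> S u) \<partial>?P)"
    using \<Theta>_M_pos by (subst (asm) ennreal_le_iff) (auto intro!: add_nonneg_nonneg)
qed

end

context bipartite_regular
begin

text \<open>The support of the law has length 1 + 2 W / n, but the extreme values over a
  neighbourhood stay away from its two ends by about W / n or more on average. So the expected slack
  is at least 1 - O(1/n^2), and to first order only the entropy 2 \<Lambda> / n per vertex of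
  \<open>A\<close> remains. The factor 2 bounds the length of the support, over which the root value
  ranges.\<close>

lemma vol_ge:
  assumes "edge_profile l M" and n1: "real n \<ge> 2 * M" and n2: "real n \<ge> 8 * edge_profile.\<Theta> l M"
  defines "\<theta> \<equiv> edge_profile.\<Theta> l M"
  shows "ennreal (exp (card A * (2 * edge_profile.\<Lambda> l M / n) - card B * ((4 * M\<^sup>2 * \<theta> + 32 * \<theta>\<^sup>2) / (real n)\<^sup>2)))
    \<le> ennreal 2 * vol"
proof -
  interpret E: edge_profile l M by fact
  have \<theta>: "\<theta> > 0" "\<theta> = E.\<Theta> M" using E.\<Theta>_M_pos by (auto simp: \<theta>_def)
  have n0: "real n > 0" using n_pos by simp
  let ?P = "Pi\<^sub>M A (\<lambda>_. unit_uniform)"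
  interpret P: prob_space ?P by (intro prob_space_PiM prob_space_unit_uniform)
  let ?i = "\<lambda>u::real. u" and ?j = "\<lambda>u::real. 1 - u"
  define q1 where "q1 b u = enn2real (E.Q n ?i (N b) u)" for b u
  define q2 where "q2 b u = enn2real (E.Q n ?j (N b) u)" for b u
  \<comment> \<open>A lower bound for the slack at \<open>b\<close> minus 1: the values on
    \<open>N b\<close> lie between \<open>q1 b u / n\<close> and
    \<open>T - q2 b u / n\<close>.\<close>
  define y where "y b u = (q1 b u + q2 b u - 2 * E.W) / n" for b u
  \<comment> \<open>From ln (1 + y) \<ge> y - 2 y^2 for |y| \<le> 1/2, with |y| \<le> 4 \<theta> /
    n. The assumption n \<ge> 8 \<theta> is what brings |y| below 1/2. It produces the term 32
    \<theta>^2 / n^2.\<close>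
  define c where "c = 2 * (4 * \<theta> / n)\<^sup>2"
  define Y where "Y u = (\<Sum>a\<in>A. l (n * u a) + l (n * (1 - u a))) + (\<Sum>b\<in>B. y b u - c)" for u :: "'a \<Rightarrow> real"
  define T where "T = E.X n 1"
  define H where "H x = indicator {0..T} (x r) * (\<Prod>b\<in>B. slack (N b) x)" for x
  have T: "T = 1 + 2 * E.W / n" unfolding T_def by (rule E.X_1[OF n1])
  have q: "0 \<le> q1 b u" "q1 b u \<le> \<theta>" "0 \<le> q2 b u" "q2 b u \<le> \<theta>" for b u
    using E.Q_le[of n ?i "N b" u] E.Q_le[of n ?j "N b" u] \<theta> by (auto simp: q1_def q2_def enn2real_leI)
  have W: "0 \<le> E.W" "E.W \<le> \<theta>" using E.W_nonneg E.W_le_\<Theta> \<theta> by auto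
  have Hm: "H \<in> borel_measurable (Pi\<^sub>M A (\<lambda>_. lborel))"
    unfolding H_def using root by (intro borel_measurable_times_ennreal measurable_prod_slack measurable_indicator_component) auto

  have y_abs: "\<bar>y b u\<bar> \<le> 4 * \<theta> / n" for b u
  proof -
    have "\<bar>q1 b u + q2 b u - 2 * E.W\<bar> \<le> 4 * \<theta>" using q[of b u] W by linarith
    then show ?thesis using n0 by (simp add: y_def abs_divide divide_right_mono)
  qed
  have y_half: "4 * \<theta> / n \<le> 1 / 2" using n2 n0 by (simp add: \<theta>_def field_simps)
  have exp_y: "exp (y b u - c) \<le> 1 + y b u" for b u
  proof -
    have h: "\<bar>y b u\<bar> \<le> 1 / 2" using y_abs[of b u] y_half by linarith
    have "(y b u)\<^sup>2 \<le> (4 * \<theta> / n)\<^sup>2" using power_mono[OF y_abs[of b u], of 2] by simp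
    then have "y b u - c \<le> ln (1 + y b u)"
      using abs_ln_one_plus_x_minus_x_bound[OF h] by (simp add: c_def)
    then have "exp (y b u - c) \<le> exp (ln (1 + y b u))" by simp
    also have "\<dots> = 1 + y b u" using h by simp
    finally show ?thesis .
  qed

  have int_l: "integrable ?P (\<lambda>u. l (n * \<phi> (u a)))" "(\<integral>u. l (n * \<phi> (u a)) \<partial>?P) = E.\<Lambda> M / n"
    if a: "a \<in> A" and \<phi>: "\<phi> = ?i \<or> \<phi> = ?j" for a and \<phi> :: "real \<Rightarrow> real"
  proof -
    have d: "distr ?P unit_uniform (\<lambda>u. u a) = unit_uniform"
      using distr_PiM_component[of A "\<lambda>_. unit_uniform" a] prob_space_unit_uniform a by auto
    have [measurable]: "\<phi> \<in> borel_measurable borel" using \<phi> by auto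
    have lm: "(\<lambda>u. l (n * \<phi> u)) \<in> borel_measurable unit_uniform" by measurable
    have am: "(\<lambda>u. u a) \<in> measurable ?P unit_uniform" using a by (rule measurable_component_singleton)
    note e = E.expectation_l[OF n1 \<phi>]
    show "integrable ?P (\<lambda>u. l (n * \<phi> (u a)))"
      using e integrable_distr_eq[OF am lm] unfolding d by (simp add: has_bochner_integral_iff)
    show "(\<integral>u. l (n * \<phi> (u a)) \<partial>?P) = E.\<Lambda> M / n"
      using e integral_distr[OF am lm] unfolding d by (simp add: has_bochner_integral_iff)
  qed
  have int_q: "integrable ?P (q1 b)" "integrable ?P (q2 b)"
    "E.W - 2 * M\<^sup>2 / n * \<theta> \<le> P.expectation (q1 b)" "E.W - 2 * M\<^sup>2 / n * \<theta> \<le> P.expectation (q2 b)"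
    if "b \<in> B" for b
    unfolding q1_def[abs_def] q2_def[abs_def] \<theta>(2)
    by (rule E.expectation_Q[OF n1 _ N_sub[OF that] card_N[OF that] finite_A], simp)+
  have int_y: "integrable ?P (y b)" if "b \<in> B" for b
    unfolding y_def[abs_def] using int_q[OF that] by auto
  have int_Y: "integrable ?P Y"
    unfolding Y_def[abs_def] using int_y int_l(1)[of _ ?i] int_l(1)[of _ ?j] by auto
  have exp_y_ge: "- (4 * M\<^sup>2 * \<theta>) / (real n)\<^sup>2 \<le> P.expectation (y b)" if "b \<in> B" for b
  proof -
    have "- (4 * M\<^sup>2 * \<theta>) / (real n)\<^sup>2 = 2 * ((E.W - 2 * M\<^sup>2 / n * \<theta>) - E.W) / n"
      using n0 by (simp add: power2_eq_square field_simps)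
    also have "\<dots> \<le> (P.expectation (q1 b) + P.expectation (q2 b) - 2 * E.W) / n"
    proof (rule divide_right_mono)
      have "2 * ((e - \<delta>) - e) \<le> p + q - 2 * e" if "e - \<delta> \<le> p" "e - \<delta> \<le> q" for p q e \<delta> :: real
        using add_mono[OF that] by (simp add: algebra_simps)
      from this[OF int_q(3,4)[OF that]]
      show "2 * ((E.W - 2 * M\<^sup>2 / n * \<theta>) - E.W) \<le> P.expectation (q1 b) + P.expectation (q2 b) - 2 * E.W" .
    qed (use n0 in simp)
    also have "\<dots> = P.expectation (y b)"
      unfolding y_def[abs_def] using int_q[OF that] P.prob_space by simp
    finally show ?thesis .
  qed
  have "P.expectation Y = (\<Sum>a\<in>A. P.expectation (\<lambda>u. l (n * u a)) + P.expectation (\<lambda>u. l (n * (1 - u a)))) +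
      (\<Sum>b\<in>B. P.expectation (y b) - c)"
    unfolding Y_def[abs_def] using int_y int_l(1)[of _ ?i] int_l(1)[of _ ?j] P.prob_space
    by (subst Bochner_Integration.integral_add) (auto simp: Bochner_Integration.integral_sum)
  also have "\<dots> \<ge> (\<Sum>a\<in>A. E.\<Lambda> M / n + E.\<Lambda> M / n) + (\<Sum>b\<in>B. - (4 * M\<^sup>2 * \<theta>) / (real n)\<^sup>2 - c)"
    using int_l(2)[of _ ?i] int_l(2)[of _ ?j] exp_y_ge
    by (intro add_mono sum_mono diff_right_mono) auto
  also have "(\<Sum>a\<in>A. E.\<Lambda> M / n + E.\<Lambda> M / n) + (\<Sum>b\<in>B. - (4 * M\<^sup>2 * \<theta>) / (real n)\<^sup>2 - c) =
      card A * (2 * E.\<Lambda> M / n) - card B * ((4 * M\<^sup>2 * \<theta> + 32 * \<theta>\<^sup>2) / (real n)\<^sup>2)"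
    by (simp add: c_def power_divide power_mult_distrib add_divide_distrib algebra_simps)
  finally have EY: "card A * (2 * E.\<Lambda> M / n) - card B * ((4 * M\<^sup>2 * \<theta> + 32 * \<theta>\<^sup>2) / (real n)\<^sup>2) \<le> P.expectation Y" .

  have point: "ennreal (exp (Y u)) \<le>
      (\<Prod>a\<in>A. ennreal (1 + E.w (n * u a) + E.w (n * (1 - u a)))) * H (\<lambda>a\<in>A. E.X n (u a))"
    if u: "\<forall>a\<in>A. u a \<in> {0..1}" for u :: "'a \<Rightarrow> real"
  proof -
    have XT: "E.X n (u a) = T - E.X n (1 - u a)" for a
      using E.X_reflect[OF n1, of "u a"] by (simp add: T_def)
    have r: "E.X n (u r) \<in> {0..T}"
      using u root E.X_nonneg[OF n1, of "u r"] E.X_nonneg[OF n1, of "1 - u r"] XT[of r] by auto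
    have sl: "ennreal (1 + y b u) \<le> slack (N b) (\<lambda>a\<in>A. E.X n (u a))" if b: "b \<in> B" for b
    proof -
      have lo: "q1 b u / n \<le> E.X n (u a)" "q2 b u / n \<le> E.X n (1 - u a)" if a: "a \<in> N b" for a
      proof -
        have ua: "0 \<le> u a" "0 \<le> 1 - u a" using u N_sub[OF b] a by auto
        have pos: "0 \<le> E.\<Theta> (min M (n * v))" if "0 \<le> v" for v :: real
          using E.\<Psi>_mono[of 0 "min M (n * v)"] that E.M_pos by (auto simp: E.\<Theta>_def)
        have "q1 b u \<le> E.\<Theta> (min M (n * u a))"
          using E.Q_le_\<Theta>[OF finite_N[OF b] a, of ?i u n] ua pos[of "u a"] by (auto simp: q1_def enn2real_leI)
        then have "q1 b u / n \<le> E.\<Theta> (min M (n * u a)) / n" by (intro divide_right_mono) auto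
        then show "q1 b u / n \<le> E.X n (u a)" using E.X_ge[OF n1 ua(1)] by linarith
        have "q2 b u \<le> E.\<Theta> (min M (n * (1 - u a)))"
          using E.Q_le_\<Theta>[OF finite_N[OF b] a, of ?j u n] ua pos[of "1 - u a"] by (auto simp: q2_def enn2real_leI)
        then have "q2 b u / n \<le> E.\<Theta> (min M (n * (1 - u a))) / n" by (intro divide_right_mono) auto
        then show "q2 b u / n \<le> E.X n (1 - u a)" using E.X_ge[OF n1 ua(2)] by linarith
      qed
      have "1 + y b u = 2 - ((T - q2 b u / n) - q1 b u / n)"
        by (simp add: T y_def add_divide_distrib diff_divide_distrib)
      moreover have "ennreal (2 - ((T - q2 b u / n) - q1 b u / n)) \<le> slack (N b) (\<lambda>a\<in>A. E.X n (u a))"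
      proof (rule slack_ge)
        fix a assume a: "a \<in> N b"
        then have aA: "a \<in> A" using N_sub[OF b] by auto
        show "q1 b u / n \<le> (\<lambda>a\<in>A. E.X n (u a)) a" using lo(1)[OF a] aA by simp
        show "(\<lambda>a\<in>A. E.X n (u a)) a \<le> T - q2 b u / n" using lo(2)[OF a] XT[of a] aA by simp
      qed
      ultimately show ?thesis by (simp only:)
    qed
    have "ennreal (exp (Y u)) = (\<Prod>a\<in>A. ennreal (exp (l (n * u a) + l (n * (1 - u a))))) * (\<Prod>b\<in>B. ennreal (exp (y b u - c)))"
      unfolding Y_def exp_add[of "\<Sum>a\<in>A. _ a"] exp_sum[OF finite_A] exp_sum[OF finite_B]
      by (subst ennreal_mult) (auto intro!: prod_nonneg simp: prod_ennreal)
    also have "\<dots> \<le> (\<Prod>a\<in>A. ennreal (1 + E.w (n * u a) + E.w (n * (1 - u a)))) *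
        (\<Prod>b\<in>B. slack (N b) (\<lambda>a\<in>A. E.X n (u a)))"
      by (intro mult_mono prod_mono_ennreal ennreal_leI E.exp_l_le[OF n1] order_trans[OF ennreal_leI[OF exp_y] sl]) auto
    also have "(\<Prod>b\<in>B. slack (N b) (\<lambda>a\<in>A. E.X n (u a))) = H (\<lambda>a\<in>A. E.X n (u a))"
      using r root by (simp add: H_def)
    finally show ?thesis .
  qed
  have AE: "AE u in ?P. \<forall>a\<in>A. u a \<in> {0..1}"
    unfolding AE_finite_all[OF finite_A]
    by (intro ballI AE_PiM_component[where P="\<lambda>x. x \<in> {0..1}"] prob_space_unit_uniform AE_unit_uniform)

  have wm [measurable]: "E.w \<in> borel_measurable borel" unfolding E.w_def[abs_def] by measurable
  note [measurable] = E.X_measurable[OF n1]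
  have "ennreal (exp (card A * (2 * E.\<Lambda> M / n) - card B * ((4 * M\<^sup>2 * \<theta> + 32 * \<theta>\<^sup>2) / (real n)\<^sup>2)))
     \<le> ennreal (exp (P.expectation Y))"
    using EY by (intro ennreal_leI) simp
  also have "\<dots> \<le> (\<integral>\<^sup>+u. ennreal (exp (Y u)) \<partial>?P)"
    by (rule P.exp_expectation_le_nn_integral[OF int_Y])
  also have "\<dots> \<le> (\<integral>\<^sup>+u. (\<Prod>a\<in>A. ennreal (1 + E.w (n * u a) + E.w (n * (1 - u a)))) * H (\<lambda>a\<in>A. E.X n (u a)) \<partial>?P)"
    using AE by (intro nn_integral_mono_AE) (auto elim!: eventually_mono intro!: point)
  also have "\<dots> \<le> (\<integral>\<^sup>+x. H x \<partial>Pi\<^sub>M A (\<lambda>_. lborel))"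
    by (rule nn_integral_PiM_substitution_le[where v="\<lambda>_ u::real. ennreal (1 + E.w (n * u) + E.w (n * (1 - u)))"
          and X="\<lambda>_. E.X n", OF lborel.sigma_finite_measure_axioms sigma_finite_unit_uniform _ _ _ finite_A Hm])
      (auto intro!: E.nn_integral_X_le[OF n1])
  also have "\<dots> = emeasure lborel {0..T} * vol"
    unfolding H_def by (rule nn_integral_root_in) auto
  also have "\<dots> \<le> ennreal 2 * vol"
  proof (rule mult_right_mono)
    have "2 * E.W / n \<le> 1" using W n2 n0 by (simp add: \<theta>_def field_simps)
    then have "T \<le> 2" "0 \<le> T" using W by (auto simp: T)
    then show "emeasure lborel {0..T} \<le> ennreal 2"
      using ennreal_leI[of T 2] by simp
  qed simp
  finally show ?thesis .
qed

end

subsection \<open>Choice of the edge profile\<close>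

text \<open>The difference of the two sides vanishes at 0 and has derivative z^K / (1 - z) \<ge>
  0.\<close>

lemma sum_power_div_le_minus_ln:
  fixes x :: real
  assumes x: "0 \<le> x" "x < 1"
  shows "(\<Sum>k=1..K. x ^ k / k) \<le> - ln (1 - x)"
proof -
  define g where "g x = - ln (1 - x) - (\<Sum>k=1..K. x ^ k / k)" for x :: real
  have "g 0 \<le> g x"
  proof (rule DERIV_nonneg_imp_nondecreasing[OF x(1)])
    fix z :: real assume z: "0 \<le> z" "z \<le> x"
    have "((\<lambda>x. \<Sum>k=1..K. x ^ k / k) has_real_derivative (\<Sum>k=1..K. real k * z ^ (k - 1) / k)) (at z)"
      by (intro DERIV_sum) (auto intro!: derivative_eq_intros)
    also have "(\<Sum>k=1..K. real k * z ^ (k - 1) / k) = (\<Sum>k<K. z ^ k)"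
      by (rule sum.reindex_bij_witness[of _ Suc "\<lambda>k. k - 1"]) auto
    also have "\<dots> = (1 - z ^ K) / (1 - z)"
      using z x by (subst sum_gp_strict) auto
    finally have 1: "((\<lambda>x. \<Sum>k=1..K. x ^ k / k) has_real_derivative (1 - z ^ K) / (1 - z)) (at z)" .
    have 2: "((\<lambda>x. - ln (1 - x)) has_real_derivative 1 / (1 - z)) (at z)"
      using z x by (auto intro!: derivative_eq_intros)
    have "(g has_real_derivative 1 / (1 - z) - (1 - z ^ K) / (1 - z)) (at z)"
      unfolding g_def by (rule DERIV_diff[OF 2 1])
    moreover have "0 \<le> 1 / (1 - z) - (1 - z ^ K) / (1 - z)"
      using z x by (simp add: diff_divide_distrib[symmetric])
    ultimately show "\<exists>y. (g has_real_derivative y) (at z) \<and> 0 \<le> y" by blast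
  qed
  moreover have "(\<Sum>k=1..K. (0::real) ^ k / k) = 0" by (rule sum.neutral) auto
  ultimately show ?thesis by (simp add: g_def)
qed

text \<open>The optimal profile - ln (1 - exp (- t)) is the series of exp (- k t) / k. Keeping K
  terms removes the singularity at 0; subtracting exp (- M) makes every term nonpositive for t \<ge>
  M, because k t \<ge> M; the maximum with 0 then gives nonnegativity and the support condition. All
  changes stay below the optimal profile, so its constraint is inherited.\<close>

lemma edge_profile_truncated_log:
  assumes "M > 0"
  shows "edge_profile (\<lambda>t. max 0 (\<Sum>k=1..K. (exp (- (real k * t)) - exp (- M)) / k)) M" (is "edge_profile ?l M")
proof
  show "continuous_on UNIV ?l" by (intro continuous_intros) auto
  show "?l t = 0" if t: "t \<ge> M" for t
  proof -
    have "(\<Sum>k=1..K. (exp (- (real k * t)) - exp (- M)) / k) \<le> 0"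
    proof (rule sum_nonpos)
      fix k assume k: "k \<in> {1..K}"
      have "1 * M \<le> real k * t" using k t \<open>M > 0\<close> by (intro mult_mono) auto
      then show "(exp (- (real k * t)) - exp (- M)) / k \<le> 0" by (intro divide_nonpos_nonneg) auto
    qed
    then show ?thesis by simp
  qed
  show "exp (?l t) * (1 - exp (- t)) \<le> 1" if t: "t \<ge> 0" for t
  proof (cases "t = 0")
    case False
    define z where "z = exp (- t)"
    have z: "0 \<le> z" "z < 1" using t False by (auto simp: z_def)
    have "(\<Sum>k=1..K. (exp (- (real k * t)) - exp (- M)) / k) \<le> (\<Sum>k=1..K. z ^ k / k)"
      by (intro sum_mono divide_right_mono) (auto simp: z_def exp_of_nat_mult[symmetric])
    also have "\<dots> \<le> - ln (1 - z)" by (rule sum_power_div_le_minus_ln[OF z])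
    finally have "?l t \<le> - ln (1 - z)" using z by simp
    then have "exp (?l t) \<le> exp (- ln (1 - z))" by simp
    also have "\<dots> = 1 / (1 - z)" using z by (simp add: exp_minus inverse_eq_divide)
    finally show ?thesis using z by (simp add: z_def pos_le_divide_eq)
  qed simp
qed (use assms in auto)

text \<open>Dropping the maximum with 0 only lowers the integrand, and the remaining finite sum has
  the explicit antiderivative \<open>F\<close>.\<close>

lemma edge_profile_\<Lambda>_ge:
  fixes M :: real and K :: nat
  assumes "M > 0"
  defines "l \<equiv> (\<lambda>t. max 0 (\<Sum>k=1..K. (exp (- (real k * t)) - exp (- M)) / k))"
  shows "(\<Sum>k=1..K. (1 - exp (- (real k * M))) / (real k)\<^sup>2 - exp (- M) * M / k) \<le> edge_profile.\<Lambda> l M"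
proof -
  interpret edge_profile l M
    unfolding l_def by (rule edge_profile_truncated_log[OF assms(1)])
  define F where "F t = (\<Sum>k=1..K. (1 - exp (- (real k * t))) / (real k)\<^sup>2 - exp (- M) * t / k)" for t
  have "\<Lambda> 0 - F 0 \<le> \<Lambda> M - F M"
  proof (rule DERIV_nonneg_imp_nondecreasing[where f="\<lambda>t. \<Lambda> t - F t"])
    fix t :: real
    have "(F has_real_derivative (\<Sum>k=1..K. (exp (- (real k * t)) - exp (- M)) / k)) (at t)"
      unfolding F_def
    proof (rule DERIV_sum)
      fix k assume "k \<in> {1..K}"
      then show "((\<lambda>t. (1 - exp (- (real k * t))) / (real k)\<^sup>2 - exp (- M) * t / k) has_real_derivative
          (exp (- (real k * t)) - exp (- M)) / k) (at t)"
        by (auto intro!: derivative_eq_intros simp: power2_eq_square field_simps)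
    qed
    then have "((\<lambda>t. \<Lambda> t - F t) has_real_derivative
        l t - (\<Sum>k=1..K. (exp (- (real k * t)) - exp (- M)) / k)) (at t)"
      using \<Lambda>_deriv by (intro DERIV_diff)
    moreover have "0 \<le> l t - (\<Sum>k=1..K. (exp (- (real k * t)) - exp (- M)) / k)"
      by (simp add: l_def)
    ultimately show "\<exists>y. ((\<lambda>t. \<Lambda> t - F t) has_real_derivative y) (at t) \<and> 0 \<le> y" by blast
  qed (use assms in simp)
  moreover have "F 0 = 0" by (simp add: F_def)
  ultimately show ?thesis by (simp add: F_def)
qed

text \<open>First K is fixed so that the partial sum of 1 / k^2 is close to pi^2 / 6; then M is
  taken large for this K, so that finitely many error terms vanish in the limit.\<close>

lemma edge_profile_near_optimal:
  assumes "\<epsilon> > 0"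
  obtains l M where "edge_profile l M" "edge_profile.\<Lambda> l M > pi\<^sup>2 / 6 - \<epsilon>"
proof -
  have "(\<lambda>K. \<Sum>k<K. 1 / (real k + 1)\<^sup>2) \<longlonglongrightarrow> pi\<^sup>2 / 6"
    using inverse_squares_sums by (simp add: sums_def add.commute)
  then have "\<forall>\<^sub>F K in sequentially. pi\<^sup>2 / 6 - \<epsilon> < (\<Sum>k<K. 1 / (real k + 1)\<^sup>2)"
    using assms by (intro order_tendstoD(1)) auto
  then obtain K where K: "pi\<^sup>2 / 6 - \<epsilon> < (\<Sum>k<K. 1 / (real k + 1)\<^sup>2)"
    by (auto simp: eventually_sequentially)
  also have "(\<Sum>k<K. 1 / (real k + 1)\<^sup>2) = (\<Sum>k=1..K. 1 / (real k)\<^sup>2)"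
    by (rule sum.reindex_bij_witness[of _ "\<lambda>k. k - 1" Suc]) (auto simp: add.commute)
  finally have K: "pi\<^sup>2 / 6 - \<epsilon> < (\<Sum>k=1..K. 1 / (real k)\<^sup>2)" .
  have "((\<lambda>M. \<Sum>k=1..K. (1 - exp (- (real k * M))) / (real k)\<^sup>2 - exp (- M) * M / k) \<longlongrightarrow>
      (\<Sum>k=1..K. (1 - 0) / (real k)\<^sup>2 - 0 / k)) at_top"
  proof (rule tendsto_sum)
    fix k assume "k \<in> {1..K}"
    then have k: "real k > 0" by auto
    have 1: "((\<lambda>M. exp (- (real k * M))) \<longlongrightarrow> 0) at_top" using k by real_asymp
    have 2: "((\<lambda>M::real. exp (- M) * M) \<longlongrightarrow> 0) at_top" by real_asymp
    show "((\<lambda>M. (1 - exp (- (real k * M))) / (real k)\<^sup>2 - exp (- M) * M / k) \<longlongrightarrow>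
      (1 - 0) / (real k)\<^sup>2 - 0 / k) at_top"
      using k by (intro tendsto_intros 1 2) auto
  qed
  then have "\<forall>\<^sub>F M in at_top. pi\<^sup>2 / 6 - \<epsilon> < (\<Sum>k=1..K. (1 - exp (- (real k * M))) / (real k)\<^sup>2 - exp (- M) * M / k)"
    using K by (intro order_tendstoD(1)) auto
  then have "\<forall>\<^sub>F M in at_top. M > 0 \<and> pi\<^sup>2 / 6 - \<epsilon> < (\<Sum>k=1..K. (1 - exp (- (real k * M))) / (real k)\<^sup>2 - exp (- M) * M / k)"
    using eventually_gt_at_top[of 0] by eventually_elim auto
  then obtain M :: real where M: "M > 0"
    "pi\<^sup>2 / 6 - \<epsilon> < (\<Sum>k=1..K. (1 - exp (- (real k * M))) / (real k)\<^sup>2 - exp (- M) * M / k)"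
    by (auto simp: eventually_at_top_linorder)
  show thesis
    by (rule that[OF edge_profile_truncated_log[OF M(1)] less_le_trans[OF M(2) edge_profile_\<Lambda>_ge[OF M(1)]]])
qed

section \<open>The volume of the polytope as an integral over one colour class\<close>

context bipartite_regular
begin

text \<open>Once the values on \<open>A\<close> are fixed, the coordinates in \<open>B\<close> are
  constrained independently of each other, and the admissible values at \<open>b\<close> form a set
  of length \<open>slack (N b)\<close>. Fubini gives the product of slacks; the update at
  \<open>r\<close> reinstates the pinned root value 0.\<close>

lemma emeasure_lipschitz_set:
  fixes Z :: "('a \<Rightarrow> real) set"
  assumes AB: "A \<inter> B = {}"
  defines "I \<equiv> (A - {r}) \<union> B"
  defines "Z \<equiv> {y \<in> space (Pi\<^sub>M I (\<lambda>_. lborel)). \<forall>b\<in>B. \<forall>a\<in>N b. \<bar>(y(r := 0)) a - y b\<bar> \<le> 1}"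
  shows "emeasure (Pi\<^sub>M I (\<lambda>_. lborel)) Z = vol"
proof -
  interpret product_sigma_finite "\<lambda>_::'a. lborel :: real measure" by (rule product_sigma_finite_lborel)
  let ?P = "Pi\<^sub>M I (\<lambda>_. lborel :: real measure)"
  define f where "f y = (\<Prod>b\<in>B. \<Prod>a\<in>N b. indicator {(y(r := 0)) a - 1..(y(r := 0)) a + 1} (y b) :: ennreal)"
    for y :: "'a \<Rightarrow> real"
  have rB: "r \<notin> B" using AB root by auto
  have comp: "(\<lambda>y. (y(r := 0)) a) \<in> borel_measurable ?P" if "a \<in> A \<union> B" for a
  proof (cases "a = r")
    case False
    then have "a \<in> I" using that by (auto simp: I_def)
    then have "(\<lambda>y. y a) \<in> borel_measurable ?P"
      using measurable_component_singleton[of a I "\<lambda>_. lborel :: real measure"] by simp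
    then show ?thesis using False by simp
  qed simp
  have fm: "f \<in> borel_measurable ?P"
    unfolding f_def
  proof (intro borel_measurable_prod_ennreal)
    fix b a assume b: "b \<in> B" and a: "a \<in> N b"
    have "(\<lambda>y. (y(r := 0)) b - (y(r := 0)) a) \<in> borel_measurable ?P"
      using b a N_sub[OF b] by (intro borel_measurable_diff comp) auto
    from measurable_compose[OF this, of "indicator {-1..1} :: real \<Rightarrow> ennreal" borel]
    have "(\<lambda>y. indicator {-1..1} ((y(r := 0)) b - (y(r := 0)) a) :: ennreal) \<in> borel_measurable ?P" by simp
    also have "(\<lambda>y :: 'a \<Rightarrow> real. indicator {-1..1} ((y(r := 0)) b - (y(r := 0)) a) :: ennreal) =
        (\<lambda>y. indicator {(y(r := 0)) a - 1..(y(r := 0)) a + 1} (y b))"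
    proof
      fix y :: "'a \<Rightarrow> real"
      have "(y(r := 0)) b = y b" using b rB by auto
      then show "indicator {-1..1} ((y(r := 0)) b - (y(r := 0)) a) =
          (indicator {(y(r := 0)) a - 1..(y(r := 0)) a + 1} (y b) :: ennreal)"
        by (auto simp: indicator_def simp del: fun_upd_apply)
    qed
    finally show "(\<lambda>y. indicator {(y(r := 0)) a - 1..(y(r := 0)) a + 1} (y b) :: ennreal) \<in> borel_measurable ?P" .
  qed
  have f: "f y = indicator Z y" if "y \<in> space ?P" for y
  proof -
    have ab: "y b \<in> {(y(r := 0)) a - 1..(y(r := 0)) a + 1} \<longleftrightarrow> \<bar>(y(r := 0)) a - y b\<bar> \<le> 1" for a b
      by (simp only: atLeastAtMost_iff) linarith
    show ?thesis
    proof (cases "\<forall>b\<in>B. \<forall>a\<in>N b. \<bar>(y(r := 0)) a - y b\<bar> \<le> 1")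
      case True
      then have "f y = 1"
        unfolding f_def by (intro prod.neutral ballI) (simp only: indicator_def ab, simp)
      then show ?thesis using that True by (simp add: Z_def)
    next
      case False
      then obtain b a where ba: "b \<in> B" "a \<in> N b" "\<not> \<bar>(y(r := 0)) a - y b\<bar> \<le> 1" by blast
      then have "indicator {(y(r := 0)) a - 1..(y(r := 0)) a + 1} (y b) = (0 :: ennreal)"
        using ab[of b a] by (simp only: indicator_def) simp
      then have "(\<Prod>a\<in>N b. indicator {(y(r := 0)) a - 1..(y(r := 0)) a + 1} (y b) :: ennreal) = 0"
        using ba finite_N[OF ba(1)] by (intro prod_zero) blast+
      then have "f y = 0"
        unfolding f_def using ba finite_B by (intro prod_zero) blast+
      moreover have "y \<notin> Z" unfolding Z_def using False by blast
      ultimately show ?thesis by (simp only: indicator_def) simp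
    qed
  qed
  have Zs: "Z \<in> sets ?P"
  proof -
    have "Z = {y \<in> space ?P. f y = 1}"
    proof (intro set_eqI iffI)
      fix y assume "y \<in> Z"
      moreover then have "y \<in> space ?P" by (simp add: Z_def)
      ultimately show "y \<in> {y \<in> space ?P. f y = 1}" using f by simp
    next
      fix y assume "y \<in> {y \<in> space ?P. f y = 1}"
      then show "y \<in> Z" using f[of y] by (auto simp: indicator_def split: if_splits)
    qed
    also have "\<dots> \<in> sets ?P" using fm by measurable
    finally show ?thesis .
  qed
  have "emeasure ?P Z = (\<integral>\<^sup>+y. f y \<partial>?P)"
    unfolding nn_integral_indicator[OF Zs, symmetric] using f by (intro nn_integral_cong) simp
  also have "\<dots> = (\<integral>\<^sup>+x. (\<integral>\<^sup>+y. f (merge (A - {r}) B (x, y)) \<partial>Pi\<^sub>M B (\<lambda>_. lborel)) \<partial>Pi\<^sub>M (A - {r}) (\<lambda>_. lborel))"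
    unfolding I_def using finite_A finite_B AB fm
    by (intro product_nn_integral_fold) (auto simp: I_def)
  also have "\<dots> = vol"
    unfolding vol_def
  proof (rule nn_integral_cong)
    fix x :: "'a \<Rightarrow> real"
    have "f (merge (A - {r}) B (x, y)) =
        (\<Prod>b\<in>B. \<Prod>a\<in>N b. indicator {(x(r := 0)) a - 1..(x(r := 0)) a + 1} (y b))" for y
      unfolding f_def
    proof (intro prod.cong refl)
      fix b a assume b: "b \<in> B" and a: "a \<in> N b"
      then have "a \<in> A" "b \<notin> A" using N_sub[OF b] AB by auto
      then have "((merge (A - {r}) B (x, y))(r := 0)) a = (x(r := 0)) a" "merge (A - {r}) B (x, y) b = y b"
        using b by (auto simp: merge_def)
      then show "indicator {((merge (A - {r}) B (x, y))(r := 0)) a - 1..((merge (A - {r}) B (x, y))(r := 0)) a + 1}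
           (merge (A - {r}) B (x, y) b) =
         (indicator {(x(r := 0)) a - 1..(x(r := 0)) a + 1} (y b) :: ennreal)"
        by (simp only:)
    qed
    then have "(\<integral>\<^sup>+y. f (merge (A - {r}) B (x, y)) \<partial>Pi\<^sub>M B (\<lambda>_. lborel)) =
       (\<integral>\<^sup>+y. (\<Prod>b\<in>B. \<Prod>a\<in>N b. indicator {(x(r := 0)) a - 1..(x(r := 0)) a + 1} (y b)) \<partial>Pi\<^sub>M B (\<lambda>_. lborel))"
      by (simp only:)
    also have "\<dots> = (\<Prod>b\<in>B. slack (N b) (x(r := 0)))"
      unfolding slack_def using finite_B
      by (intro product_nn_integral_prod[where f="\<lambda>b t. \<Prod>a\<in>N b. indicator {(x(r := 0)) a - 1..(x(r := 0)) a + 1} t"]) measurable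
    finally show "(\<integral>\<^sup>+y. f (merge (A - {r}) B (x, y)) \<partial>Pi\<^sub>M B (\<lambda>_. lborel)) = (\<Prod>b\<in>B. slack (N b) (x(r := 0)))" .
  qed
  finally show ?thesis .
qed

end

subsection \<open>The hypercube\<close>

definition differ :: "nat \<Rightarrow> (nat \<Rightarrow> nat) \<Rightarrow> (nat \<Rightarrow> nat) \<Rightarrow> nat set" where
  "differ d u v = {i \<in> {..<d}. u i \<noteq> v i}"

definition flip :: "(nat \<Rightarrow> nat) \<Rightarrow> nat \<Rightarrow> nat \<Rightarrow> nat" where
  "flip v i = v(i := 1 - v i)"

definition cube_nbhd :: "nat \<Rightarrow> (nat \<Rightarrow> nat) \<Rightarrow> (nat \<Rightarrow> nat) set" where
  "cube_nbhd d v = {u \<in> pverts (hypercube d). card (differ d u v) = 1}"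

definition cube_even :: "nat \<Rightarrow> (nat \<Rightarrow> nat) \<Rightarrow> (nat \<Rightarrow> nat) set" where
  "cube_even d r = {v \<in> pverts (hypercube d). even (card (differ d v r))}"

definition cube_odd :: "nat \<Rightarrow> (nat \<Rightarrow> nat) \<Rightarrow> (nat \<Rightarrow> nat) set" where
  "cube_odd d r = {v \<in> pverts (hypercube d). odd (card (differ d v r))}"

lemma finite_differ [simp]: "finite (differ d u v)"
  by (simp add: differ_def)

lemma differ_commute: "differ d u v = differ d v u"
  unfolding differ_def by metis

lemma cube_vertexD: "v \<in> pverts (hypercube d) \<Longrightarrow> i < d \<Longrightarrow> v i = 0 \<or> v i = 1"
  by (auto simp: hypercube_def PiE_iff)

lemma flip_in_cube: "v \<in> pverts (hypercube d) \<Longrightarrow> i < d \<Longrightarrow> flip v i \<in> pverts (hypercube d)"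
  by (auto simp: hypercube_def flip_def PiE_iff extensional_def)

lemma flip_flip:
  assumes "v \<in> pverts (hypercube d)" "i < d"
  shows "flip (flip v i) i = v"
proof -
  have "1 - (1 - v i) = v i" using cube_vertexD[OF assms] by linarith
  then show ?thesis by (simp add: flip_def)
qed

lemma differ_flip_self:
  assumes "v \<in> pverts (hypercube d)" "i < d"
  shows "differ d (flip v i) v = {i}"
proof -
  have "1 - v i \<noteq> v i" using cube_vertexD[OF assms] by linarith
  then show ?thesis using assms(2) by (auto simp: differ_def flip_def simp del: One_nat_def)
qed

text \<open>A flip changes the difference set by the symmetric difference with \<open>{i}\<close>.
  It therefore reverses the parity of the distance to r, which makes the cube bipartite.\<close>

lemma differ_flip:
  assumes "v \<in> pverts (hypercube d)" "r \<in> pverts (hypercube d)" "i < d"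
  shows "differ d (flip v i) r = (if i \<in> differ d v r then differ d v r - {i} else insert i (differ d v r))"
proof -
  have "1 - v i \<noteq> r i \<longleftrightarrow> v i = r i"
    using cube_vertexD[OF assms(1,3)] cube_vertexD[OF assms(2,3)] by linarith
  then have *: "j \<in> differ d (flip v i) r \<longleftrightarrow> (if j = i then v i = r i else j \<in> differ d v r)" for j
    using assms(3) by (simp add: differ_def flip_def)
  have i: "i \<in> differ d v r \<longleftrightarrow> v i \<noteq> r i" using assms(3) by (simp add: differ_def)
  show ?thesis
  proof (rule set_eqI)
    fix j
    show "j \<in> differ d (flip v i) r \<longleftrightarrow>
        j \<in> (if i \<in> differ d v r then differ d v r - {i} else insert i (differ d v r))"
      unfolding *[of j] using i by simp
  qed
qed

lemma even_card_differ_flip: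
  assumes "v \<in> pverts (hypercube d)" "r \<in> pverts (hypercube d)" "i < d"
  shows "even (card (differ d (flip v i) r)) \<longleftrightarrow> odd (card (differ d v r))"
proof (cases "i \<in> differ d v r")
  case True
  then have "card (differ d v r) = Suc (card (differ d v r - {i}))"
    by (metis card_Suc_Diff1 finite_differ)
  moreover have "differ d (flip v i) r = differ d v r - {i}"
    using True by (simp add: differ_flip[OF assms])
  ultimately show ?thesis by (metis even_Suc)
next
  case False
  then show ?thesis by (simp add: differ_flip[OF assms])
qed

lemma cube_eqI:
  assumes "u \<in> pverts (hypercube d)" "v \<in> pverts (hypercube d)" "differ d u v = {}"
  shows "u = v"
proof (rule PiE_ext)
  show "u \<in> {..<d} \<rightarrow>\<^sub>E {0, 1}" "v \<in> {..<d} \<rightarrow>\<^sub>E {0, 1}" using assms by (simp_all add: hypercube_def)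
  show "u i = v i" if "i \<in> {..<d}" for i using assms(3) that by (auto simp: differ_def)
qed

lemma cube_nbhd_eq:
  assumes v: "v \<in> pverts (hypercube d)"
  shows "cube_nbhd d v = flip v ` {..<d}"
proof
  show "flip v ` {..<d} \<subseteq> cube_nbhd d v"
    using flip_in_cube[OF v] differ_flip_self[OF v] by (auto simp: cube_nbhd_def)
  show "cube_nbhd d v \<subseteq> flip v ` {..<d}"
  proof
    fix u assume "u \<in> cube_nbhd d v"
    then have u: "u \<in> pverts (hypercube d)" "card (differ d u v) = 1" by (auto simp: cube_nbhd_def)
    then obtain i where i: "differ d u v = {i}" by (auto simp: card_1_singleton_iff)
    then have id: "i < d" by (auto simp: differ_def)
    have "differ d (flip v i) u = {}"
      using i id differ_flip[OF v u(1) id] by (simp add: differ_commute)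
    then have "flip v i = u" by (rule cube_eqI[OF flip_in_cube[OF v id] u(1)])
    then show "u \<in> flip v ` {..<d}" using id by auto
  qed
qed

lemma card_cube_nbhd:
  assumes v: "v \<in> pverts (hypercube d)"
  shows "card (cube_nbhd d v) = d"
proof -
  have "inj_on (flip v) {..<d}"
  proof (rule inj_onI)
    fix i j assume ij: "i \<in> {..<d}" "j \<in> {..<d}" "flip v i = flip v j"
    have "{i} = differ d (flip v i) v" using differ_flip_self[OF v, of i] ij(1) by simp
    also have "\<dots> = differ d (flip v j) v" by (simp only: ij(3))
    also have "\<dots> = {j}" using differ_flip_self[OF v, of j] ij(2) by simp
    finally show "i = j" by simp
  qed
  then show ?thesis by (simp add: cube_nbhd_eq[OF v] card_image)
qed

lemma finite_cube: "finite (pverts (hypercube d))"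
  using card_hypercube[of d] by (metis card.infinite power_not_zero zero_neq_numeral)

lemma cube_nbhd_sym: "u \<in> pverts (hypercube d) \<Longrightarrow> v \<in> pverts (hypercube d) \<Longrightarrow> u \<in> cube_nbhd d v \<longleftrightarrow> v \<in> cube_nbhd d u"
  unfolding cube_nbhd_def using differ_commute[of d u v] by simp

text \<open>Flipping coordinate 0 is an involution that exchanges the two parity classes.\<close>

lemma card_cube_classes:
  assumes r: "r \<in> pverts (hypercube d)" and d: "d > 0"
  shows "2 * card (cube_even d r) = 2 ^ d" "2 * card (cube_odd d r) = 2 ^ d"
proof -
  have "bij_betw (\<lambda>v. flip v 0) (cube_even d r) (cube_odd d r)"
    using r d by (intro bij_betw_byWitness[where f'="\<lambda>v. flip v 0"])
      (auto simp: cube_even_def cube_odd_def flip_flip flip_in_cube even_card_differ_flip)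
  then have "card (cube_even d r) = card (cube_odd d r)" by (rule bij_betw_same_card)
  moreover have "card (cube_even d r) + card (cube_odd d r) = card (pverts (hypercube d))"
    using finite_cube[of d] by (subst card_Un_disjoint[symmetric]) (auto simp: cube_even_def cube_odd_def intro!: arg_cong[of _ _ card])
  ultimately show "2 * card (cube_even d r) = 2 ^ d" "2 * card (cube_odd d r) = 2 ^ d"
    by (simp_all add: card_hypercube)
qed

text \<open>Regularity and bipartiteness come from the description of neighbours as flips. For
  connectedness, an even vertex other than r differs from r in at least two coordinates; flipping
  two of them reaches an even vertex closer to r that shares a neighbour with the old one, so
  induction on the distance applies.\<close>

lemma bipartite_regular_hypercube:
  assumes r: "r \<in> pverts (hypercube d)" and d: "d > 0"
  shows "bipartite_regular (cube_even d r) (cube_odd d r) (cube_nbhd d) r d"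
proof
  show "finite (cube_even d r)" "finite (cube_odd d r)"
    using finite_cube[of d] by (auto simp: cube_even_def cube_odd_def)
  have odd_nbhd: "cube_nbhd d b \<subseteq> cube_even d r" if "b \<in> cube_odd d r" for b
    using that r by (auto simp: cube_even_def cube_odd_def cube_nbhd_eq flip_in_cube even_card_differ_flip)
  have even_nbhd: "cube_nbhd d a \<subseteq> cube_odd d r" if "a \<in> cube_even d r" for a
    using that r by (auto simp: cube_even_def cube_odd_def cube_nbhd_eq flip_in_cube even_card_differ_flip)
  show "cube_nbhd d b \<subseteq> cube_even d r" "card (cube_nbhd d b) = d" if "b \<in> cube_odd d r" for b
    using odd_nbhd[OF that] that by (auto simp: cube_odd_def card_cube_nbhd)
  show "card {b \<in> cube_odd d r. a \<in> cube_nbhd d b} = d" if a: "a \<in> cube_even d r" for a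
  proof -
    have "{b \<in> cube_odd d r. a \<in> cube_nbhd d b} = cube_nbhd d a"
      using a even_nbhd[OF a] cube_nbhd_sym by (auto simp: cube_even_def cube_odd_def)
    then show ?thesis using a by (simp add: card_cube_nbhd cube_even_def)
  qed
  show "r \<in> cube_even d r" using r by (simp add: cube_even_def differ_def)
  fix k :: "(nat \<Rightarrow> nat) \<Rightarrow> int" and a
  assume k: "\<And>b a a'. b \<in> cube_odd d r \<Longrightarrow> a \<in> cube_nbhd d b \<Longrightarrow> a' \<in> cube_nbhd d b \<Longrightarrow> k a = k a'"
  assume "a \<in> cube_even d r"
  then show "k a = k r"
  proof (induction "card (differ d a r)" arbitrary: a rule: less_induct)
    case less
    have a: "a \<in> pverts (hypercube d)" "even (card (differ d a r))" using less.prems by (auto simp: cube_even_def)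
    show ?case
    proof (cases "differ d a r = {}")
      case True
      then show ?thesis using cube_eqI[OF a(1) r] by simp
    next
      case False
      then obtain i where i: "i \<in> differ d a r" by auto
      \<comment> \<open>The parity of the distance supplies a second coordinate to flip.\<close>
      have "differ d a r \<noteq> {i}" using a(2) by auto
      then obtain j where j: "j \<in> differ d a r" "j \<noteq> i" using i by auto
      have ij: "i < d" "j < d" using i j by (auto simp: differ_def)
      define b where "b = flip a i"
      define a' where "a' = flip b j"
      have b: "b \<in> pverts (hypercube d)" using a ij by (simp add: b_def flip_in_cube)
      have bo: "b \<in> cube_odd d r"
        using a ij b r even_card_differ_flip[OF a(1) r ij(1)] by (simp add: cube_odd_def b_def)
      have a'b: "a' \<in> cube_nbhd d b" using ij by (simp add: cube_nbhd_eq[OF b] a'_def)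
      have ab: "a \<in> cube_nbhd d b"
        unfolding cube_nbhd_eq[OF b] using ij flip_flip[OF a(1) ij(1)]
        by (intro image_eqI[of _ _ i]) (auto simp: b_def)
      have "differ d a' r = differ d a r - {i} - {j}"
        using differ_flip[OF b r ij(2)] differ_flip[OF a(1) r ij(1)] i j by (simp add: a'_def b_def)
      then have "differ d a' r \<subset> differ d a r" using i by auto
      then have "card (differ d a' r) < card (differ d a r)" by (simp add: psubset_card_mono)
      moreover have "a' \<in> cube_even d r" using odd_nbhd[OF bo] a'b by auto
      ultimately have "k a' = k r" using less.hyps by blast
      then show ?thesis using k[OF bo ab a'b] by simp
    qed
  qed
qed (use d in auto)

text \<open>Every edge has exactly one end in the odd class, so the constraints over all arcs are
  those over pairs of an odd vertex and one of its neighbours. Deleting the root coordinate loses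
  nothing, since its value is always 0.\<close>

lemma lipschitz_volume_hypercube:
  assumes r: "r \<in> pverts (hypercube d)" and d: "d > 0"
  shows "lipschitz_volume (hypercube d) r =
    enn2real (bipartite_regular.vol (cube_even d r) (cube_odd d r) (cube_nbhd d) r)"
proof -
  interpret bipartite_regular "cube_even d r" "cube_odd d r" "cube_nbhd d" r d
    by (rule bipartite_regular_hypercube[OF assms])
  let ?A = "cube_even d r" and ?B = "cube_odd d r" and ?V = "pverts (hypercube d)"
  have AB: "?A \<inter> ?B = {}" "?A \<union> ?B = ?V" by (auto simp: cube_even_def cube_odd_def)
  have rB: "r \<notin> ?B" using root AB by auto
  have I: "?V - {r} = (?A - {r}) \<union> ?B" using AB rB by auto
  have arcs: "(u, v) \<in> parcs (hypercube d) \<longleftrightarrow> u \<in> ?V \<and> v \<in> ?V \<and> u \<in> cube_nbhd d v" for u v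
    by (auto simp: hypercube_def cube_nbhd_def differ_def)
  have lip: "(\<forall>(u, v)\<in>parcs (hypercube d). \<bar>x u - x v\<bar> \<le> 1) \<longleftrightarrow> (\<forall>b\<in>?B. \<forall>a\<in>cube_nbhd d b. \<bar>x a - x b\<bar> \<le> (1::real))"
    (is "?l \<longleftrightarrow> ?r") for x
  proof
    show ?r if ?l
    proof (intro ballI)
      fix b a assume "b \<in> ?B" "a \<in> cube_nbhd d b"
      then have "(a, b) \<in> parcs (hypercube d)" using N_sub AB unfolding arcs by blast
      then show "\<bar>x a - x b\<bar> \<le> 1" using that by blast
    qed
    show ?l if ?r
    proof (clarify)
      fix u v assume uv: "(u, v) \<in> parcs (hypercube d)"
      then have uvV: "u \<in> ?V" "v \<in> ?V" "u \<in> cube_nbhd d v" "v \<in> cube_nbhd d u"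
        unfolding arcs using cube_nbhd_sym by auto
      consider "v \<in> ?B" | "u \<in> ?B"
      proof -
        have "u \<in> ?B" if "v \<in> ?A"
        proof -
          have "u \<in> flip v ` {..<d}" using uvV cube_nbhd_eq[of v d] by auto
          then show ?thesis using that r even_card_differ_flip[OF uvV(2) r] uvV(1)
            by (auto simp: cube_even_def cube_odd_def)
        qed
        then show thesis using that uvV(2) AB by blast
      qed
      then show "\<bar>x u - x v\<bar> \<le> 1"
      proof cases
        case 1 then show ?thesis using \<open>?r\<close> uvV by blast
      next
        case 2 then have "\<bar>x v - x u\<bar> \<le> 1" using \<open>?r\<close> uvV by blast
        then show ?thesis by linarith
      qed
    qed
  qed
  have "(\<lambda>x. restrict x (?V - {r})) ` lipschitz_polytope (hypercube d) r =
    {y \<in> space (Pi\<^sub>M ((?A - {r}) \<union> ?B) (\<lambda>_. lborel)). \<forall>b\<in>?B. \<forall>a\<in>cube_nbhd d b. \<bar>(y(r := 0)) a - y b\<bar> \<le> (1::real)}"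
    (is "?L = ?R")
  proof (intro set_eqI iffI)
    fix y assume "y \<in> ?L"
    then obtain x where x: "x \<in> lipschitz_polytope (hypercube d) r" "y = restrict x (?V - {r})" by auto
    then have xr: "x r = 0" and xl: "\<And>b a. b \<in> ?B \<Longrightarrow> a \<in> cube_nbhd d b \<Longrightarrow> \<bar>x a - x b\<bar> \<le> 1"
      using lip[of x] by (auto simp: lipschitz_polytope_def)
    have "\<bar>(y(r := 0)) a - y b\<bar> \<le> 1" if "b \<in> ?B" "a \<in> cube_nbhd d b" for a b
    proof -
      have "a \<in> ?V" "b \<in> ?V" "b \<noteq> r" using that N_sub[OF that(1)] AB rB by auto
      then have "(y(r := 0)) a = x a" "y b = x b" using xr by (auto simp: x(2))
      then show ?thesis using xl[OF that] by (simp only:)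
    qed
    moreover have "y \<in> space (Pi\<^sub>M ((?A - {r}) \<union> ?B) (\<lambda>_. lborel))"
      unfolding I[symmetric] by (auto simp: space_PiM x(2))
    ultimately show "y \<in> ?R" by blast
  next
    fix y assume y: "y \<in> ?R"
    then have ys: "y \<in> extensional (?V - {r})" unfolding I by (auto simp: space_PiM PiE_iff)
    define x where "x = y(r := 0)"
    have "x \<in> ?V \<rightarrow>\<^sub>E UNIV" using ys r by (auto simp: x_def PiE_iff extensional_def)
    moreover have "x r = 0" by (simp add: x_def)
    moreover have "\<forall>b\<in>?B. \<forall>a\<in>cube_nbhd d b. \<bar>x a - x b\<bar> \<le> 1"
    proof (intro ballI)
      fix b a assume ba: "b \<in> ?B" "a \<in> cube_nbhd d b"
      then have "x b = y b" using rB by (auto simp: x_def)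
      moreover have "\<bar>x a - y b\<bar> \<le> 1" using y ba unfolding x_def by blast
      ultimately show "\<bar>x a - x b\<bar> \<le> 1" by (simp only:)
    qed
    ultimately have "x \<in> lipschitz_polytope (hypercube d) r" using lip[of x] by (simp add: lipschitz_polytope_def)
    moreover have "y = restrict x (?V - {r})" using ys by (auto simp: x_def extensional_def restrict_def fun_eq_iff)
    ultimately show "y \<in> ?L" by blast
  qed
  then show ?thesis
    using emeasure_lipschitz_set[OF AB(1)] by (simp only: lipschitz_volume_def I measure_def)
qed

section \<open>Logarithms and asymptotics\<close>

lemma ln_growth_constant_hypercube:
  assumes r: "r \<in> pverts (hypercube d)" and d: "d > 0" and v: "lipschitz_volume (hypercube d) r > 0"
  shows "ln (growth_constant (hypercube d) r) = ln (lipschitz_volume (hypercube d) r) / (2 ^ d - 1)"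
proof -
  have "(2::nat) ^ d > 1" by (rule one_less_power) (use d in auto)
  then show ?thesis using v by (simp add: growth_constant_def card_hypercube ln_root of_nat_diff)
qed

text \<open>The bound of \<open>nn_integral_slack_power_le\<close> for \<open>L = 5\<close>.\<close>

definition clique_weight :: "nat \<Rightarrow> real" where
  "clique_weight d = (real d)\<^sup>2 * (9 * (4 * exp 1 / sqrt (real (d - 2))))"

text \<open>Finiteness is recorded separately because \<open>enn2real\<close> sends \<top> to 0:
  only with it does the lower bound for \<open>vol\<close> carry over to the real-valued volume. The
  factor L = 5 in front of \<open>vol\<close> is simply discarded.\<close>

lemma lipschitz_volume_hypercube_le:
  assumes r: "r \<in> pverts (hypercube d)" and d: "d \<ge> 3"
  shows "bipartite_regular.vol (cube_even d r) (cube_odd d r) (cube_nbhd d) r < \<top>"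
    and "lipschitz_volume (hypercube d) r \<le> root d (clique_weight d) ^ card (cube_odd d r)"
proof -
  interpret bipartite_regular "cube_even d r" "cube_odd d r" "cube_nbhd d" r d
    using r d by (intro bipartite_regular_hypercube) auto
  have cw: "clique_weight d \<ge> 0" by (simp add: clique_weight_def)
  have "ennreal 5 * vol \<le> eroot d (ennreal (clique_weight d)) ^ card (cube_odd d r)"
  proof (rule vol_le)
    fix b a assume "b \<in> cube_odd d r" "a \<in> cube_nbhd d b"
    then show "(\<integral>\<^sup>+x. indicator {0..<5} (x a) * slack (cube_nbhd d b) x ^ d \<partial>Pi\<^sub>M (cube_nbhd d b) (\<lambda>_. lborel))
        \<le> ennreal (clique_weight d)"
      using nn_integral_slack_power_le[of "cube_nbhd d b" "d - 2" a 5] finite_N card_N d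
      by (simp add: clique_weight_def)
  qed simp
  also have "\<dots> = ennreal (root d (clique_weight d) ^ card (cube_odd d r))"
    using cw d by (simp add: eroot_ennreal ennreal_power real_root_pos_pos_le)
  finally have 5: "ennreal 5 * vol \<le> ennreal (root d (clique_weight d) ^ card (cube_odd d r))" .
  have "1 * vol \<le> ennreal 5 * vol" by (intro mult_right_mono) auto
  then have v: "vol \<le> ennreal (root d (clique_weight d) ^ card (cube_odd d r))" using 5 by simp
  then show "vol < \<top>" using ennreal_less_top le_less_trans by blast
  have "lipschitz_volume (hypercube d) r = enn2real vol"
    using r d by (intro lipschitz_volume_hypercube) auto
  also have "\<dots> \<le> root d (clique_weight d) ^ card (cube_odd d r)"
    using v cw by (intro enn2real_leI) (auto simp: real_root_pos_pos_le)
  finally show "lipschitz_volume (hypercube d) r \<le> root d (clique_weight d) ^ card (cube_odd d r)" .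
qed

text \<open>Both classes have 2^(d-1) elements, which turns 2 \<Lambda> / d into \<Lambda> / d and
  halves \<open>C\<close>. The summand - ln 2 pays for the factor in front of
  \<open>vol\<close>.\<close>

lemma lipschitz_volume_hypercube_ge:
  assumes r: "r \<in> pverts (hypercube d)" and d: "d \<ge> 3" and E: "edge_profile l M"
    and large: "real d \<ge> 2 * M" "real d \<ge> 8 * edge_profile.\<Theta> l M"
  defines "C \<equiv> 4 * M\<^sup>2 * edge_profile.\<Theta> l M + 32 * (edge_profile.\<Theta> l M)\<^sup>2"
  shows "lipschitz_volume (hypercube d) r > 0"
    and "2 ^ d * (edge_profile.\<Lambda> l M / d - C / (2 * (real d)\<^sup>2)) - ln 2 \<le> ln (lipschitz_volume (hypercube d) r)"
proof -
  have d0: "d > 0" using d by simp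
  interpret bipartite_regular "cube_even d r" "cube_odd d r" "cube_nbhd d" r d
    by (rule bipartite_regular_hypercube[OF r d0])
  define e where "e = 2 ^ d * (edge_profile.\<Lambda> l M / d - C / (2 * (real d)\<^sup>2))"
  have c: "real (card (cube_even d r)) = 2 ^ d / 2" "real (card (cube_odd d r)) = 2 ^ d / 2"
    using card_cube_classes[OF r d0] by (metis nonzero_mult_div_cancel_left of_nat_mult of_nat_numeral of_nat_power zero_neq_numeral)+
  have "e = card (cube_even d r) * (2 * edge_profile.\<Lambda> l M / d) - card (cube_odd d r) * (C / (real d)\<^sup>2)"
    unfolding c by (simp add: e_def algebra_simps)
  then have "ennreal (exp e) \<le> ennreal 2 * vol"
    using vol_ge[OF E large] by (simp only: C_def)
  also have "vol = ennreal (lipschitz_volume (hypercube d) r)"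
    using lipschitz_volume_hypercube_le(1)[OF r d] lipschitz_volume_hypercube[OF r d0] by simp
  finally have "ennreal (exp e) \<le> ennreal (2 * lipschitz_volume (hypercube d) r)"
    by (subst ennreal_mult) (auto simp: lipschitz_volume_def)
  then have le: "exp e \<le> 2 * lipschitz_volume (hypercube d) r"
    by (subst (asm) ennreal_le_iff) (auto simp: lipschitz_volume_def)
  moreover have "0 < exp e" by simp
  ultimately show pos: "lipschitz_volume (hypercube d) r > 0" by linarith
  have "e \<le> ln (2 * lipschitz_volume (hypercube d) r)" using le pos by (simp add: ln_ge_iff)
  then show "2 ^ d * (edge_profile.\<Lambda> l M / d - C / (2 * (real d)\<^sup>2)) - ln 2 \<le> ln (lipschitz_volume (hypercube d) r)"
    using pos by (simp add: ln_mult e_def)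
qed

text \<open>For a fixed profile the errors C / d^2 and ln 2 / 2^d are negligible against 1/d, so d
  times the lower bound tends to \<Lambda>, which exceeds pi^2 / 6 - \<epsilon>.\<close>

lemma ln_growth_constant_hypercube_ge:
  assumes "\<epsilon> > 0"
  shows "\<forall>\<^sub>F d in sequentially. \<forall>r \<in> pverts (hypercube d).
    lipschitz_volume (hypercube d) r > 0 \<and> pi\<^sup>2 / (6 * real d) - \<epsilon> / d \<le> ln (growth_constant (hypercube d) r)"
proof -
  obtain l M where E: "edge_profile l M" "edge_profile.\<Lambda> l M > pi\<^sup>2 / 6 - \<epsilon>"
    using edge_profile_near_optimal[OF assms] .
  define \<Lambda> where "\<Lambda> = edge_profile.\<Lambda> l M"
  define C where "C = 4 * M\<^sup>2 * edge_profile.\<Theta> l M + 32 * (edge_profile.\<Theta> l M)\<^sup>2"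
  have "((\<lambda>d::nat. real d * ((2 ^ d * (\<Lambda> / d - C / (2 * (real d)\<^sup>2)) - ln 2) / (2 ^ d - 1))) \<longlongrightarrow> \<Lambda>) sequentially"
    by real_asymp
  then have lim: "\<forall>\<^sub>F d::nat in sequentially. pi\<^sup>2 / 6 - \<epsilon> < real d * ((2 ^ d * (\<Lambda> / d - C / (2 * (real d)\<^sup>2)) - ln 2) / (2 ^ d - 1))"
    using E(2) by (intro order_tendstoD(1)) (auto simp: \<Lambda>_def)
  have "\<forall>\<^sub>F d::nat in sequentially. real d \<ge> K" for K by real_asymp
  from lim eventually_ge_at_top[of 3] this[of "2 * M"] this[of "8 * edge_profile.\<Theta> l M"]
  show ?thesis
  proof eventually_elim
    case (elim d)
    show ?case
    proof (intro ballI conjI)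
      fix r assume r: "r \<in> pverts (hypercube d)"
      note ge = lipschitz_volume_hypercube_ge[OF r elim(2) E(1) elim(3,4), folded \<Lambda>_def C_def]
      show "lipschitz_volume (hypercube d) r > 0" by (rule ge(1))
      have d: "d > 0" "real d > 0" "(2::real) ^ d - 1 > 0" using elim(2) by (auto simp: one_less_power)
      have "pi\<^sup>2 / (6 * real d) - \<epsilon> / d = (pi\<^sup>2 / 6 - \<epsilon>) / d" by (simp add: diff_divide_distrib)
      also have "\<dots> \<le> real d * ((2 ^ d * (\<Lambda> / d - C / (2 * (real d)\<^sup>2)) - ln 2) / (2 ^ d - 1)) / d"
        using elim(1) d by (intro divide_right_mono) auto
      also have "\<dots> = (2 ^ d * (\<Lambda> / d - C / (2 * (real d)\<^sup>2)) - ln 2) / (2 ^ d - 1)"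
        using d by simp
      also have "\<dots> \<le> ln (lipschitz_volume (hypercube d) r) / (2 ^ d - 1)"
        using ge(2) d by (intro divide_right_mono) auto
      also have "\<dots> = ln (growth_constant (hypercube d) r)"
        by (rule ln_growth_constant_hypercube[symmetric, OF r d(1) ge(1)])
      finally show "pi\<^sup>2 / (6 * real d) - \<epsilon> / d \<le> ln (growth_constant (hypercube d) r)" .
    qed
  qed
qed

text \<open>The first factor tends to 1/2 and ln (\<open>clique_weight d\<close>) grows like (3/2)
  ln d; this is the origin of the constant 3/4.\<close>

lemma ln_growth_constant_hypercube_le:
  assumes r: "r \<in> pverts (hypercube d)" and d: "d \<ge> 3" and v: "lipschitz_volume (hypercube d) r > 0"
  shows "ln (growth_constant (hypercube d) r) \<le> (2 ^ d / 2) / (2 ^ d - 1) * (ln (clique_weight d) / d)"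
proof -
  have d0: "d > 0" "(2::real) ^ d - 1 > 0" using d by (auto simp: one_less_power)
  have cw: "clique_weight d > 0" using d by (simp add: clique_weight_def)
  have c: "real (card (cube_odd d r)) = 2 ^ d / 2"
    using card_cube_classes(2)[OF r d0(1)] by (metis nonzero_mult_div_cancel_left of_nat_mult of_nat_numeral of_nat_power zero_neq_numeral)
  have "ln (lipschitz_volume (hypercube d) r) \<le> ln (root d (clique_weight d) ^ card (cube_odd d r))"
    using lipschitz_volume_hypercube_le(2)[OF r d] v by simp
  also have "\<dots> = card (cube_odd d r) * (ln (clique_weight d) / d)"
    using cw d0 by (simp add: ln_realpow ln_root)
  also have "\<dots> = (2 ^ d / 2) * (ln (clique_weight d) / d)"
    unfolding c ..
  finally show ?thesis
    using ln_growth_constant_hypercube[OF r d0(1) v] divide_right_mono[of _ _ "2 ^ d - 1 :: real"] d0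
    by (metis (no_types, lifting) less_imp_le times_divide_eq_left)
qed

theorem theorem5p2:
  shows "\<exists>f g :: nat \<Rightarrow> real.
           f \<in> o(\<lambda>d. 1 / real d) \<and> g \<in> o(\<lambda>_. 1) \<and>
           (\<forall>\<^sub>F d in sequentially. \<forall>r \<in> pverts (hypercube d).
              pi\<^sup>2 / (6 * real d) + f d \<le> ln (growth_constant (hypercube d) r) \<and>
              ln (growth_constant (hypercube d) r) \<le> (3 / 4 + g d) * (ln (real d) / real d))"
proof -
  \<comment> \<open>Taking the worst root makes the error uniform in r and the lower bound true for
    every d by definition; the content lies in f being o(1/d). The minimum with 0 leaves only the
    deficit to be estimated.\<close>
  define f where "f d = min 0 (Min ((\<lambda>r. ln (growth_constant (hypercube d) r)) ` pverts (hypercube d)) - pi\<^sup>2 / (6 * real d))" for d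
  \<comment> \<open>The exact coefficient of ln d / d in the upper bound. The subtraction in
    \<open>real d - 2\<close> is real, unlike the one in \<open>clique_weight\<close>; the two agree
    for d \<ge> 2.\<close>
  define h where "h d = (2 ^ d / 2) / (2 ^ d - 1) * (ln ((real d)\<^sup>2 * (9 * (4 * exp 1 / sqrt (real d - 2)))) / ln (real d))" for d :: nat
  define g where "g d = h d - 3 / 4" for d
  have f_le: "pi\<^sup>2 / (6 * real d) + f d \<le> ln (growth_constant (hypercube d) r)" if "r \<in> pverts (hypercube d)" for d r
  proof -
    have "Min ((\<lambda>r. ln (growth_constant (hypercube d) r)) ` pverts (hypercube d)) \<le> ln (growth_constant (hypercube d) r)"
      using that finite_cube[of d] by (intro Min_le) auto
    then show ?thesis unfolding f_def by linarith
  qed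
  have "f \<in> o(\<lambda>d. 1 / real d)"
  proof (rule landau_o.smallI)
    fix \<epsilon> :: real assume "\<epsilon> > 0"
    from ln_growth_constant_hypercube_ge[OF this]
    show "\<forall>\<^sub>F d in sequentially. norm (f d) \<le> \<epsilon> * norm (1 / real d)"
    proof eventually_elim
      case (elim d)
      have ne: "pverts (hypercube d) \<noteq> {}" using card_hypercube[of d] by (metis card.empty power_not_zero zero_neq_numeral)
      have "pi\<^sup>2 / (6 * real d) - \<epsilon> / d \<le> Min ((\<lambda>r. ln (growth_constant (hypercube d) r)) ` pverts (hypercube d))"
        using elim ne finite_cube[of d] by (subst Min_ge_iff) auto
      moreover have "0 \<le> \<epsilon> / d" using \<open>\<epsilon> > 0\<close> by simp
      ultimately show ?case unfolding f_def by simp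
    qed
  qed
  moreover have "g \<in> o(\<lambda>_. 1)"
  proof -
    have "g \<longlonglongrightarrow> 0" unfolding g_def h_def by real_asymp
    then show ?thesis by (intro smalloI_tendsto) auto
  qed
  moreover have "\<forall>\<^sub>F d in sequentially. \<forall>r \<in> pverts (hypercube d).
      ln (growth_constant (hypercube d) r) \<le> (3 / 4 + g d) * (ln (real d) / real d)"
    \<comment> \<open>The lower bound, with an arbitrary tolerance 1, supplies the positivity of the
      volume under which the logarithm is controlled from above.\<close>
    using ln_growth_constant_hypercube_ge[of 1, OF zero_less_one] eventually_ge_at_top[of 3]
  proof eventually_elim
    case (elim d)
    have "ln (real d) > 0" using elim(2) by simp
    then have "(2 ^ d / 2) / (2 ^ d - 1) * (ln (clique_weight d) / d) = (3 / 4 + g d) * (ln (real d) / real d)"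
      using elim(2) by (simp add: g_def h_def clique_weight_def of_nat_diff)
    then show ?case using ln_growth_constant_hypercube_le[of _ d] elim by simp
  qed
  ultimately show ?thesis using f_le
    by (intro exI[of _ f] exI[of _ g] conjI) (auto elim!: eventually_mono)
qed

end
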